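(* Every pivotal monoidal category is equivalent, as a pivotal monoidal category, to a strict pivotal monoidal category. That is, for every pivotal monoidal category $\mathcal C$ there exist a strict pivotal monoidal category $\mathcal D$ and a monoidal equivalence between $\mathcal C$ and $\mathcal D$ which preserves the pivotal structure.
   Context: Conventions. In a monoidal category the associativity isomorphism is $\Phi\colon (U\otimes V)\otimes W\to U\otimes (V\otimes W)$ and the unit object $I$ is assumed strict: $V\otimes I=V=I\otimes V$. An object also denotes its identity morphism; composition is written by juxtaposition. A (left) dual of $V$ is a triple $(V^\vee,\mathrm{ev}_V,\mathrm{db}_V)$ with $\mathrm{ev}_V\colon V^\vee\otimes V\to I$ and $\mathrm{db}_V\colon I\to V\otimes V^\vee$ such that $(V\otimes \mathrm{ev}_V)\Phi(\mathrm{db}_V\otimes V)=\mathrm{id}_V$ and $(\mathrm{ev}_V\otimes V^\vee)\Phi^{-1}(V^\vee\otimes\mathrm{db}_V)=\mathrm{id}_{V^\vee}$. A category is rigid if every object has a left dual; a choice of duals is fixed, with $I^\vee=I$ and $\mathrm{ev}_I,\mathrm{db}_I$ identities. Then $(-)^\vee$ is a contravariant functor: for $f\colon V\to W$, $f^\vee\colon W^\vee\to V^\vee$ is determined by $\mathrm{ev}_V(f^\vee\otimes V)=\mathrm{ev}_W(W^\vee\otimes f)$. Let $\widetilde{\mathrm{ev}}\colon (W^\vee\otimes V^\vee)\otimes(V\otimes W)\to I$ be the composite of the canonical associativity isomorphism to $W^\vee\otimes((V^\vee\otimes V)\otimes W)$, $W^\vee\otimes\mathrm{ev}_V\otimes W$,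 and $\mathrm{ev}_W$. There is a unique isomorphism $\zeta\colon W^\vee\otimes V^\vee\to(V\otimes W)^\vee$ with $\mathrm{ev}_{V\otimes W}(\zeta\otimes (V\otimes W))=\widetilde{\mathrm{ev}}$; these form the (contravariant) monoidal functor structure of $(-)^\vee$, and $(-)^{\vee\vee}$ becomes a monoidal functor with structure $(\zeta^{-1})^\vee\zeta\colon V^{\vee\vee}\otimes W^{\vee\vee}\to (W^\vee\otimes V^\vee)^\vee\to(V\otimes W)^{\vee\vee}$. A pivotal monoidal category is a rigid monoidal category with a pivotal structure, i.e. an isomorphism $j\colon V\to V^{\vee\vee}$ of monoidal functors from the identity functor to $(-)^{\vee\vee}$. A strict pivotal monoidal category is a pivotal monoidal category whose monoidal structure is strict (all $\Phi$ are identities), and for which both the monoidal functor structure $\zeta$ of $(-)^\vee$ (so $(V\otimes W)^\vee=W^\vee\otimes V^\vee$) and the pivotal structure $j$ (so $V^{\vee\vee}=V$) are identities. A monoidal functor $(\mathcal F,\xi)\colon\mathcal C\to\mathcal D$ has natural coherent isomorphisms $\xi\colon \mathcal F(V)\otimes\mathcal F(W)\to\mathcal F(V\otimes W)$ and satisfies $\mathcal F(I)=I$ with identity unit structure. For $\mathcal C,\mathcal D$ rigid, $\mathcal F(X^\vee)$ is a left dual of $\mathcal F(X)$ with evaluation $\mathcal F(\mathrm{ev}_X)\xi$ and dual basis morphism $\xi^{-1}\mathcal F(\mathrm{db}_X)$; let $\tilde\xi_X\colon\mathcal F(X^\vee)\to\mathcal F(X)^\vee$ be the resulting canonical isomorphism,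 determined by $\mathrm{ev}_{\mathcal F(X)}(\tilde\xi_X\otimes\mathcal F(X))=\mathcal F(\mathrm{ev}_X)\xi$. If $\mathcal C,\mathcal D$ are pivotal, $\mathcal F$ preserves the pivotal structure if $\tilde\xi_{X^\vee}\mathcal F(j_X)=(\tilde\xi_X)^\vee j_{\mathcal F(X)}$ as morphisms $\mathcal F(X)\to\mathcal F(X^\vee)^\vee$, for all $X$. *)

theory Defs
  imports Main
begin

section \<open>Categories, functors, natural isomorphisms\<close>

record ('o, 'a) cat_data =
  Obj :: "'o set"
  Arr :: "'a set"
  Dom :: "'a \<Rightarrow> 'o"
  Cod :: "'a \<Rightarrow> 'o"
  Idn :: "'o \<Rightarrow> 'a" ("\<iota>\<index>")
  cmp :: "'a \<Rightarrow> 'a \<Rightarrow> 'a" (infixr "\<cdot>\<index>" 55)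

definition Hom :: "('o, 'a, 'm) cat_data_scheme \<Rightarrow> 'o \<Rightarrow> 'o \<Rightarrow> 'a set"
  where "Hom C V W = {f \<in> Arr C. Dom C f = V \<and> Cod C f = W}"

locale category =
  fixes C :: "('o, 'a, 'm) cat_data_scheme" (structure)
  assumes Dom_Obj: "f \<in> Arr C \<Longrightarrow> Dom C f \<in> Obj C"
    and Cod_Obj: "f \<in> Arr C \<Longrightarrow> Cod C f \<in> Obj C"
    and Idn_Hom: "V \<in> Obj C \<Longrightarrow> \<iota> V \<in> Hom C V V"
    and cmp_Hom: "f \<in> Hom C U V \<Longrightarrow> g \<in> Hom C V W \<Longrightarrow> g \<cdot> f \<in> Hom C U W"
    and cmp_Idn_right: "f \<in> Hom C U V \<Longrightarrow> f \<cdot> \<iota> U = f"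
    and cmp_Idn_left: "f \<in> Hom C U V \<Longrightarrow> \<iota> V \<cdot> f = f"
    and cmp_assoc: "f \<in> Hom C T U \<Longrightarrow> g \<in> Hom C U V \<Longrightarrow> h \<in> Hom C V W \<Longrightarrow>
      (h \<cdot> g) \<cdot> f = h \<cdot> (g \<cdot> f)"

definition inverse_arrs :: "('o, 'a, 'm) cat_data_scheme \<Rightarrow> 'a \<Rightarrow> 'a \<Rightarrow> bool"
  where "inverse_arrs C f g \<longleftrightarrow>
    f \<in> Arr C \<and> g \<in> Hom C (Cod C f) (Dom C f) \<and>
    cmp C g f = Idn C (Dom C f) \<and> cmp C f g = Idn C (Cod C f)"

definition is_iso :: "('o, 'a, 'm) cat_data_scheme \<Rightarrow> 'a \<Rightarrow> bool"
  where "is_iso C f \<longleftrightarrow> (\<exists>g. inverse_arrs C f g)"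

definition inv_arr :: "('o, 'a, 'm) cat_data_scheme \<Rightarrow> 'a \<Rightarrow> 'a"
  where "inv_arr C f = (THE g. inverse_arrs C f g)"

record ('o, 'a, 'p, 'b) fun_data =
  on_obj :: "'o \<Rightarrow> 'p"
  on_arr :: "'a \<Rightarrow> 'b"

definition is_functor ::
  "('o, 'a, 'm) cat_data_scheme \<Rightarrow> ('p, 'b, 'n) cat_data_scheme \<Rightarrow>
   ('o, 'a, 'p, 'b, 'k) fun_data_scheme \<Rightarrow> bool"
  where "is_functor C D F \<longleftrightarrow>
    (\<forall>V\<in>Obj C. on_obj F V \<in> Obj D) \<and>
    (\<forall>f\<in>Arr C. on_arr F f \<in> Hom D (on_obj F (Dom C f)) (on_obj F (Cod C f))) \<and>
    (\<forall>V\<in>Obj C. on_arr F (Idn C V) = Idn D (on_obj F V)) \<and>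
    (\<forall>f\<in>Arr C. \<forall>g\<in>Arr C. Cod C f = Dom C g \<longrightarrow>
      on_arr F (cmp C g f) = cmp D (on_arr F g) (on_arr F f))"

definition natural_iso ::
  "('o, 'a, 'm) cat_data_scheme \<Rightarrow> ('p, 'b, 'n) cat_data_scheme \<Rightarrow>
   ('o, 'a, 'p, 'b, 'k) fun_data_scheme \<Rightarrow> ('o, 'a, 'p, 'b, 'l) fun_data_scheme \<Rightarrow>
   ('o \<Rightarrow> 'b) \<Rightarrow> bool"
  where "natural_iso C D F G t \<longleftrightarrow>
    (\<forall>V\<in>Obj C. t V \<in> Hom D (on_obj F V) (on_obj G V) \<and> is_iso D (t V)) \<and>
    (\<forall>f\<in>Arr C. cmp D (t (Cod C f)) (on_arr F f) = cmp D (on_arr G f) (t (Dom C f)))"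

definition id_fun :: "('o, 'a, 'o, 'a) fun_data"
  where "id_fun = \<lparr>on_obj = (\<lambda>V. V), on_arr = (\<lambda>f. f)\<rparr>"

definition comp_fun ::
  "('p, 'b, 'q, 'c, 'k) fun_data_scheme \<Rightarrow> ('o, 'a, 'p, 'b, 'l) fun_data_scheme \<Rightarrow>
   ('o, 'a, 'q, 'c) fun_data"
  where "comp_fun G F =
    \<lparr>on_obj = (\<lambda>V. on_obj G (on_obj F V)), on_arr = (\<lambda>f. on_arr G (on_arr F f))\<rparr>"

definition is_equivalence ::
  "('o, 'a, 'm) cat_data_scheme \<Rightarrow> ('p, 'b, 'n) cat_data_scheme \<Rightarrow>
   ('o, 'a, 'p, 'b, 'k) fun_data_scheme \<Rightarrow> bool"
  where "is_equivalence C D F \<longleftrightarrow>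
    is_functor C D F \<and>
    (\<exists>(G :: ('p, 'b, 'o, 'a) fun_data) s t. is_functor D C G \<and>
      natural_iso C C id_fun (comp_fun G F) s \<and>
      natural_iso D D (comp_fun F G) id_fun t)"


section \<open>Monoidal categories with strict unit\<close>

text \<open>The tensor product is written \<open>\<otimes>\<close> on objects and \<open>\<boxtimes>\<close> on arrows.\<close>

record ('o, 'a) mon_data = "('o, 'a) cat_data" +
  unit_obj :: "'o" ("\<I>\<index>")
  tens_obj :: "'o \<Rightarrow> 'o \<Rightarrow> 'o" (infixr "\<otimes>\<index>" 70)
  tens_arr :: "'a \<Rightarrow> 'a \<Rightarrow> 'a" (infixr "\<boxtimes>\<index>" 70)
  assoc :: "'o \<Rightarrow> 'o \<Rightarrow> 'o \<Rightarrow> 'a" ("\<Phi>\<index>")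

text \<open>
  The unit constraints are identities. Their naturality becomes
  \<open>tens_arr_unit_right\<close> and \<open>tens_arr_unit_left\<close>, and the triangle axiom says that
  the middle-unit component of \<open>\<Phi>\<close> is an identity.
\<close>

locale monoidal_category = category C
  for C :: "('o, 'a, 'm) mon_data_scheme" (structure) +
  assumes unit_Obj: "\<I> \<in> Obj C"
    and tens_Obj: "V \<in> Obj C \<Longrightarrow> W \<in> Obj C \<Longrightarrow> V \<otimes> W \<in> Obj C"
    and tens_Hom: "f \<in> Hom C V V' \<Longrightarrow> g \<in> Hom C W W' \<Longrightarrow>
      f \<boxtimes> g \<in> Hom C (V \<otimes> W) (V' \<otimes> W')"
    and tens_Idn: "V \<in> Obj C \<Longrightarrow> W \<in> Obj C \<Longrightarrow> \<iota> V \<boxtimes> \<iota> W = \<iota> (V \<otimes> W)"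
    and tens_cmp: "f \<in> Hom C U V \<Longrightarrow> g \<in> Hom C V W \<Longrightarrow>
      f' \<in> Hom C U' V' \<Longrightarrow> g' \<in> Hom C V' W' \<Longrightarrow>
      (g \<cdot> f) \<boxtimes> (g' \<cdot> f') = (g \<boxtimes> g') \<cdot> (f \<boxtimes> f')"
    and assoc_Hom: "U \<in> Obj C \<Longrightarrow> V \<in> Obj C \<Longrightarrow> W \<in> Obj C \<Longrightarrow>
      \<Phi> U V W \<in> Hom C ((U \<otimes> V) \<otimes> W) (U \<otimes> (V \<otimes> W))"
    and assoc_iso: "U \<in> Obj C \<Longrightarrow> V \<in> Obj C \<Longrightarrow> W \<in> Obj C \<Longrightarrow> is_iso C (\<Phi> U V W)"
    and assoc_natural: "f \<in> Hom C U U' \<Longrightarrow> g \<in> Hom C V V' \<Longrightarrow> h \<in> Hom C W W' \<Longrightarrow>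
      \<Phi> U' V' W' \<cdot> ((f \<boxtimes> g) \<boxtimes> h) = (f \<boxtimes> (g \<boxtimes> h)) \<cdot> \<Phi> U V W"
    and pentagon: "T \<in> Obj C \<Longrightarrow> U \<in> Obj C \<Longrightarrow> V \<in> Obj C \<Longrightarrow> W \<in> Obj C \<Longrightarrow>
      (\<iota> T \<boxtimes> \<Phi> U V W) \<cdot> \<Phi> T (U \<otimes> V) W \<cdot> (\<Phi> T U V \<boxtimes> \<iota> W)
        = \<Phi> T U (V \<otimes> W) \<cdot> \<Phi> (T \<otimes> U) V W"
    and tens_unit_right: "V \<in> Obj C \<Longrightarrow> V \<otimes> \<I> = V"
    and tens_unit_left: "V \<in> Obj C \<Longrightarrow> \<I> \<otimes> V = V"
    and tens_arr_unit_right: "f \<in> Arr C \<Longrightarrow> f \<boxtimes> \<iota> \<I> = f"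
    and tens_arr_unit_left: "f \<in> Arr C \<Longrightarrow> \<iota> \<I> \<boxtimes> f = f"
    and triangle: "V \<in> Obj C \<Longrightarrow> W \<in> Obj C \<Longrightarrow> \<Phi> V \<I> W = \<iota> (V \<otimes> W)"

locale strict_monoidal_category = monoidal_category +
  assumes strict_tens: "U \<in> Obj C \<Longrightarrow> V \<in> Obj C \<Longrightarrow> W \<in> Obj C \<Longrightarrow>
      (U \<otimes> V) \<otimes> W = U \<otimes> (V \<otimes> W)"
    and strict_assoc: "U \<in> Obj C \<Longrightarrow> V \<in> Obj C \<Longrightarrow> W \<in> Obj C \<Longrightarrow>
      \<Phi> U V W = \<iota> (U \<otimes> (V \<otimes> W))"

record ('o, 'a, 'p, 'b) mon_fun_data = "('o, 'a, 'p, 'b) fun_data" +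
  mon_str :: "'o \<Rightarrow> 'o \<Rightarrow> 'b"

text \<open>The unit structure \<open>\<I> = F \<I>\<close> is an identity, so the unit coherence of
  \<open>\<xi> = mon_str F\<close> says that its components at the unit are identities.\<close>

definition is_monoidal_functor ::
  "('o, 'a, 'm) mon_data_scheme \<Rightarrow> ('p, 'b, 'n) mon_data_scheme \<Rightarrow>
   ('o, 'a, 'p, 'b, 'k) mon_fun_data_scheme \<Rightarrow> bool"
  where "is_monoidal_functor C D F \<longleftrightarrow>
    is_functor C D F \<and>
    on_obj F \<I>\<^bsub>C\<^esub> = \<I>\<^bsub>D\<^esub> \<and>
    (\<forall>V\<in>Obj C. \<forall>W\<in>Obj C.
      mon_str F V W \<in> Hom D (on_obj F V \<otimes>\<^bsub>D\<^esub> on_obj F W) (on_obj F (V \<otimes>\<^bsub>C\<^esub> W)) \<and>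
      is_iso D (mon_str F V W)) \<and>
    (\<forall>f\<in>Arr C. \<forall>g\<in>Arr C.
      mon_str F (Cod C f) (Cod C g) \<cdot>\<^bsub>D\<^esub> (on_arr F f \<boxtimes>\<^bsub>D\<^esub> on_arr F g)
        = on_arr F (f \<boxtimes>\<^bsub>C\<^esub> g) \<cdot>\<^bsub>D\<^esub> mon_str F (Dom C f) (Dom C g)) \<and>
    (\<forall>U\<in>Obj C. \<forall>V\<in>Obj C. \<forall>W\<in>Obj C.
      on_arr F (\<Phi>\<^bsub>C\<^esub> U V W) \<cdot>\<^bsub>D\<^esub> mon_str F (U \<otimes>\<^bsub>C\<^esub> V) W
          \<cdot>\<^bsub>D\<^esub> (mon_str F U V \<boxtimes>\<^bsub>D\<^esub> \<iota>\<^bsub>D\<^esub> (on_obj F W))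
        = mon_str F U (V \<otimes>\<^bsub>C\<^esub> W) \<cdot>\<^bsub>D\<^esub> (\<iota>\<^bsub>D\<^esub> (on_obj F U) \<boxtimes>\<^bsub>D\<^esub> mon_str F V W)
          \<cdot>\<^bsub>D\<^esub> \<Phi>\<^bsub>D\<^esub> (on_obj F U) (on_obj F V) (on_obj F W)) \<and>
    (\<forall>V\<in>Obj C. mon_str F V \<I>\<^bsub>C\<^esub> = \<iota>\<^bsub>D\<^esub> (on_obj F V) \<and>
      mon_str F \<I>\<^bsub>C\<^esub> V = \<iota>\<^bsub>D\<^esub> (on_obj F V))"

definition monoidal_natural_iso ::
  "('o, 'a, 'm) mon_data_scheme \<Rightarrow> ('p, 'b, 'n) mon_data_scheme \<Rightarrow>
   ('o, 'a, 'p, 'b, 'k) mon_fun_data_scheme \<Rightarrow> ('o, 'a, 'p, 'b, 'l) mon_fun_data_scheme \<Rightarrow>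
   ('o \<Rightarrow> 'b) \<Rightarrow> bool"
  where "monoidal_natural_iso C D F G t \<longleftrightarrow>
    natural_iso C D F G t \<and>
    (\<forall>V\<in>Obj C. \<forall>W\<in>Obj C.
      t (V \<otimes>\<^bsub>C\<^esub> W) \<cdot>\<^bsub>D\<^esub> mon_str F V W = mon_str G V W \<cdot>\<^bsub>D\<^esub> (t V \<boxtimes>\<^bsub>D\<^esub> t W)) \<and>
    t \<I>\<^bsub>C\<^esub> = \<iota>\<^bsub>D\<^esub> \<I>\<^bsub>D\<^esub>"

definition id_mon_fun :: "('o, 'a, 'm) mon_data_scheme \<Rightarrow> ('o, 'a, 'o, 'a) mon_fun_data"
  where "id_mon_fun C = \<lparr>on_obj = (\<lambda>V. V), on_arr = (\<lambda>f. f),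
    mon_str = (\<lambda>V W. \<iota>\<^bsub>C\<^esub> (V \<otimes>\<^bsub>C\<^esub> W))\<rparr>"


section \<open>Rigid categories\<close>

record ('o, 'a) rigid_data = "('o, 'a) mon_data" +
  dual :: "'o \<Rightarrow> 'o"
  ev :: "'o \<Rightarrow> 'a"
  db :: "'o \<Rightarrow> 'a"

locale rigid_category = monoidal_category C
  for C :: "('o, 'a, 'm) rigid_data_scheme" (structure) +
  assumes dual_Obj: "V \<in> Obj C \<Longrightarrow> dual C V \<in> Obj C"
    and ev_Hom: "V \<in> Obj C \<Longrightarrow> ev C V \<in> Hom C (dual C V \<otimes> V) \<I>"
    and db_Hom: "V \<in> Obj C \<Longrightarrow> db C V \<in> Hom C \<I> (V \<otimes> dual C V)"
    and zigzag: "V \<in> Obj C \<Longrightarrow>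
      (\<iota> V \<boxtimes> ev C V) \<cdot> \<Phi> V (dual C V) V \<cdot> (db C V \<boxtimes> \<iota> V) = \<iota> V"
    and zigzag_dual: "V \<in> Obj C \<Longrightarrow>
      (ev C V \<boxtimes> \<iota> (dual C V)) \<cdot> inv_arr C (\<Phi> (dual C V) V (dual C V))
        \<cdot> (\<iota> (dual C V) \<boxtimes> db C V) = \<iota> (dual C V)"
    and dual_unit: "dual C \<I> = \<I>"
    and ev_unit: "ev C \<I> = \<iota> \<I>"
    and db_unit: "db C \<I> = \<iota> \<I>"

text \<open>
  Duals have a universal property: an arrow \<open>h\<close> from \<open>X \<otimes> V\<close> to \<open>\<I>\<close> is
  \<open>ev V \<cdot> (g \<boxtimes> \<iota> V)\<close> for a unique arrow \<open>g\<close> from \<open>X\<close> to the dual of \<open>V\<close>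
  (\<open>ex1_mate\<close> below). The arrows \<open>dual_arr\<close>, \<open>zeta\<close> and \<open>xi_tilde\<close> are all
  determined by an equation of this form.
\<close>

definition mate :: "('o, 'a, 'm) rigid_data_scheme \<Rightarrow> 'o \<Rightarrow> 'o \<Rightarrow> 'a \<Rightarrow> 'a"
  where "mate C X V h =
    (THE g. g \<in> Hom C X (dual C V) \<and> ev C V \<cdot>\<^bsub>C\<^esub> (g \<boxtimes>\<^bsub>C\<^esub> \<iota>\<^bsub>C\<^esub> V) = h)"

context category
begin

lemma HomD: "f \<in> Hom C V W \<Longrightarrow> f \<in> Arr C" "f \<in> Hom C V W \<Longrightarrow> Dom C f = V"
    "f \<in> Hom C V W \<Longrightarrow> Cod C f = W"
  by (auto simp: Hom_def)

lemma HomI: "f \<in> Arr C \<Longrightarrow> Dom C f = V \<Longrightarrow> Cod C f = W \<Longrightarrow> f \<in> Hom C V W"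
  by (auto simp: Hom_def)

lemma Idn_arr:
  assumes "V \<in> Obj C"
  shows "\<iota> V \<in> Arr C" "Dom C (\<iota> V) = V" "Cod C (\<iota> V) = V"
  using HomD[OF Idn_Hom[OF assms]] by auto

lemma cmp_arr:
  assumes "f \<in> Arr C" "g \<in> Arr C" "Cod C f = Dom C g"
  shows "g \<cdot> f \<in> Arr C" "Dom C (g \<cdot> f) = Dom C f" "Cod C (g \<cdot> f) = Cod C g"
proof -
  have "g \<cdot> f \<in> Hom C (Dom C f) (Cod C g)"
    using assms by (intro cmp_Hom[where V = "Dom C g"]) (auto intro: HomI)
  from HomD[OF this]
  show "g \<cdot> f \<in> Arr C" "Dom C (g \<cdot> f) = Dom C f" "Cod C (g \<cdot> f) = Cod C g" by auto
qed

lemma cmp_assoc_arr: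
  assumes "f \<in> Arr C" "g \<in> Arr C" "h \<in> Arr C" "Cod C f = Dom C g" "Cod C g = Dom C h"
  shows "(h \<cdot> g) \<cdot> f = h \<cdot> g \<cdot> f"
  by (rule cmp_assoc[where U = "Dom C g" and V = "Dom C h"]) (use assms in \<open>auto intro: HomI\<close>)

lemma cmp_Idn_arr:
  assumes "f \<in> Arr C"
  shows "f \<cdot> \<iota> (Dom C f) = f" "\<iota> (Cod C f) \<cdot> f = f"
  using assms by (auto intro!: cmp_Idn_right cmp_Idn_left HomI)

lemma inverse_arrs_unique:
  assumes "inverse_arrs C f g" "inverse_arrs C f h"
  shows "g = h"
proof -
  have f: "f \<in> Arr C" "g \<in> Arr C" "h \<in> Arr C" "Dom C g = Cod C f" "Cod C g = Dom C f"
      "Dom C h = Cod C f" "Cod C h = Dom C f"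
    using assms by (auto simp: inverse_arrs_def Hom_def)
  have "g = (h \<cdot> f) \<cdot> g"
    using assms f cmp_Idn_arr(2)[of g] by (simp add: inverse_arrs_def)
  also have "\<dots> = h \<cdot> f \<cdot> g"
    using f by (simp add: cmp_assoc_arr)
  also have "\<dots> = h"
    using assms f cmp_Idn_arr(1)[of h] by (simp add: inverse_arrs_def)
  finally show ?thesis .
qed

lemma inverse_arrs_inv_arr: "is_iso C f \<Longrightarrow> inverse_arrs C f (inv_arr C f)"
  unfolding is_iso_def inv_arr_def
  by (metis inverse_arrs_unique theI)

lemma inv_arr:
  assumes "is_iso C f"
  shows "f \<in> Arr C" "inv_arr C f \<in> Arr C" "Dom C (inv_arr C f) = Cod C f"
    "Cod C (inv_arr C f) = Dom C f" "inv_arr C f \<cdot> f = \<iota> (Dom C f)" "f \<cdot> inv_arr C f = \<iota> (Cod C f)"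
  using inverse_arrs_inv_arr[OF assms] by (auto simp: inverse_arrs_def Hom_def)

lemma iso_cancel_left:
  assumes "is_iso C f" "g \<in> Arr C" "h \<in> Arr C" "Cod C g = Dom C f" "Cod C h = Dom C f"
    "f \<cdot> g = f \<cdot> h"
  shows "g = h"
proof -
  have "(inv_arr C f \<cdot> f) \<cdot> g = (inv_arr C f \<cdot> f) \<cdot> h"
    using assms inv_arr(1-4)[OF assms(1)] by (simp add: cmp_assoc_arr)
  then show ?thesis
    using assms inv_arr(5)[OF assms(1)] cmp_Idn_arr(2)[of g] cmp_Idn_arr(2)[of h] by simp
qed

end

context monoidal_category
begin

lemma tens_arr:
  assumes "f \<in> Arr C" "g \<in> Arr C"
  shows "f \<boxtimes> g \<in> Arr C" "Dom C (f \<boxtimes> g) = Dom C f \<otimes> Dom C g"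
    "Cod C (f \<boxtimes> g) = Cod C f \<otimes> Cod C g"
proof -
  have "f \<boxtimes> g \<in> Hom C (Dom C f \<otimes> Dom C g) (Cod C f \<otimes> Cod C g)"
    using assms by (intro tens_Hom) (auto intro: HomI)
  from HomD[OF this]
  show "f \<boxtimes> g \<in> Arr C" "Dom C (f \<boxtimes> g) = Dom C f \<otimes> Dom C g"
    "Cod C (f \<boxtimes> g) = Cod C f \<otimes> Cod C g" by auto
qed

lemma assoc_arr:
  assumes "U \<in> Obj C" "V \<in> Obj C" "W \<in> Obj C"
  shows "\<Phi> U V W \<in> Arr C" "Dom C (\<Phi> U V W) = (U \<otimes> V) \<otimes> W" "Cod C (\<Phi> U V W) = U \<otimes> (V \<otimes> W)"
  using HomD[OF assoc_Hom[OF assms]] by auto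

lemma inv_assoc_arr:
  assumes "U \<in> Obj C" "V \<in> Obj C" "W \<in> Obj C"
  shows "inv_arr C (\<Phi> U V W) \<in> Arr C" "Dom C (inv_arr C (\<Phi> U V W)) = U \<otimes> (V \<otimes> W)"
    "Cod C (inv_arr C (\<Phi> U V W)) = (U \<otimes> V) \<otimes> W"
    "inv_arr C (\<Phi> U V W) \<cdot> \<Phi> U V W = \<iota> ((U \<otimes> V) \<otimes> W)"
    "\<Phi> U V W \<cdot> inv_arr C (\<Phi> U V W) = \<iota> (U \<otimes> (V \<otimes> W))"
  using inv_arr[OF assoc_iso[OF assms]] assoc_arr[OF assms] by auto

lemma tens_cmp_arr:
  assumes "f \<in> Arr C" "g \<in> Arr C" "f' \<in> Arr C" "g' \<in> Arr C"
    "Cod C f = Dom C g" "Cod C f' = Dom C g'"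
  shows "(g \<boxtimes> g') \<cdot> (f \<boxtimes> f') = (g \<cdot> f) \<boxtimes> (g' \<cdot> f')"
  using assms by (intro tens_cmp[symmetric, where V = "Dom C g" and V' = "Dom C g'"])
    (auto intro: HomI)

lemmas arr_simps = Idn_arr cmp_arr tens_arr assoc_arr inv_assoc_arr(1-3) unit_Obj tens_Obj
  tens_Idn cmp_Idn_arr tens_unit_left tens_unit_right

lemma assoc_natural_arr:
  assumes "f \<in> Arr C" "g \<in> Arr C" "h \<in> Arr C"
  shows "\<Phi> (Cod C f) (Cod C g) (Cod C h) \<cdot> ((f \<boxtimes> g) \<boxtimes> h)
    = (f \<boxtimes> (g \<boxtimes> h)) \<cdot> \<Phi> (Dom C f) (Dom C g) (Dom C h)"
  using assms by (intro assoc_natural) (auto intro: HomI)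

lemma assoc_unit_left:
  assumes "V \<in> Obj C" "W \<in> Obj C"
  shows "\<Phi> \<I> V W = \<iota> (V \<otimes> W)"
proof (rule iso_cancel_left[OF assoc_iso[OF unit_Obj assms]])
  have "\<Phi> \<I> V W \<cdot> \<Phi> \<I> V W \<cdot> \<iota> ((\<I> \<otimes> V) \<otimes> W) = \<iota> (V \<otimes> W) \<cdot> \<Phi> \<I> V W"
    using pentagon[OF unit_Obj unit_Obj assms] assms
    by (simp add: arr_simps triangle tens_arr_unit_left)
  then show "\<Phi> \<I> V W \<cdot> \<Phi> \<I> V W = \<Phi> \<I> V W \<cdot> \<iota> (V \<otimes> W)"
    using assms cmp_Idn_arr[of "\<Phi> \<I> V W"] by (simp add: arr_simps)
qed (use assms in \<open>simp_all add: arr_simps\<close>)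

lemma assoc_unit_right:
  assumes "V \<in> Obj C" "W \<in> Obj C"
  shows "\<Phi> V W \<I> = \<iota> (V \<otimes> W)"
proof (rule iso_cancel_left[OF assoc_iso[OF assms unit_Obj]])
  have "\<iota> (V \<otimes> W) \<cdot> \<Phi> V W \<I> \<cdot> \<Phi> V W \<I> = \<Phi> V W \<I> \<cdot> \<iota> (V \<otimes> W)"
    using pentagon[OF assms unit_Obj unit_Obj] assms
    by (simp add: arr_simps triangle tens_arr_unit_right)
  then show "\<Phi> V W \<I> \<cdot> \<Phi> V W \<I> = \<Phi> V W \<I> \<cdot> \<iota> (V \<otimes> W)"
    using assms cmp_Idn_arr(2)[of "\<Phi> V W \<I> \<cdot> \<Phi> V W \<I>"] by (simp add: arr_simps)
qed (use assms in \<open>simp_all add: arr_simps\<close>)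

lemma tens_cmp_Idn:
  assumes "f \<in> Arr C" "g \<in> Arr C" "X \<in> Obj C" "Cod C f = Dom C g"
  shows "(\<iota> X \<boxtimes> g) \<cdot> (\<iota> X \<boxtimes> f) = \<iota> X \<boxtimes> (g \<cdot> f)"
    "(g \<boxtimes> \<iota> X) \<cdot> (f \<boxtimes> \<iota> X) = (g \<cdot> f) \<boxtimes> \<iota> X"
  using assms cmp_Idn_arr(1)[of "\<iota> X"] by (simp_all add: tens_cmp_arr Idn_arr)

lemma tens_swap:
  assumes "f \<in> Arr C" "g \<in> Arr C"
  shows "(f \<boxtimes> \<iota> (Cod C g)) \<cdot> (\<iota> (Dom C f) \<boxtimes> g) = f \<boxtimes> g"
    "(\<iota> (Cod C f) \<boxtimes> g) \<cdot> (f \<boxtimes> \<iota> (Dom C g)) = f \<boxtimes> g"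
  using assms by (simp_all add: tens_cmp_arr Idn_arr Dom_Obj Cod_Obj cmp_Idn_arr)

end

context rigid_category
begin

lemma ev_arr:
  assumes "V \<in> Obj C"
  shows "ev C V \<in> Arr C" "Dom C (ev C V) = dual C V \<otimes> V" "Cod C (ev C V) = \<I>"
  using HomD[OF ev_Hom[OF assms]] by auto

lemma db_arr:
  assumes "V \<in> Obj C"
  shows "db C V \<in> Arr C" "Dom C (db C V) = \<I>" "Cod C (db C V) = V \<otimes> dual C V"
  using HomD[OF db_Hom[OF assms]] by auto

lemmas rigid_simps = arr_simps ev_arr db_arr dual_Obj

lemma ex1_mate:
  assumes X: "X \<in> Obj C" and V: "V \<in> Obj C" and h: "h \<in> Hom C (X \<otimes> V) \<I>"
  shows "\<exists>!g. g \<in> Hom C X (dual C V) \<and> ev C V \<cdot> (g \<boxtimes> \<iota> V) = h"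
proof -
  define V' where "V' = dual C V"
  have V': "V' \<in> Obj C" using V by (simp add: V'_def dual_Obj)
  have ev: "ev C V \<in> Arr C" "Dom C (ev C V) = V' \<otimes> V" "Cod C (ev C V) = \<I>"
    and db: "db C V \<in> Arr C" "Dom C (db C V) = \<I>" "Cod C (db C V) = V \<otimes> V'"
    using V by (auto simp: V'_def ev_arr db_arr)
  note h = HomD[OF h]
  define P where "P = inv_arr C (\<Phi> X V V')"
  have P: "P \<in> Arr C" "Dom C P = X \<otimes> (V \<otimes> V')" "Cod C P = (X \<otimes> V) \<otimes> V'"
    "P \<cdot> \<Phi> X V V' = \<iota> ((X \<otimes> V) \<otimes> V')" "\<Phi> X V V' \<cdot> P = \<iota> (X \<otimes> (V \<otimes> V'))"
    using X V V' by (simp_all add: P_def inv_assoc_arr)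
  define g where "g = (h \<boxtimes> \<iota> V') \<cdot> P \<cdot> (\<iota> X \<boxtimes> db C V)"
  note S = arr_simps X V V' ev db h P(1-3)
  have g: "g \<in> Arr C" "Dom C g = X" "Cod C g = V'"
    by (simp_all add: g_def S)

  define k where "k = \<Phi> (X \<otimes> V) V' V \<cdot> (P \<boxtimes> \<iota> V) \<cdot> ((\<iota> X \<boxtimes> db C V) \<boxtimes> \<iota> V)"
  have k: "k \<in> Arr C" "Dom C k = X \<otimes> V" "Cod C k = (X \<otimes> V) \<otimes> (V' \<otimes> V)"
    by (simp_all add: k_def S)
  have k_eq: "\<Phi> X V (V' \<otimes> V) \<cdot> k = \<iota> X \<boxtimes> (\<Phi> V V' V \<cdot> (db C V \<boxtimes> \<iota> V))"
  proof -
    have "\<Phi> X V (V' \<otimes> V) \<cdot> k =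
        (\<Phi> X V (V' \<otimes> V) \<cdot> \<Phi> (X \<otimes> V) V' V) \<cdot> (P \<boxtimes> \<iota> V) \<cdot> ((\<iota> X \<boxtimes> db C V) \<boxtimes> \<iota> V)"
      by (simp add: k_def S cmp_assoc_arr)
    also have "\<dots> = (\<iota> X \<boxtimes> \<Phi> V V' V) \<cdot> \<Phi> X (V \<otimes> V') V \<cdot>
        ((\<Phi> X V V' \<boxtimes> \<iota> V) \<cdot> (P \<boxtimes> \<iota> V)) \<cdot> ((\<iota> X \<boxtimes> db C V) \<boxtimes> \<iota> V)"
      by (simp add: pentagon[OF X V V' V, symmetric] cmp_assoc_arr S)
    also have "(\<Phi> X V V' \<boxtimes> \<iota> V) \<cdot> (P \<boxtimes> \<iota> V) = \<iota> ((X \<otimes> (V \<otimes> V')) \<otimes> V)"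
      by (subst tens_cmp_Idn) (simp_all add: S P(5))
    also have "\<iota> ((X \<otimes> (V \<otimes> V')) \<otimes> V) \<cdot> ((\<iota> X \<boxtimes> db C V) \<boxtimes> \<iota> V)
        = ((\<iota> X \<boxtimes> db C V) \<boxtimes> \<iota> V)"
      using cmp_Idn_arr(2)[of "(\<iota> X \<boxtimes> db C V) \<boxtimes> \<iota> V"] by (simp add: S)
    also have "\<Phi> X (V \<otimes> V') V \<cdot> ((\<iota> X \<boxtimes> db C V) \<boxtimes> \<iota> V) = \<iota> X \<boxtimes> (db C V \<boxtimes> \<iota> V)"
      using assoc_natural_arr[of "\<iota> X" "db C V" "\<iota> V"]
        cmp_Idn_arr(1)[of "\<iota> X \<boxtimes> (db C V \<boxtimes> \<iota> V)"]
      by (simp add: S triangle)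
    also have "(\<iota> X \<boxtimes> \<Phi> V V' V) \<cdot> (\<iota> X \<boxtimes> (db C V \<boxtimes> \<iota> V)) = \<iota> X \<boxtimes> (\<Phi> V V' V \<cdot> (db C V \<boxtimes> \<iota> V))"
      by (rule tens_cmp_Idn) (simp_all add: S)
    finally show ?thesis .
  qed
  have ev_k: "(\<iota> (X \<otimes> V) \<boxtimes> ev C V) \<cdot> k = \<iota> (X \<otimes> V)"
  proof -
    have "\<iota> (X \<otimes> V) \<boxtimes> ev C V = (\<iota> X \<boxtimes> (\<iota> V \<boxtimes> ev C V)) \<cdot> \<Phi> X V (V' \<otimes> V)"
      using assoc_natural_arr[of "\<iota> X" "\<iota> V" "ev C V"]
        cmp_Idn_arr(2)[of "\<iota> (X \<otimes> V) \<boxtimes> ev C V"]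
      by (simp add: S assoc_unit_right)
    then have "(\<iota> (X \<otimes> V) \<boxtimes> ev C V) \<cdot> k
        = (\<iota> X \<boxtimes> (\<iota> V \<boxtimes> ev C V)) \<cdot> (\<iota> X \<boxtimes> (\<Phi> V V' V \<cdot> (db C V \<boxtimes> \<iota> V)))"
      by (simp add: cmp_assoc_arr S k k_eq)
    also have "\<dots> = \<iota> X \<boxtimes> ((\<iota> V \<boxtimes> ev C V) \<cdot> \<Phi> V V' V \<cdot> (db C V \<boxtimes> \<iota> V))"
      by (rule tens_cmp_Idn) (simp_all add: S)
    also have "\<dots> = \<iota> (X \<otimes> V)"
      using zigzag[OF V] by (simp add: V'_def[symmetric] S)
    finally show ?thesis .
  qed
  have "(h \<boxtimes> \<iota> V') \<boxtimes> \<iota> V = (h \<boxtimes> \<iota> (V' \<otimes> V)) \<cdot> \<Phi> (X \<otimes> V) V' V"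
    using assoc_natural_arr[of h "\<iota> V'" "\<iota> V"] cmp_Idn_arr(2)[of "(h \<boxtimes> \<iota> V') \<boxtimes> \<iota> V"]
    by (simp add: S assoc_unit_left)
  moreover have "g \<boxtimes> \<iota> V
      = ((h \<boxtimes> \<iota> V') \<boxtimes> \<iota> V) \<cdot> (P \<boxtimes> \<iota> V) \<cdot> ((\<iota> X \<boxtimes> db C V) \<boxtimes> \<iota> V)"
    by (simp add: g_def tens_cmp_Idn S)
  ultimately have "g \<boxtimes> \<iota> V = (h \<boxtimes> \<iota> (V' \<otimes> V)) \<cdot> k"
    by (simp add: k_def cmp_assoc_arr S)
  then have "ev C V \<cdot> (g \<boxtimes> \<iota> V) = (ev C V \<cdot> (h \<boxtimes> \<iota> (V' \<otimes> V))) \<cdot> k"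
    by (simp add: cmp_assoc_arr S k)
  also have "ev C V \<cdot> (h \<boxtimes> \<iota> (V' \<otimes> V)) = h \<cdot> (\<iota> (X \<otimes> V) \<boxtimes> ev C V)"
    using tens_swap[of h "ev C V"] by (simp add: S tens_arr_unit_left tens_arr_unit_right)
  also have "(h \<cdot> (\<iota> (X \<otimes> V) \<boxtimes> ev C V)) \<cdot> k = h"
    using cmp_Idn_arr(1)[of h] by (simp add: cmp_assoc_arr S k ev_k)
  finally have ex: "ev C V \<cdot> (g \<boxtimes> \<iota> V) = h" .

  have unique: "g' = g" if g': "g' \<in> Hom C X V'" and eq: "ev C V \<cdot> (g' \<boxtimes> \<iota> V) = h" for g'
  proof -
    note g' = HomD[OF g']
    define Q where "Q = inv_arr C (\<Phi> V' V V')"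
    have Q: "Q \<in> Arr C" "Dom C Q = V' \<otimes> (V \<otimes> V')" "Cod C Q = (V' \<otimes> V) \<otimes> V'"
      "Q \<cdot> \<Phi> V' V V' = \<iota> ((V' \<otimes> V) \<otimes> V')"
      using V V' by (simp_all add: Q_def inv_assoc_arr)
    note S = S g' Q(1-3)
    have nat: "((g' \<boxtimes> \<iota> V) \<boxtimes> \<iota> V') \<cdot> P = Q \<cdot> (g' \<boxtimes> \<iota> (V \<otimes> V'))"
    proof -
      have "\<Phi> V' V V' \<cdot> ((g' \<boxtimes> \<iota> V) \<boxtimes> \<iota> V') = (g' \<boxtimes> \<iota> (V \<otimes> V')) \<cdot> \<Phi> X V V'"
        using assoc_natural_arr[of g' "\<iota> V" "\<iota> V'"] by (simp add: S)
      then have "(Q \<cdot> \<Phi> V' V V' \<cdot> ((g' \<boxtimes> \<iota> V) \<boxtimes> \<iota> V')) \<cdot> P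
          = (Q \<cdot> (g' \<boxtimes> \<iota> (V \<otimes> V')) \<cdot> \<Phi> X V V') \<cdot> P"
        by simp
      then have "(Q \<cdot> \<Phi> V' V V') \<cdot> ((g' \<boxtimes> \<iota> V) \<boxtimes> \<iota> V') \<cdot> P
          = Q \<cdot> (g' \<boxtimes> \<iota> (V \<otimes> V')) \<cdot> (\<Phi> X V V' \<cdot> P)"
        by (simp add: cmp_assoc_arr S)
      then show ?thesis
        using cmp_Idn_arr(2)[of "((g' \<boxtimes> \<iota> V) \<boxtimes> \<iota> V') \<cdot> P"]
          cmp_Idn_arr(1)[of "g' \<boxtimes> \<iota> (V \<otimes> V')"]
        by (simp add: S Q(4) P(5))
    qed
    have "g = ((ev C V \<boxtimes> \<iota> V') \<cdot> ((g' \<boxtimes> \<iota> V) \<boxtimes> \<iota> V')) \<cdot> P \<cdot> (\<iota> X \<boxtimes> db C V)"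
      by (simp add: g_def eq[symmetric] tens_cmp_Idn S)
    also have "\<dots> = (ev C V \<boxtimes> \<iota> V') \<cdot> (((g' \<boxtimes> \<iota> V) \<boxtimes> \<iota> V') \<cdot> P) \<cdot> (\<iota> X \<boxtimes> db C V)"
      by (simp add: cmp_assoc_arr S)
    also have "\<dots> = (ev C V \<boxtimes> \<iota> V') \<cdot> Q \<cdot> ((g' \<boxtimes> \<iota> (V \<otimes> V')) \<cdot> (\<iota> X \<boxtimes> db C V))"
      by (simp add: nat cmp_assoc_arr S)
    also have "(g' \<boxtimes> \<iota> (V \<otimes> V')) \<cdot> (\<iota> X \<boxtimes> db C V) = (\<iota> V' \<boxtimes> db C V) \<cdot> g'"
      using tens_swap[of g' "db C V"] by (simp add: S tens_arr_unit_right)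
    also have "(ev C V \<boxtimes> \<iota> V') \<cdot> Q \<cdot> (\<iota> V' \<boxtimes> db C V) \<cdot> g'
        = ((ev C V \<boxtimes> \<iota> V') \<cdot> Q \<cdot> (\<iota> V' \<boxtimes> db C V)) \<cdot> g'"
      by (simp add: cmp_assoc_arr S)
    also have "\<dots> = g'"
      using zigzag_dual[OF V] cmp_Idn_arr(2)[of g'] by (simp add: V'_def[symmetric] Q_def S)
    finally show ?thesis by simp
  qed
  show ?thesis
    using g ex unique by (auto simp: V'_def intro!: ex1I[of _ g] HomI)
qed

lemma mate:
  assumes "X \<in> Obj C" "V \<in> Obj C" "h \<in> Hom C (X \<otimes> V) \<I>"
  shows "mate C X V h \<in> Hom C X (dual C V)" "ev C V \<cdot> (mate C X V h \<boxtimes> \<iota> V) = h"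
  using theI'[OF ex1_mate[OF assms]] by (auto simp: mate_def)

end

definition dual_arr :: "('o, 'a, 'm) rigid_data_scheme \<Rightarrow> 'a \<Rightarrow> 'a"
  where "dual_arr C f =
    mate C (dual C (Cod C f)) (Dom C f)
      (ev C (Cod C f) \<cdot>\<^bsub>C\<^esub> (\<iota>\<^bsub>C\<^esub> (dual C (Cod C f)) \<boxtimes>\<^bsub>C\<^esub> f))"

definition ev_tilde :: "('o, 'a, 'm) rigid_data_scheme \<Rightarrow> 'o \<Rightarrow> 'o \<Rightarrow> 'a"
  where "ev_tilde C V W =
    ev C W
    \<cdot>\<^bsub>C\<^esub> (\<iota>\<^bsub>C\<^esub> (dual C W) \<boxtimes>\<^bsub>C\<^esub> (ev C V \<boxtimes>\<^bsub>C\<^esub> \<iota>\<^bsub>C\<^esub> W))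
    \<cdot>\<^bsub>C\<^esub> (\<iota>\<^bsub>C\<^esub> (dual C W) \<boxtimes>\<^bsub>C\<^esub> inv_arr C (\<Phi>\<^bsub>C\<^esub> (dual C V) V W))
    \<cdot>\<^bsub>C\<^esub> \<Phi>\<^bsub>C\<^esub> (dual C W) (dual C V) (V \<otimes>\<^bsub>C\<^esub> W)"

definition zeta :: "('o, 'a, 'm) rigid_data_scheme \<Rightarrow> 'o \<Rightarrow> 'o \<Rightarrow> 'a"
  where "zeta C V W =
    mate C (dual C W \<otimes>\<^bsub>C\<^esub> dual C V) (V \<otimes>\<^bsub>C\<^esub> W) (ev_tilde C V W)"

definition double_dual :: "('o, 'a, 'm) rigid_data_scheme \<Rightarrow> ('o, 'a, 'o, 'a) mon_fun_data"
  where "double_dual C =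
    \<lparr>on_obj = (\<lambda>V. dual C (dual C V)),
     on_arr = (\<lambda>f. dual_arr C (dual_arr C f)),
     mon_str = (\<lambda>V W. dual_arr C (inv_arr C (zeta C V W)) \<cdot>\<^bsub>C\<^esub> zeta C (dual C W) (dual C V))\<rparr>"


section \<open>Pivotal categories\<close>

record ('o, 'a) pivotal_data = "('o, 'a) rigid_data" +
  piv :: "'o \<Rightarrow> 'a"

locale pivotal_category = rigid_category C
  for C :: "('o, 'a, 'm) pivotal_data_scheme" (structure) +
  assumes piv: "monoidal_natural_iso C C (id_mon_fun C) (double_dual C) (piv C)"

locale strict_pivotal_category = pivotal_category C + strict_monoidal_category C
  for C :: "('o, 'a, 'm) pivotal_data_scheme" (structure) +
  assumes strict_dual_tens: "V \<in> Obj C \<Longrightarrow> W \<in> Obj C \<Longrightarrow>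
      dual C (V \<otimes> W) = dual C W \<otimes> dual C V"
    and strict_zeta: "V \<in> Obj C \<Longrightarrow> W \<in> Obj C \<Longrightarrow>
      zeta C V W = \<iota> (dual C (V \<otimes> W))"
    and strict_double_dual: "V \<in> Obj C \<Longrightarrow> dual C (dual C V) = V"
    and strict_piv: "V \<in> Obj C \<Longrightarrow> piv C V = \<iota> V"

definition xi_tilde ::
  "('o, 'a, 'm) rigid_data_scheme \<Rightarrow> ('p, 'b, 'n) rigid_data_scheme \<Rightarrow>
   ('o, 'a, 'p, 'b, 'k) mon_fun_data_scheme \<Rightarrow> 'o \<Rightarrow> 'b"
  where "xi_tilde C D F X =
    mate D (on_obj F (dual C X)) (on_obj F X)
      (on_arr F (ev C X) \<cdot>\<^bsub>D\<^esub> mon_str F (dual C X) X)"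

definition preserves_pivotal ::
  "('o, 'a, 'm) pivotal_data_scheme \<Rightarrow> ('p, 'b, 'n) pivotal_data_scheme \<Rightarrow>
   ('o, 'a, 'p, 'b, 'k) mon_fun_data_scheme \<Rightarrow> bool"
  where "preserves_pivotal C D F \<longleftrightarrow>
    (\<forall>X\<in>Obj C.
      xi_tilde C D F (dual C X) \<cdot>\<^bsub>D\<^esub> on_arr F (piv C X)
        = dual_arr D (xi_tilde C D F X) \<cdot>\<^bsub>D\<^esub> piv D (on_obj F X))"

text \<open>
  HOL has no existential quantification over types, so a statement that asserts the existence
  of a strict pivotal category has to name its object and arrow types. For a category with
  objects in \<open>'o\<close> and arrows in \<open>'a\<close> these types are large enough: words in objects with
  a sign (the object or its dual) as objects, and arrows of the given category together with
  a source and a target word as arrows.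
\<close>

type_synonym 'o signed_words = "('o \<times> bool) list"
type_synonym ('o, 'a) word_arrows = "'o signed_words \<times> 'a \<times> 'o signed_words"

end

theory Submission
  imports Defs
begin

text \<open>
  A monoidal category is made strict by replacing its objects with words: a word stands for the
  right-bracketed tensor product of its letters, an arrow of words is an arrow between these
  products, and words are tensored by concatenation. Every object is the product of a word, so
  nothing is lost. For a pivotal category the letters carry a sign: \<open>(V, True)\<close> stands for \<open>V\<close> and
  \<open>(V, False)\<close> for its dual. The dual of a word is then the reversed word with all signs flipped,
  an operation that is strictly involutive and strictly reverses concatenation. A positive letter is
  evaluated by \<open>ev V\<close>, a negative one by \<open>ev (dual V) \<cdot> (piv V \<boxtimes> \<iota>)\<close>, and the evaluation of a
  word nests those of its letters. Nesting makes \<open>zeta\<close> an identity by construction.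

  What remains is that the double dual of an arrow \<open>f\<close> is \<open>f\<close> itself. This is a statement about
  \<^emph>\<open>rotation\<close>, which turns a pairing \<open>p\<close> from \<open>u \<otimes> v\<close> to the unit into one from \<open>v \<otimes> u\<close>: write
  \<open>p = ev v \<cdot> (t \<boxtimes> \<iota>)\<close> and take \<open>ev (dual v) \<cdot> (piv v \<boxtimes> t)\<close>. Naturality of the pivotal structure
  makes rotation natural (\<open>rot_natural\<close>); its compatibility with tensor products says that rotating
  past \<open>l \<otimes> v\<close> is rotating past \<open>v\<close> and then past \<open>l\<close> (\<open>rot_cocycle\<close>). Hence rotating all the way
  round changes nothing (\<open>rot_rot\<close>), and rotating a nested pairing nests the rotated pairings in the
  opposite order (\<open>rot_tensor\<close>). By induction the rotated evaluation of a word is the evaluation of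
  its dual word (\<open>rot_word_ev\<close>). Now let \<open>g\<close> be the dual of \<open>f\<close>, so that
  \<open>ev u \<cdot> (g \<boxtimes> \<iota>) = ev v \<cdot> (\<iota> \<boxtimes> f)\<close>. Rotating both sides gives
  \<open>ev (dual u) \<cdot> (\<iota> \<boxtimes> g) = ev (dual v) \<cdot> (f \<boxtimes> \<iota>)\<close>, which says that \<open>f\<close> is the dual of \<open>g\<close>.

  Rotation is set up with a second, auxiliary dual of a word \<open>u\<close>: the single negative letter on the
  product of \<open>u\<close>. Its evaluation is literally the evaluation of the given category, and tensoring on
  the left with a one-letter word involves no associativity isomorphism. So the given structure
  passes to words with hardly any coherence computation, and everything about rotation is
  calculated in a strict monoidal category. Compatibility with tensor products is transported for a
  single letter on the left, which is the case that an induction over words calls for.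
\<close>


section \<open>Exact pairings in strict monoidal categories\<close>

context category
begin

lemma cmp_Idn_arr':
  "f \<in> Arr C \<Longrightarrow> Dom C f = u \<Longrightarrow> f \<cdot> \<iota> u = f"
  "f \<in> Arr C \<Longrightarrow> Cod C f = u \<Longrightarrow> \<iota> u \<cdot> f = f"
  using cmp_Idn_arr by auto

lemma HomE:
  assumes "f \<in> Hom C u v"
  shows "f \<in> Arr C" "Dom C f = u" "Cod C f = v" "u \<in> Obj C" "v \<in> Obj C"
  using assms HomD[OF assms] Dom_Obj Cod_Obj by auto

end

text \<open>
  The zigzag equations without associators; the predicate is meant for strict monoidal categories.
\<close>
definition exact_pairing ::
  "('o, 'a, 'm) mon_data_scheme \<Rightarrow> 'o \<Rightarrow> 'o \<Rightarrow> 'a \<Rightarrow> 'a \<Rightarrow> bool"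
  where "exact_pairing C x' x e c \<longleftrightarrow>
    x \<in> Obj C \<and> x' \<in> Obj C \<and>
    e \<in> Hom C (x' \<otimes>\<^bsub>C\<^esub> x) \<I>\<^bsub>C\<^esub> \<and> c \<in> Hom C \<I>\<^bsub>C\<^esub> (x \<otimes>\<^bsub>C\<^esub> x') \<and>
    (\<iota>\<^bsub>C\<^esub> x \<boxtimes>\<^bsub>C\<^esub> e) \<cdot>\<^bsub>C\<^esub> (c \<boxtimes>\<^bsub>C\<^esub> \<iota>\<^bsub>C\<^esub> x) = \<iota>\<^bsub>C\<^esub> x \<and>
    (e \<boxtimes>\<^bsub>C\<^esub> \<iota>\<^bsub>C\<^esub> x') \<cdot>\<^bsub>C\<^esub> (\<iota>\<^bsub>C\<^esub> x' \<boxtimes>\<^bsub>C\<^esub> c) = \<iota>\<^bsub>C\<^esub> x'"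

context strict_monoidal_category
begin

lemma tens_assoc_arr:
  assumes "f \<in> Arr C" "g \<in> Arr C" "h \<in> Arr C"
  shows "(f \<boxtimes> g) \<boxtimes> h = f \<boxtimes> (g \<boxtimes> h)"
  using assoc_natural_arr[OF assms] assms Dom_Obj Cod_Obj
  by (simp add: strict_assoc strict_tens arr_simps cmp_Idn_arr')

lemma tens_Idn_split:
  "u \<in> Obj C \<Longrightarrow> v \<in> Obj C \<Longrightarrow> f \<in> Arr C \<Longrightarrow> \<iota> (u \<otimes> v) \<boxtimes> f = \<iota> u \<boxtimes> (\<iota> v \<boxtimes> f)"
  "u \<in> Obj C \<Longrightarrow> v \<in> Obj C \<Longrightarrow> f \<in> Arr C \<Longrightarrow> f \<boxtimes> \<iota> (u \<otimes> v) = f \<boxtimes> (\<iota> u \<boxtimes> \<iota> v)"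
  by (simp_all add: tens_assoc_arr[symmetric] arr_simps)

lemmas strict_simps = Idn_arr cmp_arr tens_arr unit_Obj tens_Obj tens_Idn
  tens_unit_left tens_unit_right tens_arr_unit_left tens_arr_unit_right
  cmp_Idn_arr' strict_tens tens_assoc_arr

lemma tens_swap':
  assumes "f \<in> Arr C" "g \<in> Arr C" "Dom C f = a" "Cod C f = b" "Dom C g = c" "Cod C g = d"
  shows "(f \<boxtimes> \<iota> d) \<cdot> (\<iota> a \<boxtimes> g) = f \<boxtimes> g"
    "(\<iota> b \<boxtimes> g) \<cdot> (f \<boxtimes> \<iota> c) = f \<boxtimes> g"
  using tens_swap[OF assms(1,2)] assms(3-) by auto

lemma exact_pairingD:
  assumes "exact_pairing C x' x e c"
  shows "x \<in> Obj C" "x' \<in> Obj C"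
    "e \<in> Arr C" "Dom C e = x' \<otimes> x" "Cod C e = \<I>"
    "c \<in> Arr C" "Dom C c = \<I>" "Cod C c = x \<otimes> x'"
    "(\<iota> x \<boxtimes> e) \<cdot> (c \<boxtimes> \<iota> x) = \<iota> x"
    "(e \<boxtimes> \<iota> x') \<cdot> (\<iota> x' \<boxtimes> c) = \<iota> x'"
  using assms HomD by (auto simp: exact_pairing_def)

text \<open>
  Bending the strand \<open>x\<close>: the transpose of \<open>f\<close> is \<open>(f \<boxtimes> \<iota> x') \<cdot> (\<iota> w \<boxtimes> c)\<close>, and the two zigzag
  equations give existence and uniqueness respectively.
\<close>
lemma exact_pairing_transpose:
  assumes p: "exact_pairing C x' x e c" and w: "w \<in> Obj C" and y: "y \<in> Obj C"
    and f: "f \<in> Hom C (w \<otimes> x) y"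
  shows "\<exists>!t. t \<in> Hom C w (y \<otimes> x') \<and> (\<iota> y \<boxtimes> e) \<cdot> (t \<boxtimes> \<iota> x) = f"
proof (rule ex1I)
  note p' = exact_pairingD(1-8)[OF p] and zz = exact_pairingD(9,10)[OF p]
  note f' = HomD[OF f]
  note S = strict_simps p' w y f'
  let ?t = "(f \<boxtimes> \<iota> x') \<cdot> (\<iota> w \<boxtimes> c)"
  have "(\<iota> y \<boxtimes> e) \<cdot> (?t \<boxtimes> \<iota> x)
      = (\<iota> y \<boxtimes> e) \<cdot> (f \<boxtimes> \<iota> (x' \<otimes> x)) \<cdot> (\<iota> w \<boxtimes> (c \<boxtimes> \<iota> x))"
    by (simp add: tens_cmp_Idn(2)[symmetric] S)
  also have "\<dots> = (f \<boxtimes> e) \<cdot> (\<iota> w \<boxtimes> (c \<boxtimes> \<iota> x))"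
    by (simp add: cmp_assoc_arr[symmetric] tens_swap'(2) S)
  also have "f \<boxtimes> e = f \<cdot> (\<iota> (w \<otimes> x) \<boxtimes> e)"
    using tens_swap(1)[of f e] by (simp add: S)
  also have "(f \<cdot> (\<iota> (w \<otimes> x) \<boxtimes> e)) \<cdot> (\<iota> w \<boxtimes> (c \<boxtimes> \<iota> x)) = f \<cdot> (\<iota> w \<boxtimes> ((\<iota> x \<boxtimes> e) \<cdot> (c \<boxtimes> \<iota> x)))"
    by (simp add: tens_Idn_split cmp_assoc_arr tens_cmp_Idn S)
  also have "\<dots> = f"
    by (simp add: zz S)
  finally show "?t \<in> Hom C w (y \<otimes> x') \<and> (\<iota> y \<boxtimes> e) \<cdot> (?t \<boxtimes> \<iota> x) = f"
    by (simp add: Hom_def S)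
  fix t assume t: "t \<in> Hom C w (y \<otimes> x') \<and> (\<iota> y \<boxtimes> e) \<cdot> (t \<boxtimes> \<iota> x) = f"
  note t' = HomD[OF conjunct1[OF t]]
  note S = S t'
  have "?t = ((\<iota> y \<boxtimes> (e \<boxtimes> \<iota> x')) \<cdot> (t \<boxtimes> \<iota> (x \<otimes> x'))) \<cdot> (\<iota> w \<boxtimes> c)"
    by (simp add: conjunct2[OF t, symmetric] tens_cmp_Idn(2)[symmetric] S)
  also have "\<dots> = (\<iota> y \<boxtimes> (e \<boxtimes> \<iota> x')) \<cdot> (t \<boxtimes> c)"
    by (simp add: cmp_assoc_arr tens_swap'(1) S)
  also have "t \<boxtimes> c = (\<iota> (y \<otimes> x') \<boxtimes> c) \<cdot> t"
    using tens_swap(2)[of t c] by (simp add: S)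
  also have "(\<iota> y \<boxtimes> (e \<boxtimes> \<iota> x')) \<cdot> \<dots> = (\<iota> y \<boxtimes> ((e \<boxtimes> \<iota> x') \<cdot> (\<iota> x' \<boxtimes> c))) \<cdot> t"
    by (simp add: tens_Idn_split cmp_assoc_arr[symmetric] tens_cmp_Idn S)
  also have "\<dots> = t"
    by (simp add: zz S)
  finally show "t = ?t" ..
qed

text \<open>
  Nested cups and caps: in each zigzag the inner and the outer pairing slide past each other and
  can then be straightened one at a time.
\<close>
lemma exact_pairing_tensor:
  assumes p: "exact_pairing C x' x e c" and q: "exact_pairing C y' y d b"
  shows "exact_pairing C (y' \<otimes> x') (x \<otimes> y)
    (d \<cdot> (\<iota> y' \<boxtimes> (e \<boxtimes> \<iota> y))) ((\<iota> x \<boxtimes> (b \<boxtimes> \<iota> x')) \<cdot> c)"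
proof -
  note p' = exact_pairingD(1-8)[OF p] and zp = exact_pairingD(9,10)[OF p]
  note q' = exact_pairingD(1-8)[OF q] and zq = exact_pairingD(9,10)[OF q]
  note S = strict_simps p' q'
  have "(\<iota> (x \<otimes> y) \<boxtimes> (d \<cdot> (\<iota> y' \<boxtimes> (e \<boxtimes> \<iota> y)))) \<cdot> (((\<iota> x \<boxtimes> (b \<boxtimes> \<iota> x')) \<cdot> c) \<boxtimes> \<iota> (x \<otimes> y))
    = (\<iota> (x \<otimes> y) \<boxtimes> d) \<cdot> ((\<iota> (x \<otimes> y \<otimes> y') \<boxtimes> (e \<boxtimes> \<iota> y)) \<cdot> ((\<iota> x \<boxtimes> b) \<boxtimes> \<iota> (x' \<otimes> x \<otimes> y)))
      \<cdot> (c \<boxtimes> \<iota> (x \<otimes> y))"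
    by (simp add: tens_cmp_Idn[symmetric] cmp_assoc_arr S tens_Idn_split(1))
  also have "(\<iota> (x \<otimes> y \<otimes> y') \<boxtimes> (e \<boxtimes> \<iota> y)) \<cdot> ((\<iota> x \<boxtimes> b) \<boxtimes> \<iota> (x' \<otimes> x \<otimes> y))
    = (\<iota> x \<boxtimes> b) \<boxtimes> (e \<boxtimes> \<iota> y)"
    by (rule tens_swap'(2)) (simp_all add: S)
  also have "\<dots> = ((\<iota> x \<boxtimes> b) \<boxtimes> \<iota> y) \<cdot> (\<iota> x \<boxtimes> (e \<boxtimes> \<iota> y))"
    by (rule tens_swap'(1)[symmetric]) (simp_all add: S)
  also have "(\<iota> (x \<otimes> y) \<boxtimes> d) \<cdot> \<dots> \<cdot> (c \<boxtimes> \<iota> (x \<otimes> y))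
    = (\<iota> x \<boxtimes> ((\<iota> y \<boxtimes> d) \<cdot> (b \<boxtimes> \<iota> y))) \<cdot> (((\<iota> x \<boxtimes> e) \<cdot> (c \<boxtimes> \<iota> x)) \<boxtimes> \<iota> y)"
    by (simp add: tens_cmp_Idn[symmetric] cmp_assoc_arr S tens_Idn_split(1))
  finally have 1: "(\<iota> (x \<otimes> y) \<boxtimes> (d \<cdot> (\<iota> y' \<boxtimes> (e \<boxtimes> \<iota> y)))) \<cdot>
      (((\<iota> x \<boxtimes> (b \<boxtimes> \<iota> x')) \<cdot> c) \<boxtimes> \<iota> (x \<otimes> y)) = \<iota> (x \<otimes> y)"
    by (simp add: zp zq S)
  have "((d \<cdot> (\<iota> y' \<boxtimes> (e \<boxtimes> \<iota> y))) \<boxtimes> \<iota> (y' \<otimes> x')) \<cdot> (\<iota> (y' \<otimes> x') \<boxtimes> ((\<iota> x \<boxtimes> (b \<boxtimes> \<iota> x')) \<cdot> c))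
    = (d \<boxtimes> \<iota> (y' \<otimes> x')) \<cdot> (((\<iota> y' \<boxtimes> e) \<boxtimes> \<iota> (y \<otimes> y' \<otimes> x')) \<cdot> (\<iota> (y' \<otimes> x' \<otimes> x) \<boxtimes> (b \<boxtimes> \<iota> x')))
      \<cdot> (\<iota> (y' \<otimes> x') \<boxtimes> c)"
    by (simp add: tens_cmp_Idn[symmetric] cmp_assoc_arr S tens_Idn_split(1))
  also have "((\<iota> y' \<boxtimes> e) \<boxtimes> \<iota> (y \<otimes> y' \<otimes> x')) \<cdot> (\<iota> (y' \<otimes> x' \<otimes> x) \<boxtimes> (b \<boxtimes> \<iota> x'))
    = (\<iota> y' \<boxtimes> e) \<boxtimes> (b \<boxtimes> \<iota> x')"
    by (rule tens_swap'(1)) (simp_all add: S)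
  also have "\<dots> = (\<iota> y' \<boxtimes> (b \<boxtimes> \<iota> x')) \<cdot> ((\<iota> y' \<boxtimes> e) \<boxtimes> \<iota> x')"
    by (rule tens_swap'(2)[symmetric]) (simp_all add: S)
  also have "(d \<boxtimes> \<iota> (y' \<otimes> x')) \<cdot> \<dots> \<cdot> (\<iota> (y' \<otimes> x') \<boxtimes> c)
    = (((d \<boxtimes> \<iota> y') \<cdot> (\<iota> y' \<boxtimes> b)) \<boxtimes> \<iota> x') \<cdot> (\<iota> y' \<boxtimes> ((e \<boxtimes> \<iota> x') \<cdot> (\<iota> x' \<boxtimes> c)))"
    by (simp add: tens_cmp_Idn[symmetric] cmp_assoc_arr S tens_Idn_split(1))
  finally have 2: "((d \<cdot> (\<iota> y' \<boxtimes> (e \<boxtimes> \<iota> y))) \<boxtimes> \<iota> (y' \<otimes> x')) \<cdot>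
      (\<iota> (y' \<otimes> x') \<boxtimes> ((\<iota> x \<boxtimes> (b \<boxtimes> \<iota> x')) \<cdot> c)) = \<iota> (y' \<otimes> x')"
    by (simp add: zp zq S)
  show ?thesis
    using 1 2 by (simp add: exact_pairing_def Hom_def S)
qed

text \<open>
  A dual may be replaced by an isomorphic object. Along the pivotal isomorphism this turns the pairing
  of the dual of \<open>V\<close> with the double dual into a pairing with \<open>V\<close>.
\<close>
lemma exact_pairing_twist:
  assumes p: "exact_pairing C x' x e c"
    and f: "f \<in> Hom C y x'" and g: "g \<in> Hom C x' y"
    and inv: "g \<cdot> f = \<iota> y" "f \<cdot> g = \<iota> x'"
  shows "exact_pairing C y x (e \<cdot> (f \<boxtimes> \<iota> x)) ((\<iota> x \<boxtimes> g) \<cdot> c)"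
proof -
  note p' = exact_pairingD(1-8)[OF p] and zp = exact_pairingD(9,10)[OF p]
  note S = strict_simps p' HomE[OF f] HomE[OF g]
  have "(\<iota> x \<boxtimes> (e \<cdot> (f \<boxtimes> \<iota> x))) \<cdot> (((\<iota> x \<boxtimes> g) \<cdot> c) \<boxtimes> \<iota> x)
      = (\<iota> x \<boxtimes> e) \<cdot> ((\<iota> x \<boxtimes> (f \<boxtimes> \<iota> x)) \<cdot> (\<iota> x \<boxtimes> (g \<boxtimes> \<iota> x))) \<cdot> (c \<boxtimes> \<iota> x)"
    by (simp add: tens_cmp_Idn[symmetric] cmp_assoc_arr S)
  also have "(\<iota> x \<boxtimes> (f \<boxtimes> \<iota> x)) \<cdot> (\<iota> x \<boxtimes> (g \<boxtimes> \<iota> x)) = \<iota> (x \<otimes> x' \<otimes> x)"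
    by (simp add: tens_cmp_Idn S inv)
  finally have 1: "(\<iota> x \<boxtimes> (e \<cdot> (f \<boxtimes> \<iota> x))) \<cdot> (((\<iota> x \<boxtimes> g) \<cdot> c) \<boxtimes> \<iota> x) = \<iota> x"
    by (simp add: S zp)
  have "((e \<cdot> (f \<boxtimes> \<iota> x)) \<boxtimes> \<iota> y) \<cdot> (\<iota> y \<boxtimes> ((\<iota> x \<boxtimes> g) \<cdot> c))
      = (e \<boxtimes> \<iota> y) \<cdot> ((f \<boxtimes> \<iota> (x \<otimes> y)) \<cdot> (\<iota> y \<boxtimes> (\<iota> x \<boxtimes> g))) \<cdot> (\<iota> y \<boxtimes> c)"
    by (simp add: tens_cmp_Idn[symmetric] cmp_assoc_arr S)
  also have "(f \<boxtimes> \<iota> (x \<otimes> y)) \<cdot> (\<iota> y \<boxtimes> (\<iota> x \<boxtimes> g)) = f \<boxtimes> (\<iota> x \<boxtimes> g)"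
    by (rule tens_swap'(1)) (simp_all add: S)
  also have "\<dots> = (\<iota> (x' \<otimes> x) \<boxtimes> g) \<cdot> (f \<boxtimes> \<iota> (x \<otimes> x'))"
    using tens_swap(2)[of f "\<iota> x \<boxtimes> g"] by (simp add: S tens_Idn_split(1))
  also have "(e \<boxtimes> \<iota> y) \<cdot> \<dots> \<cdot> (\<iota> y \<boxtimes> c)
      = ((e \<boxtimes> \<iota> y) \<cdot> (\<iota> (x' \<otimes> x) \<boxtimes> g)) \<cdot> ((f \<boxtimes> \<iota> (x \<otimes> x')) \<cdot> (\<iota> y \<boxtimes> c))"
    by (simp add: cmp_assoc_arr S)
  also have "(e \<boxtimes> \<iota> y) \<cdot> (\<iota> (x' \<otimes> x) \<boxtimes> g) = g \<cdot> (e \<boxtimes> \<iota> x')"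
    using tens_swap[of e g] by (simp add: S)
  also have "(f \<boxtimes> \<iota> (x \<otimes> x')) \<cdot> (\<iota> y \<boxtimes> c) = (\<iota> x' \<boxtimes> c) \<cdot> f"
    using tens_swap[of f c] by (simp add: S)
  also have "(g \<cdot> (e \<boxtimes> \<iota> x')) \<cdot> (\<iota> x' \<boxtimes> c) \<cdot> f = g \<cdot> ((e \<boxtimes> \<iota> x') \<cdot> (\<iota> x' \<boxtimes> c)) \<cdot> f"
    by (simp add: cmp_assoc_arr S)
  finally have 2: "((e \<cdot> (f \<boxtimes> \<iota> x)) \<boxtimes> \<iota> y) \<cdot> (\<iota> y \<boxtimes> ((\<iota> x \<boxtimes> g) \<cdot> c)) = \<iota> y"
    by (simp add: S zp inv)
  show ?thesis
    using 1 2 by (simp add: exact_pairing_def Hom_def S)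
qed

end


section \<open>The strict monoidal category of words\<close>

context monoidal_category
begin

lemma inv_arr_Idn: "u \<in> Obj C \<Longrightarrow> inv_arr C (\<iota> u) = \<iota> u"
proof -
  assume "u \<in> Obj C"
  then have i: "inverse_arrs C (\<iota> u) (\<iota> u)"
    by (simp add: inverse_arrs_def Idn_arr Idn_Hom cmp_Idn_arr')
  then have "is_iso C (\<iota> u)" unfolding is_iso_def by blast
  from inverse_arrs_unique[OF inverse_arrs_inv_arr[OF this] i] show ?thesis .
qed

lemmas mon_simps = Idn_arr cmp_arr tens_arr unit_Obj tens_Obj tens_Idn
  tens_unit_left tens_unit_right tens_arr_unit_left tens_arr_unit_right
  cmp_Idn_arr' assoc_arr inv_assoc_arr(1-3)

end

text \<open>
  Words over an alphabet \<open>L\<close> whose letters name objects of \<open>C\<close>. The isomorphisms \<open>\<mu> u v\<close> re-bracket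
  the product of two words to that of their concatenation. They and their inverses \<open>\<nu> u v\<close> are
  defined by recursion on the first word, so that they are identities when it has one letter.
\<close>
locale word_strictification = monoidal_category C
  for C :: "('o, 'a, 'm) mon_data_scheme" (structure) +
  fixes L :: "'l set" and lobj :: "'l \<Rightarrow> 'o"
  assumes lobj_Obj: "l \<in> L \<Longrightarrow> lobj l \<in> Obj C"
begin

primrec word_obj :: "'l list \<Rightarrow> 'o" where
  "word_obj [] = \<I>"
| "word_obj (l # u) = lobj l \<otimes> word_obj u"

primrec \<mu> :: "'l list \<Rightarrow> 'l list \<Rightarrow> 'a" where
  "\<mu> [] v = \<iota> (word_obj v)"
| "\<mu> (l # u) v = (\<iota> (lobj l) \<boxtimes> \<mu> u v) \<cdot> \<Phi> (lobj l) (word_obj u) (word_obj v)"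

primrec \<nu> :: "'l list \<Rightarrow> 'l list \<Rightarrow> 'a" where
  "\<nu> [] v = \<iota> (word_obj v)"
| "\<nu> (l # u) v = inv_arr C (\<Phi> (lobj l) (word_obj u) (word_obj v)) \<cdot> (\<iota> (lobj l) \<boxtimes> \<nu> u v)"

lemma word_obj_Obj: "u \<in> lists L \<Longrightarrow> word_obj u \<in> Obj C"
  by (induction u) (simp_all add: unit_Obj tens_Obj lobj_Obj)

lemma \<mu>_arr:
  assumes "u \<in> lists L" "v \<in> lists L"
  shows "\<mu> u v \<in> Arr C" "Dom C (\<mu> u v) = word_obj u \<otimes> word_obj v" "Cod C (\<mu> u v) = word_obj (u @ v)"
  using assms by (induction u) (simp_all add: mon_simps word_obj_Obj lobj_Obj)

lemma \<nu>_arr: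
  assumes "u \<in> lists L" "v \<in> lists L"
  shows "\<nu> u v \<in> Arr C" "Dom C (\<nu> u v) = word_obj (u @ v)" "Cod C (\<nu> u v) = word_obj u \<otimes> word_obj v"
  using assms by (induction u) (simp_all add: mon_simps word_obj_Obj lobj_Obj)

lemmas word_simps = mon_simps lobj_Obj word_obj_Obj \<mu>_arr \<nu>_arr

lemma \<mu>_\<nu>:
  assumes "u \<in> lists L" "v \<in> lists L"
  shows "\<mu> u v \<cdot> \<nu> u v = \<iota> (word_obj (u @ v))"
  using assms
proof (induction u)
  case (Cons l u)
  let ?P = "\<Phi> (lobj l) (word_obj u) (word_obj v)"
  have "\<mu> (l # u) v \<cdot> \<nu> (l # u) v
      = (\<iota> (lobj l) \<boxtimes> \<mu> u v) \<cdot> (?P \<cdot> inv_arr C ?P) \<cdot> (\<iota> (lobj l) \<boxtimes> \<nu> u v)"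
    using Cons by (simp add: cmp_assoc_arr word_simps)
  also have "\<dots> = \<iota> (lobj l) \<boxtimes> (\<mu> u v \<cdot> \<nu> u v)"
    using Cons by (simp add: word_simps inv_assoc_arr tens_cmp_Idn)
  finally show ?case using Cons by (simp add: word_simps inv_assoc_arr)
qed (simp add: word_simps)

lemma \<nu>_\<mu>:
  assumes "u \<in> lists L" "v \<in> lists L"
  shows "\<nu> u v \<cdot> \<mu> u v = \<iota> (word_obj u \<otimes> word_obj v)"
  using assms
proof (induction u)
  case (Cons l u)
  let ?P = "\<Phi> (lobj l) (word_obj u) (word_obj v)"
  have "\<nu> (l # u) v \<cdot> \<mu> (l # u) v
      = inv_arr C ?P \<cdot> ((\<iota> (lobj l) \<boxtimes> \<nu> u v) \<cdot> (\<iota> (lobj l) \<boxtimes> \<mu> u v)) \<cdot> ?P"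
    using Cons by (simp add: cmp_assoc_arr word_simps)
  also have "(\<iota> (lobj l) \<boxtimes> \<nu> u v) \<cdot> (\<iota> (lobj l) \<boxtimes> \<mu> u v) = \<iota> (lobj l \<otimes> word_obj u \<otimes> word_obj v)"
    using Cons by (simp add: word_simps tens_cmp_Idn)
  finally show ?case using Cons by (simp add: word_simps inv_assoc_arr)
qed (simp add: word_simps)

lemma \<mu>_Nil: "u \<in> lists L \<Longrightarrow> \<mu> u [] = \<iota> (word_obj u)"
  by (induction u) (simp_all add: word_simps assoc_unit_right)

lemma \<nu>_Nil: "u \<in> lists L \<Longrightarrow> \<nu> u [] = \<iota> (word_obj u)"
  using \<mu>_\<nu>[of u "[]"] by (simp add: word_simps \<mu>_Nil)

lemma \<mu>_single: "l \<in> L \<Longrightarrow> v \<in> lists L \<Longrightarrow> \<mu> [l] v = \<iota> (lobj l \<otimes> word_obj v)"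
  by (simp add: word_simps triangle)

lemma \<nu>_single: "l \<in> L \<Longrightarrow> v \<in> lists L \<Longrightarrow> \<nu> [l] v = \<iota> (lobj l \<otimes> word_obj v)"
  using \<mu>_\<nu>[of "[l]" v] by (simp add: \<mu>_single word_simps del: \<mu>.simps \<nu>.simps)

text \<open>
  The two ways of merging three words agree. This is the only coherence theorem that is needed; it
  follows by induction on the first word, with the pentagon in the step.
\<close>
lemma \<mu>_assoc:
  assumes "u \<in> lists L" "v \<in> lists L" "w \<in> lists L"
  shows "\<mu> (u @ v) w \<cdot> (\<mu> u v \<boxtimes> \<iota> (word_obj w))
    = \<mu> u (v @ w) \<cdot> (\<iota> (word_obj u) \<boxtimes> \<mu> v w) \<cdot> \<Phi> (word_obj u) (word_obj v) (word_obj w)"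
  using assms
proof (induction u)
  case Nil
  then show ?case by (simp add: word_simps assoc_unit_left)
next
  case (Cons l u)
  note S = word_simps Cons.hyps(1,2) Cons.prems
  let ?l = "lobj l" and ?u = "word_obj u" and ?v = "word_obj v" and ?w = "word_obj w"
  have "\<mu> ((l # u) @ v) w \<cdot> (\<mu> (l # u) v \<boxtimes> \<iota> ?w)
    = (\<iota> ?l \<boxtimes> \<mu> (u @ v) w) \<cdot> (\<Phi> ?l (word_obj (u @ v)) ?w \<cdot> ((\<iota> ?l \<boxtimes> \<mu> u v) \<boxtimes> \<iota> ?w))
      \<cdot> (\<Phi> ?l ?u ?v \<boxtimes> \<iota> ?w)"
    by (simp add: S tens_cmp_Idn[symmetric] cmp_assoc_arr)
  also have "\<Phi> ?l (word_obj (u @ v)) ?w \<cdot> ((\<iota> ?l \<boxtimes> \<mu> u v) \<boxtimes> \<iota> ?w)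
    = (\<iota> ?l \<boxtimes> (\<mu> u v \<boxtimes> \<iota> ?w)) \<cdot> \<Phi> ?l (?u \<otimes> ?v) ?w"
    using assoc_natural_arr[of "\<iota> ?l" "\<mu> u v" "\<iota> ?w"] by (simp add: S)
  also have "(\<iota> ?l \<boxtimes> \<mu> (u @ v) w) \<cdot> \<dots> \<cdot> (\<Phi> ?l ?u ?v \<boxtimes> \<iota> ?w)
    = (\<iota> ?l \<boxtimes> (\<mu> (u @ v) w \<cdot> (\<mu> u v \<boxtimes> \<iota> ?w))) \<cdot> \<Phi> ?l (?u \<otimes> ?v) ?w \<cdot> (\<Phi> ?l ?u ?v \<boxtimes> \<iota> ?w)"
    by (simp add: S tens_cmp_Idn[symmetric] cmp_assoc_arr)
  also have "\<mu> (u @ v) w \<cdot> (\<mu> u v \<boxtimes> \<iota> ?w) = \<mu> u (v @ w) \<cdot> (\<iota> ?u \<boxtimes> \<mu> v w) \<cdot> \<Phi> ?u ?v ?w"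
    using Cons by simp
  also have "(\<iota> ?l \<boxtimes> \<dots>) \<cdot> \<Phi> ?l (?u \<otimes> ?v) ?w \<cdot> (\<Phi> ?l ?u ?v \<boxtimes> \<iota> ?w)
    = (\<iota> ?l \<boxtimes> \<mu> u (v @ w)) \<cdot> (\<iota> ?l \<boxtimes> (\<iota> ?u \<boxtimes> \<mu> v w)) \<cdot>
      ((\<iota> ?l \<boxtimes> \<Phi> ?u ?v ?w) \<cdot> \<Phi> ?l (?u \<otimes> ?v) ?w \<cdot> (\<Phi> ?l ?u ?v \<boxtimes> \<iota> ?w))"
    by (simp add: S tens_cmp_Idn[symmetric] cmp_assoc_arr)
  also have "\<dots> = (\<iota> ?l \<boxtimes> \<mu> u (v @ w)) \<cdot> ((\<iota> ?l \<boxtimes> (\<iota> ?u \<boxtimes> \<mu> v w)) \<cdot>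
      \<Phi> ?l ?u (?v \<otimes> ?w)) \<cdot> \<Phi> (?l \<otimes> ?u) ?v ?w"
    by (simp add: S pentagon cmp_assoc_arr)
  also have "(\<iota> ?l \<boxtimes> (\<iota> ?u \<boxtimes> \<mu> v w)) \<cdot> \<Phi> ?l ?u (?v \<otimes> ?w)
    = \<Phi> ?l ?u (word_obj (v @ w)) \<cdot> (\<iota> (?l \<otimes> ?u) \<boxtimes> \<mu> v w)"
    using assoc_natural_arr[of "\<iota> ?l" "\<iota> ?u" "\<mu> v w"] by (simp add: S)
  finally show ?case by (simp add: S cmp_assoc_arr)
qed

lemma \<nu>_assoc:
  assumes u: "u \<in> lists L" and v: "v \<in> lists L" and w: "w \<in> lists L"
  shows "\<Phi> (word_obj u) (word_obj v) (word_obj w) \<cdot> (\<nu> u v \<boxtimes> \<iota> (word_obj w)) \<cdot> \<nu> (u @ v) w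
    = (\<iota> (word_obj u) \<boxtimes> \<nu> v w) \<cdot> \<nu> u (v @ w)"
proof -
  note S = word_simps u v w
  let ?P = "\<Phi> (word_obj u) (word_obj v) (word_obj w)"
  let ?n = "(\<iota> (word_obj u) \<boxtimes> \<nu> v w) \<cdot> \<nu> u (v @ w)" and ?n' = "(\<nu> u v \<boxtimes> \<iota> (word_obj w)) \<cdot> \<nu> (u @ v) w"
  let ?m = "\<mu> u (v @ w) \<cdot> (\<iota> (word_obj u) \<boxtimes> \<mu> v w)" and ?m' = "\<mu> (u @ v) w \<cdot> (\<mu> u v \<boxtimes> \<iota> (word_obj w))"
  have "?n \<cdot> ?m = (\<iota> (word_obj u) \<boxtimes> \<nu> v w) \<cdot> (\<nu> u (v @ w) \<cdot> \<mu> u (v @ w)) \<cdot> (\<iota> (word_obj u) \<boxtimes> \<mu> v w)"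
    by (simp add: S cmp_assoc_arr)
  also have "\<dots> = \<iota> (word_obj u \<otimes> word_obj v \<otimes> word_obj w)"
    by (simp add: S \<nu>_\<mu> tens_cmp_Idn)
  finally have 1: "?n \<cdot> ?m = \<iota> (word_obj u \<otimes> word_obj v \<otimes> word_obj w)" .
  have "?m' \<cdot> ?n' = \<mu> (u @ v) w \<cdot> ((\<mu> u v \<boxtimes> \<iota> (word_obj w)) \<cdot> (\<nu> u v \<boxtimes> \<iota> (word_obj w))) \<cdot> \<nu> (u @ v) w"
    by (simp add: S cmp_assoc_arr)
  also have "\<dots> = \<iota> (word_obj (u @ v @ w))"
    by (simp add: S \<mu>_\<nu> tens_cmp_Idn)
  finally have 2: "?m' \<cdot> ?n' = \<iota> (word_obj (u @ v @ w))" .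
  have "?P \<cdot> ?n' = (?n \<cdot> ?m) \<cdot> ?P \<cdot> ?n'"
    unfolding 1 by (simp add: S)
  also have "\<dots> = ?n \<cdot> (?m \<cdot> ?P) \<cdot> ?n'"
    by (simp add: S cmp_assoc_arr)
  also have "?m \<cdot> ?P = ?m'"
    using \<mu>_assoc[OF u v w] by (simp add: S cmp_assoc_arr)
  also have "?n \<cdot> ?m' \<cdot> ?n' = ?n"
    unfolding 2 by (simp add: S)
  finally show ?thesis .
qed

text \<open>
  An arrow carries its source and target words along because different words may have the same
  product. The record extension \<open>e\<close> is left open: the strict monoidal structure is the same
  whatever duals are added to it.
\<close>
definition word_cat :: "'e \<Rightarrow> ('l list, 'l list \<times> 'a \<times> 'l list, 'e) mon_data_scheme"
  where "word_cat e =
    \<lparr>Obj = lists L,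
     Arr = {(u, f, v). u \<in> lists L \<and> v \<in> lists L \<and> f \<in> Hom C (word_obj u) (word_obj v)},
     Dom = (\<lambda>(u, f, v). u),
     Cod = (\<lambda>(u, f, v). v),
     Idn = (\<lambda>u. (u, \<iota> (word_obj u), u)),
     cmp = (\<lambda>(v, g, w) (u, f, v'). (u, g \<cdot> f, w)),
     unit_obj = [],
     tens_obj = (@),
     tens_arr = (\<lambda>(u, f, v) (u', f', v'). (u @ u', \<mu> v v' \<cdot> (f \<boxtimes> f') \<cdot> \<nu> u u', v @ v')),
     assoc = (\<lambda>u v w. (u @ v @ w, \<iota> (word_obj (u @ v @ w)), u @ v @ w)),
     \<dots> = e\<rparr>"

lemma word_cat_sel [simp]:
  "Obj (word_cat e) = lists L"
  "Dom (word_cat e) (u, f, v) = u"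
  "Cod (word_cat e) (u, f, v) = v"
  "Idn (word_cat e) u = (u, \<iota> (word_obj u), u)"
  "cmp (word_cat e) (v, g, w) (u, f, v') = (u, g \<cdot> f, w)"
  "unit_obj (word_cat e) = []"
  "tens_obj (word_cat e) u v = u @ v"
  "tens_arr (word_cat e) (u, f, v) (u', f', v') = (u @ u', \<mu> v v' \<cdot> (f \<boxtimes> f') \<cdot> \<nu> u u', v @ v')"
  "assoc (word_cat e) u v w = (u @ v @ w, \<iota> (word_obj (u @ v @ w)), u @ v @ w)"
  by (simp_all add: word_cat_def)

lemma word_cat_Arr: "(u, f, v) \<in> Arr (word_cat e) \<longleftrightarrow> u \<in> lists L \<and> v \<in> lists L \<and> f \<in> Hom C (word_obj
    u) (word_obj v)"
  by (simp add: word_cat_def)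

lemma word_cat_Hom:
  "t \<in> Hom (word_cat e) u v \<longleftrightarrow> (\<exists>f. t = (u, f, v) \<and> u \<in> lists L \<and> v \<in> lists L \<and> f \<in> Hom C (word_obj
      u) (word_obj v))"
  by (cases t) (auto simp: Hom_def[of "word_cat e"] word_cat_Arr)

lemma word_cat_tens_Hom:
  assumes f: "f \<in> Hom C (word_obj u) (word_obj v)" and f': "f' \<in> Hom C (word_obj u') (word_obj v')"
    and L: "u \<in> lists L" "v \<in> lists L" "u' \<in> lists L" "v' \<in> lists L"
  shows "\<mu> v v' \<cdot> (f \<boxtimes> f') \<cdot> \<nu> u u' \<in> Hom C (word_obj (u @ u')) (word_obj (v @ v'))"
  using L HomD[OF f] HomD[OF f'] by (simp add: Hom_def word_simps)

lemma word_cat_tens_cmp: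
  assumes f: "f \<in> Hom C (word_obj u) (word_obj v)" and g: "g \<in> Hom C (word_obj v) (word_obj w)"
    and f': "f' \<in> Hom C (word_obj u') (word_obj v')" and g': "g' \<in> Hom C (word_obj v') (word_obj w')"
    and L: "u \<in> lists L" "v \<in> lists L" "w \<in> lists L" "u' \<in> lists L" "v' \<in> lists L" "w' \<in> lists L"
  shows "(\<mu> w w' \<cdot> (g \<boxtimes> g') \<cdot> \<nu> v v') \<cdot> (\<mu> v v' \<cdot> (f \<boxtimes> f') \<cdot> \<nu> u u')
    = \<mu> w w' \<cdot> ((g \<cdot> f) \<boxtimes> (g' \<cdot> f')) \<cdot> \<nu> u u'"
proof -
  note S = word_simps L HomD[OF f] HomD[OF g] HomD[OF f'] HomD[OF g']
  have "(\<mu> w w' \<cdot> (g \<boxtimes> g') \<cdot> \<nu> v v') \<cdot> (\<mu> v v' \<cdot> (f \<boxtimes> f') \<cdot> \<nu> u u')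
      = \<mu> w w' \<cdot> ((g \<boxtimes> g') \<cdot> (\<nu> v v' \<cdot> \<mu> v v') \<cdot> (f \<boxtimes> f')) \<cdot> \<nu> u u'"
    by (simp add: S cmp_assoc_arr)
  then show ?thesis by (simp add: S \<nu>_\<mu> tens_cmp_arr)
qed

text \<open>
  Strict associativity on arrows: conjugating with \<open>\<mu>\<close> and \<open>\<nu>\<close> absorbs the associator of \<open>C\<close>.
\<close>
lemma word_cat_tens_assoc:
  assumes f: "f \<in> Hom C (word_obj u) (word_obj u')" and g:
      "g \<in> Hom C (word_obj v) (word_obj v')" and h: "h \<in> Hom C (word_obj w) (word_obj w')"
    and L: "u \<in> lists L" "v \<in> lists L" "w \<in> lists L" "u' \<in> lists L" "v' \<in> lists L" "w' \<in> lists L"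
  shows "\<mu> (u' @ v') w' \<cdot> ((\<mu> u' v' \<cdot> (f \<boxtimes> g) \<cdot> \<nu> u v) \<boxtimes> h) \<cdot> \<nu> (u @ v) w
    = \<mu> u' (v' @ w') \<cdot> (f \<boxtimes> (\<mu> v' w' \<cdot> (g \<boxtimes> h) \<cdot> \<nu> v w)) \<cdot> \<nu> u (v @ w)"
proof -
  note S = word_simps L HomD[OF f] HomD[OF g] HomD[OF h]
  have h3: "(\<mu> u' v' \<cdot> (f \<boxtimes> g) \<cdot> \<nu> u v) \<boxtimes> h
      = (\<mu> u' v' \<boxtimes> \<iota> (word_obj w')) \<cdot> ((f \<boxtimes> g) \<boxtimes> h) \<cdot> (\<nu> u v \<boxtimes> \<iota> (word_obj w))"
    by (simp add: S tens_cmp_arr)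
  have f3: "f \<boxtimes> (\<mu> v' w' \<cdot> (g \<boxtimes> h) \<cdot> \<nu> v w)
      = (\<iota> (word_obj u') \<boxtimes> \<mu> v' w') \<cdot> (f \<boxtimes> (g \<boxtimes> h)) \<cdot> (\<iota> (word_obj u) \<boxtimes> \<nu> v w)"
    by (simp add: S tens_cmp_arr)
  have "\<mu> (u' @ v') w' \<cdot> ((\<mu> u' v' \<cdot> (f \<boxtimes> g) \<cdot> \<nu> u v) \<boxtimes> h) \<cdot> \<nu> (u @ v) w
      = (\<mu> (u' @ v') w' \<cdot> (\<mu> u' v' \<boxtimes> \<iota> (word_obj w'))) \<cdot> ((f \<boxtimes> g) \<boxtimes> h) \<cdot> (\<nu> u v \<boxtimes> \<iota> (word_obj w))
          \<cdot> \<nu> (u @ v) w"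
    unfolding h3 by (simp add: S cmp_assoc_arr)
  also have "\<dots> = (\<mu> u' (v' @ w') \<cdot> (\<iota> (word_obj u') \<boxtimes> \<mu> v' w')) \<cdot>
      (\<Phi> (word_obj u') (word_obj v') (word_obj w') \<cdot> ((f \<boxtimes> g) \<boxtimes> h)) \<cdot> (\<nu> u v \<boxtimes> \<iota> (word_obj w))
          \<cdot> \<nu> (u @ v) w"
    by (simp add: S \<mu>_assoc cmp_assoc_arr)
  also have "\<Phi> (word_obj u') (word_obj v') (word_obj w') \<cdot> ((f \<boxtimes> g) \<boxtimes> h) = (f \<boxtimes> (g \<boxtimes> h))
      \<cdot> \<Phi> (word_obj u) (word_obj v) (word_obj w)"
    using assoc_natural_arr[of f g h] by (simp add: S)
  also have "(\<mu> u' (v' @ w') \<cdot> (\<iota> (word_obj u') \<boxtimes> \<mu> v' w')) \<cdot> \<dots> \<cdot> (\<nu> u v \<boxtimes> \<iota> (word_obj w)) \<cdot> \<nu> (u @ v) w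
      = (\<mu> u' (v' @ w') \<cdot> (\<iota> (word_obj u') \<boxtimes> \<mu> v' w')) \<cdot> (f \<boxtimes> (g \<boxtimes> h)) \<cdot>
        (\<Phi> (word_obj u) (word_obj v) (word_obj w) \<cdot> (\<nu> u v \<boxtimes> \<iota> (word_obj w)) \<cdot> \<nu> (u @ v) w)"
    by (simp add: S cmp_assoc_arr)
  also have "\<dots> = \<mu> u' (v' @ w') \<cdot> (f \<boxtimes> (\<mu> v' w' \<cdot> (g \<boxtimes> h) \<cdot> \<nu> v w)) \<cdot> \<nu> u (v @ w)"
    unfolding f3 \<nu>_assoc[OF L(1-3)] by (simp add: S cmp_assoc_arr)
  finally show ?thesis .
qed

lemma word_cat_iso_Idn: "u \<in> lists L \<Longrightarrow> is_iso (word_cat e) (u, \<iota> (word_obj u), u)"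
  unfolding is_iso_def inverse_arrs_def
  by (rule exI[of _ "(u, \<iota> (word_obj u), u)"]) (simp add: word_cat_Arr word_cat_Hom word_simps Idn_Hom)

proposition strict_monoidal_word_cat: "strict_monoidal_category (word_cat e)"
proof unfold_locales
  let ?W = "word_cat e"
  show "f \<in> Arr ?W \<Longrightarrow> Dom ?W f \<in> Obj ?W" for f
    by (cases f) (simp add: word_cat_Arr)
  show "f \<in> Arr ?W \<Longrightarrow> Cod ?W f \<in> Obj ?W" for f
    by (cases f) (simp add: word_cat_Arr)
  show "V \<in> Obj ?W \<Longrightarrow> \<iota>\<^bsub>?W\<^esub> V \<in> Hom ?W V V" for V
    by (simp add: word_cat_Hom Idn_Hom word_obj_Obj)
  show "\<lbrakk>f \<in> Hom ?W U V; g \<in> Hom ?W V X\<rbrakk> \<Longrightarrow> g \<cdot>\<^bsub>?W\<^esub> f \<in> Hom ?W U X" for f g U V X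
    by (auto simp: word_cat_Hom intro: cmp_Hom)
  show "f \<in> Hom ?W U V \<Longrightarrow> f \<cdot>\<^bsub>?W\<^esub> \<iota>\<^bsub>?W\<^esub> U = f" for f U V
    by (auto simp: word_cat_Hom cmp_Idn_right)
  show "f \<in> Hom ?W U V \<Longrightarrow> \<iota>\<^bsub>?W\<^esub> V \<cdot>\<^bsub>?W\<^esub> f = f" for f U V
    by (auto simp: word_cat_Hom cmp_Idn_left)
  show "\<lbrakk>f \<in> Hom ?W T U; g \<in> Hom ?W U V; h \<in> Hom ?W V X\<rbrakk> \<Longrightarrow>
      (h \<cdot>\<^bsub>?W\<^esub> g) \<cdot>\<^bsub>?W\<^esub> f = h \<cdot>\<^bsub>?W\<^esub> (g \<cdot>\<^bsub>?W\<^esub> f)" for f g h T U V X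
    by (auto simp: word_cat_Hom cmp_assoc)
  show "\<lbrakk>f \<in> Hom ?W V V'; g \<in> Hom ?W X X'\<rbrakk> \<Longrightarrow>
      f \<boxtimes>\<^bsub>?W\<^esub> g \<in> Hom ?W (V \<otimes>\<^bsub>?W\<^esub> X) (V' \<otimes>\<^bsub>?W\<^esub> X')" for f g V V' X X'
    by (auto simp: word_cat_Hom intro: word_cat_tens_Hom)
  show "\<lbrakk>V \<in> Obj ?W; X \<in> Obj ?W\<rbrakk> \<Longrightarrow>
      \<iota>\<^bsub>?W\<^esub> V \<boxtimes>\<^bsub>?W\<^esub> \<iota>\<^bsub>?W\<^esub> X = \<iota>\<^bsub>?W\<^esub> (V \<otimes>\<^bsub>?W\<^esub> X)" for V X
    by (simp add: word_simps \<mu>_\<nu>)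
  show "\<lbrakk>f \<in> Hom ?W U V; g \<in> Hom ?W V X; f' \<in> Hom ?W U' V'; g' \<in> Hom ?W V' X'\<rbrakk> \<Longrightarrow>
      (g \<cdot>\<^bsub>?W\<^esub> f) \<boxtimes>\<^bsub>?W\<^esub> (g' \<cdot>\<^bsub>?W\<^esub> f') = (g \<boxtimes>\<^bsub>?W\<^esub> g') \<cdot>\<^bsub>?W\<^esub> (f \<boxtimes>\<^bsub>?W\<^esub> f')"
    for f g f' g' U V X U' V' X'
    by (auto simp: word_cat_Hom intro!: word_cat_tens_cmp[symmetric])
  show "\<lbrakk>U \<in> Obj ?W; V \<in> Obj ?W; X \<in> Obj ?W\<rbrakk> \<Longrightarrow>
      \<Phi>\<^bsub>?W\<^esub> U V X \<in> Hom ?W ((U \<otimes>\<^bsub>?W\<^esub> V) \<otimes>\<^bsub>?W\<^esub> X) (U \<otimes>\<^bsub>?W\<^esub> (V \<otimes>\<^bsub>?W\<^esub> X))" for U V X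
    by (simp add: word_cat_Hom Idn_Hom word_obj_Obj)
  show "\<lbrakk>U \<in> Obj ?W; V \<in> Obj ?W; X \<in> Obj ?W\<rbrakk> \<Longrightarrow> is_iso ?W (\<Phi>\<^bsub>?W\<^esub> U V X)" for U V X
    using word_cat_iso_Idn[of "U @ V @ X"] by simp
  show "\<Phi>\<^bsub>?W\<^esub> U' V' X' \<cdot>\<^bsub>?W\<^esub> ((f \<boxtimes>\<^bsub>?W\<^esub> g) \<boxtimes>\<^bsub>?W\<^esub> h)
        = (f \<boxtimes>\<^bsub>?W\<^esub> (g \<boxtimes>\<^bsub>?W\<^esub> h)) \<cdot>\<^bsub>?W\<^esub> \<Phi>\<^bsub>?W\<^esub> U V X"
    if "f \<in> Hom ?W U U'" "g \<in> Hom ?W V V'" "h \<in> Hom ?W X X'"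
    for f g h U U' V V' X X'
  proof -
    from that obtain f0 g0 h0 where fgh: "f = (U, f0, U')" "g = (V, g0, V')" "h = (X, h0, X')"
      and L: "U \<in> lists L" "V \<in> lists L" "X \<in> lists L" "U' \<in> lists L" "V' \<in> lists L" "X' \<in> lists L"
      and H: "f0 \<in> Hom C (word_obj U) (word_obj U')" "g0 \<in> Hom C (word_obj V) (word_obj V')"
          "h0 \<in> Hom C (word_obj X) (word_obj X')"
      by (auto simp: word_cat_Hom)
    have "\<mu> U' (V' @ X') \<cdot> (f0 \<boxtimes> (\<mu> V' X' \<cdot> (g0 \<boxtimes> h0) \<cdot> \<nu> V X)) \<cdot> \<nu> U (V @ X)
        \<in> Hom C (word_obj (U @ V @ X)) (word_obj (U' @ V' @ X'))"
      using L H by (intro word_cat_tens_Hom) auto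
    note R = cmp_Idn_left[OF this] cmp_Idn_right[OF this]
    show ?thesis
      unfolding fgh by (simp only: word_cat_sel append_assoc word_cat_tens_assoc[OF H L] R)
  qed
  show "\<lbrakk>T \<in> Obj ?W; U \<in> Obj ?W; V \<in> Obj ?W; X \<in> Obj ?W\<rbrakk> \<Longrightarrow>
      (\<iota>\<^bsub>?W\<^esub> T \<boxtimes>\<^bsub>?W\<^esub> \<Phi>\<^bsub>?W\<^esub> U V X) \<cdot>\<^bsub>?W\<^esub> \<Phi>\<^bsub>?W\<^esub> T (U \<otimes>\<^bsub>?W\<^esub> V) X \<cdot>\<^bsub>?W\<^esub> (\<Phi>\<^bsub>?W\<^esub> T U V \<boxtimes>\<^bsub>?W\<^esub> \<iota>\<^bsub>?W\<^esub> X)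
        = \<Phi>\<^bsub>?W\<^esub> T U (V \<otimes>\<^bsub>?W\<^esub> X) \<cdot>\<^bsub>?W\<^esub> \<Phi>\<^bsub>?W\<^esub> (T \<otimes>\<^bsub>?W\<^esub> U) V X" for T U V X
    using \<mu>_\<nu>[of "T @ U @ V" X] \<mu>_\<nu>[of T "U @ V @ X"] by (simp add: word_simps)
  show "\<lbrakk>f \<in> Arr ?W\<rbrakk> \<Longrightarrow> f \<boxtimes>\<^bsub>?W\<^esub> \<iota>\<^bsub>?W\<^esub> \<I>\<^bsub>?W\<^esub> = f" for f
    by (cases f) (auto simp: word_cat_Arr word_simps \<mu>_Nil \<nu>_Nil Hom_def)
  show "\<lbrakk>f \<in> Arr ?W\<rbrakk> \<Longrightarrow> \<iota>\<^bsub>?W\<^esub> \<I>\<^bsub>?W\<^esub> \<boxtimes>\<^bsub>?W\<^esub> f = f" for f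
    by (cases f) (auto simp: word_cat_Arr word_simps Hom_def)
qed auto

end


section \<open>Rotation of pairings\<close>

text \<open>
  The monoidal category is strict but the choice of duals need not be: \<open>star\<close> may reverse tensor
  products only up to isomorphism, and may move the unit. Duality is expressed by the universal
  property of transposes, and by copairings for a set \<open>L\<close> of generating objects.
\<close>
locale dual_pairings = strict_monoidal_category C
  for C :: "('o, 'a, 'm) mon_data_scheme" (structure) +
  fixes star :: "'o \<Rightarrow> 'o" and e :: "'o \<Rightarrow> 'a" and L :: "'o set"
  assumes star_Obj: "u \<in> Obj C \<Longrightarrow> star u \<in> Obj C"
    and e_Hom: "u \<in> Obj C \<Longrightarrow> e u \<in> Hom C (star u \<otimes> u) \<I>"
    and ex1_transpose: "u \<in> Obj C \<Longrightarrow> v \<in> Obj C \<Longrightarrow> p \<in> Hom C (v \<otimes> u) \<I> \<Longrightarrow>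
      \<exists>!t. t \<in> Hom C v (star u) \<and> e u \<cdot> (t \<boxtimes> \<iota> u) = p"
    and L_Obj: "l \<in> L \<Longrightarrow> l \<in> Obj C"
    and L_exact: "l \<in> L \<Longrightarrow> \<exists>c. exact_pairing C (star l) l (e l) c"
begin

definition transpose :: "'o \<Rightarrow> 'o \<Rightarrow> 'a \<Rightarrow> 'a" where
  "transpose v u p = (THE t. t \<in> Hom C v (star u) \<and> e u \<cdot> (t \<boxtimes> \<iota> u) = p)"

lemma transpose:
  assumes "u \<in> Obj C" "v \<in> Obj C" "p \<in> Hom C (v \<otimes> u) \<I>"
  shows "transpose v u p \<in> Arr C" "Dom C (transpose v u p) = v" "Cod C (transpose v u p) = star u"
    "e u \<cdot> (transpose v u p \<boxtimes> \<iota> u) = p"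
  using theI'[OF ex1_transpose[OF assms]] by (auto simp: transpose_def Hom_def)

lemma e_arr:
  assumes "u \<in> Obj C"
  shows "e u \<in> Arr C" "Dom C (e u) = star u \<otimes> u" "Cod C (e u) = \<I>"
  using HomD[OF e_Hom[OF assms]] by auto

lemmas dual_simps = strict_simps star_Obj e_arr transpose(1-3) L_Obj

lemma transpose_eqI:
  assumes "u \<in> Obj C" "t \<in> Hom C v (star u)" "e u \<cdot> (t \<boxtimes> \<iota> u) = p"
  shows "transpose v u p = t"
proof -
  note t = HomE[OF assms(2)]
  have "p \<in> Hom C (v \<otimes> u) \<I>"
    using assms(1) t by (simp add: assms(3)[symmetric] Hom_def dual_simps)
  from ex1_transpose[OF assms(1) _ this] show ?thesis
    unfolding transpose_def using assms t by (intro the1_equality) auto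
qed

lemma transpose_cancel:
  assumes "u \<in> Obj C" "t \<in> Hom C v (star u)" "s \<in> Hom C v (star u)"
    and "e u \<cdot> (t \<boxtimes> \<iota> u) = e u \<cdot> (s \<boxtimes> \<iota> u)"
  shows "t = s"
  using transpose_eqI[OF assms(1,2) refl] transpose_eqI[OF assms(1,3) refl] assms(4) by metis

definition star_arr :: "'a \<Rightarrow> 'a" where
  "star_arr f = transpose (star (Cod C f)) (Dom C f) (e (Cod C f) \<cdot> (\<iota> (star (Cod C f)) \<boxtimes> f))"

lemma star_arr:
  assumes "f \<in> Hom C u w"
  shows "star_arr f \<in> Arr C" "Dom C (star_arr f) = star w" "Cod C (star_arr f) = star u"
    "e u \<cdot> (star_arr f \<boxtimes> \<iota> u) = e w \<cdot> (\<iota> (star w) \<boxtimes> f)"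
proof -
  note f = HomE[OF assms]
  have "e w \<cdot> (\<iota> (star w) \<boxtimes> f) \<in> Hom C (star w \<otimes> u) \<I>"
    using f by (simp add: Hom_def dual_simps)
  from transpose[OF _ _ this]
  show "star_arr f \<in> Arr C" "Dom C (star_arr f) = star w" "Cod C (star_arr f) = star u"
    "e u \<cdot> (star_arr f \<boxtimes> \<iota> u) = e w \<cdot> (\<iota> (star w) \<boxtimes> f)"
    using f by (simp_all add: star_arr_def star_Obj)
qed

definition tens_pairing :: "'o \<Rightarrow> 'o \<Rightarrow> 'a" where
  "tens_pairing u v = e v \<cdot> (\<iota> (star v) \<boxtimes> (e u \<boxtimes> \<iota> v))"

lemma tens_pairing_arr:
  assumes "u \<in> Obj C" "v \<in> Obj C"
  shows "tens_pairing u v \<in> Arr C" "Dom C (tens_pairing u v) = star v \<otimes> star u \<otimes> u \<otimes> v"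
    "Cod C (tens_pairing u v) = \<I>"
  using assms by (simp_all add: tens_pairing_def dual_simps)

definition star_tens :: "'o \<Rightarrow> 'o \<Rightarrow> 'a" where
  "star_tens u v = transpose (star v \<otimes> star u) (u \<otimes> v) (tens_pairing u v)"

lemma star_tens:
  assumes "u \<in> Obj C" "v \<in> Obj C"
  shows "star_tens u v \<in> Arr C" "Dom C (star_tens u v) = star v \<otimes> star u"
    "Cod C (star_tens u v) = star (u \<otimes> v)"
    "e (u \<otimes> v) \<cdot> (star_tens u v \<boxtimes> (\<iota> u \<boxtimes> \<iota> v)) = tens_pairing u v"
proof -
  have "tens_pairing u v \<in> Hom C ((star v \<otimes> star u) \<otimes> (u \<otimes> v)) \<I>"
    using assms by (simp add: Hom_def tens_pairing_arr dual_simps)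
  from transpose[OF _ _ this]
  show "star_tens u v \<in> Arr C" "Dom C (star_tens u v) = star v \<otimes> star u"
    "Cod C (star_tens u v) = star (u \<otimes> v)"
    "e (u \<otimes> v) \<cdot> (star_tens u v \<boxtimes> (\<iota> u \<boxtimes> \<iota> v)) = tens_pairing u v"
    using assms by (simp_all add: star_tens_def dual_simps)
qed

lemma tens_pairing_tens:
  assumes "u \<in> Obj C" "v \<in> Obj C" "t \<in> Hom C w (star v \<otimes> star u)"
  shows "tens_pairing u v \<cdot> (t \<boxtimes> (\<iota> u \<boxtimes> \<iota> v))
    = e v \<cdot> (((\<iota> (star v) \<boxtimes> e u) \<cdot> (t \<boxtimes> \<iota> u)) \<boxtimes> \<iota> v)"
  using assms HomE[OF assms(3)]
  by (simp add: tens_pairing_def dual_simps tens_cmp_Idn[symmetric] cmp_assoc_arr)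

text \<open>
  The nested pairing of \<open>l \<otimes> v\<close> has the universal property of a dual as well: first transpose along
  \<open>v\<close>, then bend the strand \<open>l\<close>, which is possible because \<open>l\<close> is paired exactly.
\<close>
lemma ex1_tens_transpose:
  assumes l: "l \<in> L" and v: "v \<in> Obj C" and w: "w \<in> Obj C"
    and p: "p \<in> Hom C (w \<otimes> l \<otimes> v) \<I>"
  shows "\<exists>!t. t \<in> Hom C w (star v \<otimes> star l) \<and> tens_pairing l v \<cdot> (t \<boxtimes> (\<iota> l \<boxtimes> \<iota> v)) = p"
proof -
  obtain c where c: "exact_pairing C (star l) l (e l) c" using L_exact l by blast
  note S = dual_simps l v w HomD[OF p]
  define k where "k = transpose (w \<otimes> l) v p"
  have p': "p \<in> Hom C ((w \<otimes> l) \<otimes> v) \<I>" using p by (simp add: S)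
  have k: "k \<in> Hom C (w \<otimes> l) (star v)" "e v \<cdot> (k \<boxtimes> \<iota> v) = p"
    using transpose[OF _ _ p'] by (simp_all add: k_def Hom_def S)
  have eq: "tens_pairing l v \<cdot> (t \<boxtimes> (\<iota> l \<boxtimes> \<iota> v)) = p \<longleftrightarrow> (\<iota> (star v) \<boxtimes> e l) \<cdot> (t \<boxtimes> \<iota> l) = k"
    if t: "t \<in> Hom C w (star v \<otimes> star l)" for t
  proof -
    have "(\<iota> (star v) \<boxtimes> e l) \<cdot> (t \<boxtimes> \<iota> l) \<in> Hom C (w \<otimes> l) (star v)"
      using HomD[OF t] by (simp add: Hom_def S)
    then show ?thesis
      using transpose_cancel[OF v _ k(1)] k(2) tens_pairing_tens[OF L_Obj[OF l] v t] by metis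
  qed
  show ?thesis
    using exact_pairing_transpose[OF c w _ k(1)] eq by (simp add: S cong: conj_cong)
qed

text \<open>
  Two objects with the same universal property are isomorphic. This is the invertibility of
  \<open>zeta\<close> in the strict setting.
\<close>
lemma star_tens_inverse:
  assumes l: "l \<in> L" and v: "v \<in> Obj C"
  obtains z where "z \<in> Hom C (star (l \<otimes> v)) (star v \<otimes> star l)"
    "star_tens l v \<cdot> z = \<iota> (star (l \<otimes> v))" "z \<cdot> star_tens l v = \<iota> (star v \<otimes> star l)"
proof -
  note S = dual_simps l v star_tens(1-3)[OF L_Obj[OF l] v] tens_pairing_arr
  let ?z = "star_tens l v"
  obtain z where z: "z \<in> Hom C (star (l \<otimes> v)) (star v \<otimes> star l)"
      and z_eq: "tens_pairing l v \<cdot> (z \<boxtimes> (\<iota> l \<boxtimes> \<iota> v)) = e (l \<otimes> v)"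
    using ex1_tens_transpose[OF l v, of "star (l \<otimes> v)" "e (l \<otimes> v)"] by (auto simp: Hom_def S)
  note S = S HomD[OF z]
  note tp = star_tens(4)[OF L_Obj[OF l] v]
  have "e (l \<otimes> v) \<cdot> ((?z \<cdot> z) \<boxtimes> \<iota> (l \<otimes> v)) = (e (l \<otimes> v) \<cdot> (?z \<boxtimes> (\<iota> l \<boxtimes> \<iota> v))) \<cdot> (z \<boxtimes> (\<iota> l \<boxtimes> \<iota> v))"
    by (simp add: S tens_cmp_Idn[symmetric] cmp_assoc_arr)
  also have "\<dots> = e (l \<otimes> v) \<cdot> (\<iota> (star (l \<otimes> v)) \<boxtimes> \<iota> (l \<otimes> v))"
    unfolding tp z_eq by (simp add: S)
  finally have 1: "?z \<cdot> z = \<iota> (star (l \<otimes> v))"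
    by - (rule transpose_cancel[where u = "l \<otimes> v" and v = "star (l \<otimes> v)"],
      simp_all add: Hom_def S)
  have "tens_pairing l v \<cdot> ((z \<cdot> ?z) \<boxtimes> (\<iota> l \<boxtimes> \<iota> v))
      = (tens_pairing l v \<cdot> (z \<boxtimes> (\<iota> l \<boxtimes> \<iota> v))) \<cdot> (?z \<boxtimes> (\<iota> l \<boxtimes> \<iota> v))"
    by (simp add: S tens_cmp_Idn[symmetric] cmp_assoc_arr)
  also have "\<dots> = tens_pairing l v"
    unfolding z_eq tp ..
  finally have "tens_pairing l v \<cdot> ((z \<cdot> ?z) \<boxtimes> (\<iota> l \<boxtimes> \<iota> v)) = tens_pairing l v" .
  moreover have "tens_pairing l v \<cdot> (\<iota> (star v \<otimes> star l) \<boxtimes> (\<iota> l \<boxtimes> \<iota> v)) = tens_pairing l v"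
    by (simp add: S)
  moreover have "z \<cdot> ?z \<in> Hom C (star v \<otimes> star l) (star v \<otimes> star l)"
    "\<iota> (star v \<otimes> star l) \<in> Hom C (star v \<otimes> star l) (star v \<otimes> star l)"
    by (simp_all add: Hom_def S)
  moreover have "\<exists>!t. t \<in> Hom C (star v \<otimes> star l) (star v \<otimes> star l) \<and>
      tens_pairing l v \<cdot> (t \<boxtimes> (\<iota> l \<boxtimes> \<iota> v)) = tens_pairing l v"
    by (rule ex1_tens_transpose[OF l v]) (simp_all add: Hom_def S)
  ultimately have 2: "z \<cdot> ?z = \<iota> (star v \<otimes> star l)"
    by blast
  show ?thesis using that[OF z 1 2] .
qed

end

text \<open>
  The pivotal structure \<open>j\<close> is compared with tensor products whose left factor is a generator; for
  words this is the case free of re-bracketing. In \<open>j_unit\<close> the transpose of \<open>\<iota> \<I>\<close> is the comparison of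
  \<open>\<I>\<close> with its dual, which may differ from \<open>\<I>\<close> here.
\<close>
locale pivotal_pairings = dual_pairings C star e L
  for C :: "('o, 'a, 'm) mon_data_scheme" (structure) and star e L +
  fixes j :: "'o \<Rightarrow> 'a"
  assumes j_Hom: "u \<in> Obj C \<Longrightarrow> j u \<in> Hom C u (star (star u))"
    and j_natural: "f \<in> Hom C u w \<Longrightarrow> j w \<cdot> f = star_arr (star_arr f) \<cdot> j u"
    and j_unit: "e (star \<I>) \<cdot> (j \<I> \<boxtimes> transpose \<I> \<I> (\<iota> \<I>)) = \<iota> \<I>"
    and j_tens: "l \<in> L \<Longrightarrow> v \<in> Obj C \<Longrightarrow>
      star_arr (star_tens l v) \<cdot> j (l \<otimes> v) = star_tens (star v) (star l) \<cdot> (j l \<boxtimes> j v)"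
begin

lemma j_arr:
  assumes "u \<in> Obj C"
  shows "j u \<in> Arr C" "Dom C (j u) = u" "Cod C (j u) = star (star u)"
  using HomD[OF j_Hom[OF assms]] by auto

lemmas piv_simps = dual_simps j_arr

text \<open>
  In string diagrams, \<open>rot u v\<close> carries the strand \<open>v\<close> around \<open>p\<close> from the right end to the left end.
\<close>
definition rot :: "'o \<Rightarrow> 'o \<Rightarrow> 'a \<Rightarrow> 'a" where
  "rot u v p = e (star v) \<cdot> (j v \<boxtimes> transpose u v p)"

lemma rot_arr:
  assumes "u \<in> Obj C" "v \<in> Obj C" "p \<in> Hom C (u \<otimes> v) \<I>"
  shows "rot u v p \<in> Arr C" "Dom C (rot u v p) = v \<otimes> u" "Cod C (rot u v p) = \<I>"
  using assms transpose[OF assms(2,1,3)] by (simp_all add: rot_def piv_simps)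

text \<open>
  Transposition moves an arrow \<open>f\<close> on the rotated strand to the other strand as its dual; evaluation
  moves it back as its double dual, which naturality of \<open>j\<close> exchanges for \<open>f\<close>.
\<close>
lemma rot_natural:
  assumes p: "p \<in> Hom C (u \<otimes> v) \<I>" and g: "g \<in> Hom C b u" and f: "f \<in> Hom C a v"
  shows "rot b a (p \<cdot> (g \<boxtimes> f)) = rot u v p \<cdot> (f \<boxtimes> g)"
proof -
  note gf = HomE[OF g] HomE[OF f]
  define t where "t = transpose u v p"
  note t = transpose[OF gf(10,5) p, folded t_def]
  note f' = star_arr[OF f]
  have "star_arr f \<in> Hom C (star v) (star a)" using f' by (simp add: Hom_def)
  note f'' = star_arr[OF this]
  note S = piv_simps gf t(1-3) f'(1-3) f''(1-3)
  \<comment> \<open>The arrow \<open>f\<close> moves across the pairing and becomes its dual.\<close>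
  have "transpose b a (p \<cdot> (g \<boxtimes> f)) = star_arr f \<cdot> t \<cdot> g"
  proof (rule transpose_eqI)
    have "e a \<cdot> ((star_arr f \<cdot> t \<cdot> g) \<boxtimes> \<iota> a) = (e a \<cdot> (star_arr f \<boxtimes> \<iota> a)) \<cdot> ((t \<cdot> g) \<boxtimes> \<iota> a)"
      by (simp add: S tens_cmp_Idn[symmetric] cmp_assoc_arr)
    also have "\<dots> = e v \<cdot> ((\<iota> (star v) \<boxtimes> f) \<cdot> ((t \<cdot> g) \<boxtimes> \<iota> a))"
      by (simp add: f'(4) S cmp_assoc_arr)
    also have "(\<iota> (star v) \<boxtimes> f) \<cdot> ((t \<cdot> g) \<boxtimes> \<iota> a) = (t \<boxtimes> \<iota> v) \<cdot> (g \<boxtimes> f)"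
      by (simp add: S tens_cmp_arr)
    also have "e v \<cdot> (t \<boxtimes> \<iota> v) \<cdot> (g \<boxtimes> f) = (e v \<cdot> (t \<boxtimes> \<iota> v)) \<cdot> (g \<boxtimes> f)"
      by (simp add: S cmp_assoc_arr)
    finally show "e a \<cdot> ((star_arr f \<cdot> t \<cdot> g) \<boxtimes> \<iota> a) = p \<cdot> (g \<boxtimes> f)" unfolding t(4) .
  qed (simp_all add: Hom_def S)
  then have "rot b a (p \<cdot> (g \<boxtimes> f)) = e (star a) \<cdot> (j a \<boxtimes> (star_arr f \<cdot> t \<cdot> g))"
    by (simp add: rot_def)
  also have "j a \<boxtimes> (star_arr f \<cdot> t \<cdot> g) = (\<iota> (star (star a)) \<boxtimes> star_arr f) \<cdot> (j a \<boxtimes> (t \<cdot> g))"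
    by (simp add: S tens_cmp_arr)
  also have "e (star a) \<cdot> \<dots> = (e (star a) \<cdot> (\<iota> (star (star a)) \<boxtimes> star_arr f)) \<cdot> (j a \<boxtimes> (t \<cdot> g))"
    by (simp add: S cmp_assoc_arr)
  also have "\<dots> = e (star v) \<cdot> (star_arr (star_arr f) \<boxtimes> \<iota> (star v)) \<cdot> (j a \<boxtimes> (t \<cdot> g))"
    by (simp add: f''(4)[symmetric] S cmp_assoc_arr)
  also have "(star_arr (star_arr f) \<boxtimes> \<iota> (star v)) \<cdot> (j a \<boxtimes> (t \<cdot> g)) = (j v \<boxtimes> t) \<cdot> (f \<boxtimes> g)"
    by (simp add: S tens_cmp_arr j_natural[OF f])
  also have "e (star v) \<cdot> \<dots> = rot u v p \<cdot> (f \<boxtimes> g)"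
    by (simp add: rot_def t_def[symmetric] S cmp_assoc_arr)
  finally show ?thesis .
qed

text \<open>
  By naturality the pairing \<open>p\<close> can be pulled out, leaving the rotation of the identity of the unit.
\<close>
lemma rot_unit:
  assumes v: "v \<in> Obj C" and p: "p \<in> Hom C v \<I>"
  shows "rot \<I> v p = p"
proof -
  have "rot \<I> v (\<iota> \<I> \<cdot> (\<iota> \<I> \<boxtimes> p)) = rot \<I> \<I> (\<iota> \<I>) \<cdot> (p \<boxtimes> \<iota> \<I>)"
    using v p by (intro rot_natural) (simp_all add: Hom_def piv_simps)
  then show ?thesis
    using v HomD[OF p] by (simp add: piv_simps rot_def[of \<I> \<I>] j_unit)
qed

text \<open>
  Rotating \<open>l \<otimes> v\<close> in one go or strand by strand. Write \<open>p\<close> as the nested pairing of \<open>l \<otimes> v\<close> with some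
  \<open>t\<close> from \<open>u\<close> to \<open>star v \<otimes> star l\<close>, which is possible because \<open>star_tens\<close> is invertible. Both sides
  then equal the nested pairing of \<open>star v\<close> and \<open>star l\<close> applied to \<open>j l \<boxtimes> j v \<boxtimes> t\<close>: the left side
  because \<open>j\<close> is compatible with the tensor product, the right side by computing transposes.
\<close>
lemma rot_cocycle:
  assumes u: "u \<in> Obj C" and l: "l \<in> L" and v: "v \<in> Obj C"
    and p: "p \<in> Hom C (u \<otimes> l \<otimes> v) \<I>"
  shows "rot u (l \<otimes> v) p = rot (v \<otimes> u) l (rot (u \<otimes> l) v p)"
proof -
  note L = L_Obj[OF l]
  define z where "z = star_tens l v"
  note z = star_tens[OF L v, folded z_def]
  obtain z' where z': "z' \<in> Hom C (star (l \<otimes> v)) (star v \<otimes> star l)"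
      and zz': "z \<cdot> z' = \<iota> (star (l \<otimes> v))"
    using star_tens_inverse[OF l v] by (metis z_def)
  note p' = transpose[OF tens_Obj[OF L v] u p]
  \<comment> \<open>\<open>t\<close> is the transpose of \<open>p\<close> with respect to the nested pairing of \<open>l \<otimes> v\<close>.\<close>
  define t where "t = z' \<cdot> transpose u (l \<otimes> v) p"
  have t: "t \<in> Arr C" "Dom C t = u" "Cod C t = star v \<otimes> star l"
    using HomD[OF z'] p' by (simp_all add: t_def piv_simps)
  note S = piv_simps u L v t z(1-3) HomD[OF p]
  have zt: "z \<cdot> t = transpose u (l \<otimes> v) p"
    using HomD[OF z'] p'
    by (simp add: t_def S zz' cmp_assoc_arr[symmetric])
  have tH: "t \<in> Hom C u (star v \<otimes> star l)" using t by (simp add: Hom_def)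
  have "p = e (l \<otimes> v) \<cdot> ((z \<cdot> t) \<boxtimes> \<iota> (l \<otimes> v))"
    using p'(4) by (simp add: zt)
  also have "\<dots> = (e (l \<otimes> v) \<cdot> (z \<boxtimes> (\<iota> l \<boxtimes> \<iota> v))) \<cdot> (t \<boxtimes> (\<iota> l \<boxtimes> \<iota> v))"
    by (simp add: S tens_cmp_Idn[symmetric] cmp_assoc_arr)
  also have "\<dots> = e v \<cdot> (((\<iota> (star v) \<boxtimes> e l) \<cdot> (t \<boxtimes> \<iota> l)) \<boxtimes> \<iota> v)"
    unfolding z(4) by (rule tens_pairing_tens[OF L v tH])
  finally have k: "transpose (u \<otimes> l) v p = (\<iota> (star v) \<boxtimes> e l) \<cdot> (t \<boxtimes> \<iota> l)"
    by (intro transpose_eqI) (simp_all add: Hom_def S)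
  let ?q = "(e (star v) \<boxtimes> \<iota> (star l)) \<cdot> (j v \<boxtimes> t)"
  have "transpose (v \<otimes> u) l (rot (u \<otimes> l) v p) = ?q"
  proof (rule transpose_eqI)
    have "e l \<cdot> (?q \<boxtimes> \<iota> l) = (e l \<cdot> (e (star v) \<boxtimes> \<iota> (star l \<otimes> l))) \<cdot> (j v \<boxtimes> (t \<boxtimes> \<iota> l))"
      by (simp add: S tens_cmp_Idn[symmetric] cmp_assoc_arr)
    also have "e l \<cdot> (e (star v) \<boxtimes> \<iota> (star l \<otimes> l)) = e (star v) \<boxtimes> e l"
      using tens_swap(2)[of "e (star v)" "e l"] by (simp add: S)
    also have "\<dots> = e (star v) \<cdot> (\<iota> (star (star v) \<otimes> star v) \<boxtimes> e l)"
      using tens_swap(1)[of "e (star v)" "e l"] by (simp add: S)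
    also have "\<dots> \<cdot> (j v \<boxtimes> (t \<boxtimes> \<iota> l)) = e (star v) \<cdot> (\<iota> (star (star v)) \<boxtimes> (\<iota> (star v) \<boxtimes> e l))
        \<cdot> (j v \<boxtimes> (t \<boxtimes> \<iota> l))"
      by (simp add: S cmp_assoc_arr tens_Idn_split(1))
    also have "(\<iota> (star (star v)) \<boxtimes> (\<iota> (star v) \<boxtimes> e l)) \<cdot> (j v \<boxtimes> (t \<boxtimes> \<iota> l))
        = j v \<boxtimes> ((\<iota> (star v) \<boxtimes> e l) \<cdot> (t \<boxtimes> \<iota> l))"
      by (simp add: S tens_cmp_arr)
    finally show "e l \<cdot> (?q \<boxtimes> \<iota> l) = rot (u \<otimes> l) v p"
      by (simp add: rot_def k)
  qed (simp_all add: Hom_def S)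
  then have "rot (v \<otimes> u) l (rot (u \<otimes> l) v p) = e (star l) \<cdot> (j l \<boxtimes> ?q)"
    by (simp add: rot_def[of _ l])
  also have "j l \<boxtimes> ?q = (\<iota> (star (star l)) \<boxtimes> (e (star v) \<boxtimes> \<iota> (star l))) \<cdot> (j l \<boxtimes> (j v \<boxtimes> t))"
    by (simp add: S tens_cmp_arr)
  also have "e (star l) \<cdot> \<dots> = tens_pairing (star v) (star l) \<cdot> (j l \<boxtimes> (j v \<boxtimes> t))"
    by (simp add: tens_pairing_def S cmp_assoc_arr)
  finally have 1: "rot (v \<otimes> u) l (rot (u \<otimes> l) v p) = tens_pairing (star v) (star l) \<cdot> (j l \<boxtimes> (j v \<boxtimes> t))" .
  note w = star_tens[OF star_Obj[OF v] star_Obj[OF L]]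
  have zH: "z \<in> Hom C (star v \<otimes> star l) (star (l \<otimes> v))" using z by (simp add: Hom_def)
  note z2 = star_arr[OF zH]
  note S = S w(1-3) z2(1-3)
  have "rot u (l \<otimes> v) p = e (star (l \<otimes> v)) \<cdot> (j (l \<otimes> v) \<boxtimes> (z \<cdot> t))"
    by (simp add: rot_def zt)
  also have "j (l \<otimes> v) \<boxtimes> (z \<cdot> t) = (\<iota> (star (star (l \<otimes> v))) \<boxtimes> z) \<cdot> (j (l \<otimes> v) \<boxtimes> t)"
    by (simp add: S tens_cmp_arr)
  also have "e (star (l \<otimes> v)) \<cdot> \<dots> = (e (star (l \<otimes> v)) \<cdot> (\<iota> (star (star (l \<otimes> v))) \<boxtimes> z)) \<cdot> (j (l \<otimes> v) \<boxtimes> t)"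
    by (simp add: S cmp_assoc_arr)
  also have "\<dots> = e (star v \<otimes> star l) \<cdot> (star_arr z \<boxtimes> \<iota> (star v \<otimes> star l)) \<cdot> (j (l \<otimes> v) \<boxtimes> t)"
    unfolding z2(4)[symmetric] by (rule cmp_assoc_arr) (simp_all add: S)
  also have "(star_arr z \<boxtimes> \<iota> (star v \<otimes> star l)) \<cdot> (j (l \<otimes> v) \<boxtimes> t) = (star_arr z \<cdot> j (l \<otimes> v)) \<boxtimes> t"
    by (simp add: S tens_cmp_arr)
  also have "star_arr z \<cdot> j (l \<otimes> v) = star_tens (star v) (star l) \<cdot> (j l \<boxtimes> j v)"
    unfolding z_def by (rule j_tens[OF l v])
  also have "(star_tens (star v) (star l) \<cdot> (j l \<boxtimes> j v)) \<boxtimes> t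
      = (star_tens (star v) (star l) \<boxtimes> (\<iota> (star v) \<boxtimes> \<iota> (star l))) \<cdot> ((j l \<boxtimes> j v) \<boxtimes> t)"
    using tens_cmp_arr[of "j l \<boxtimes> j v" "star_tens (star v) (star l)" t "\<iota> (star v) \<boxtimes> \<iota> (star l)"]
    by (simp add: S)
  also have "e (star v \<otimes> star l) \<cdot> \<dots> = (e (star v \<otimes> star l) \<cdot>
      (star_tens (star v) (star l) \<boxtimes> (\<iota> (star v) \<boxtimes> \<iota> (star l)))) \<cdot> ((j l \<boxtimes> j v) \<boxtimes> t)"
    by (rule cmp_assoc_arr[symmetric]) (simp_all add: S)
  also have "\<dots> = tens_pairing (star v) (star l) \<cdot> (j l \<boxtimes> (j v \<boxtimes> t))"
    unfolding w(4) by (simp add: S)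
  finally show ?thesis unfolding 1 .
qed

text \<open>
  Rotating \<open>v\<close> and then \<open>l\<close> is rotating everything past the unit.
\<close>
lemma rot_rot:
  assumes l: "l \<in> L" and v: "v \<in> Obj C" and p: "p \<in> Hom C (l \<otimes> v) \<I>"
  shows "rot v l (rot l v p) = p"
  using rot_cocycle[OF unit_Obj l v] rot_unit[OF _ p] p by (simp add: piv_simps v l)

text \<open>
  By the cocycle identity it suffices to rotate first \<open>v\<close> and then \<open>l\<close>. By naturality the first step
  acts on the outer pairing \<open>q\<close> alone and places it beside \<open>p\<close>; the second then rotates \<open>p\<close> around it.
\<close>
lemma rot_tensor:
  assumes l: "l \<in> L" and v: "v \<in> Obj C" and l': "l' \<in> Obj C" and v': "v' \<in> Obj C"
    and p: "p \<in> Hom C (l' \<otimes> l) \<I>" and q: "q \<in> Hom C (v' \<otimes> v) \<I>"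
  shows "rot (v' \<otimes> l') (l \<otimes> v) (q \<cdot> (\<iota> v' \<boxtimes> (p \<boxtimes> \<iota> v)))
    = rot l' l p \<cdot> (\<iota> l \<boxtimes> (rot v' v q \<boxtimes> \<iota> l'))"
proof -
  note L = L_Obj[OF l]
  note S = piv_simps L v l' v' HomD[OF p] HomD[OF q] rot_arr[OF v' v q] rot_arr[OF l' L p]
  let ?h = "q \<cdot> (\<iota> v' \<boxtimes> (p \<boxtimes> \<iota> v))"
  have "?h \<in> Hom C ((v' \<otimes> l') \<otimes> l \<otimes> v) \<I>"
    by (simp add: Hom_def S)
  then have "rot (v' \<otimes> l') (l \<otimes> v) ?h = rot (v \<otimes> v' \<otimes> l') l (rot (v' \<otimes> l' \<otimes> l) v ?h)"
    using rot_cocycle[of "v' \<otimes> l'" l v ?h] by (simp add: S l)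
  also have "rot (v' \<otimes> l' \<otimes> l) v (q \<cdot> ((\<iota> v' \<boxtimes> p) \<boxtimes> \<iota> v)) = rot v' v q \<cdot> (\<iota> v \<boxtimes> (\<iota> v' \<boxtimes> p))"
    by (rule rot_natural[OF q]) (simp_all add: Hom_def S)
  then have "rot (v' \<otimes> l' \<otimes> l) v ?h = rot v' v q \<cdot> (\<iota> v \<boxtimes> (\<iota> v' \<boxtimes> p))"
    by (simp add: S)
  also have "\<dots> = rot v' v q \<boxtimes> p"
    using tens_swap(1)[of "rot v' v q" p] by (simp add: S tens_Idn_split(1))
  also have "\<dots> = p \<cdot> ((rot v' v q \<boxtimes> \<iota> l') \<boxtimes> \<iota> l)"
    using tens_swap(2)[of "rot v' v q" p] by (simp add: S)
  also have "rot (v \<otimes> v' \<otimes> l') l \<dots> = rot l' l p \<cdot> (\<iota> l \<boxtimes> (rot v' v q \<boxtimes> \<iota> l'))"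
    by (rule rot_natural[OF p]) (simp_all add: Hom_def S)
  finally show ?thesis .
qed

end


section \<open>One-letter duals of words\<close>

context rigid_category
begin

lemma mate_eqI:
  assumes "X \<in> Obj C" "V \<in> Obj C" "g \<in> Hom C X (dual C V)" "ev C V \<cdot> (g \<boxtimes> \<iota> V) = h"
  shows "mate C X V h = g"
proof -
  have "h \<in> Hom C (X \<otimes> V) \<I>"
    using assms(1,2) HomD[OF assms(3)] by (simp add: assms(4)[symmetric] Hom_def rigid_simps)
  from ex1_mate[OF assms(1,2) this] show ?thesis
    unfolding mate_def using assms by (intro the1_equality) auto
qed

lemma dual_arr:
  assumes "f \<in> Hom C V V'"
  shows "dual_arr C f \<in> Arr C" "Dom C (dual_arr C f) = dual C V'" "Cod C (dual_arr C f) = dual C V"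
    "ev C V \<cdot> (dual_arr C f \<boxtimes> \<iota> V) = ev C V' \<cdot> (\<iota> (dual C V') \<boxtimes> f)"
proof -
  note f = HomE[OF assms]
  have "ev C V' \<cdot> (\<iota> (dual C V') \<boxtimes> f) \<in> Hom C (dual C V' \<otimes> V) \<I>"
    using f by (simp add: Hom_def rigid_simps)
  from mate[OF _ _ this]
  show "dual_arr C f \<in> Arr C" "Dom C (dual_arr C f) = dual C V'" "Cod C (dual_arr C f) = dual C V"
    "ev C V \<cdot> (dual_arr C f \<boxtimes> \<iota> V) = ev C V' \<cdot> (\<iota> (dual C V') \<boxtimes> f)"
    using f by (auto simp: dual_arr_def dual_Obj Hom_def)
qed

lemma dual_arr_eqI:
  assumes f: "f \<in> Hom C V V'" and g: "g \<in> Hom C (dual C V') (dual C V)"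
    and eq: "ev C V \<cdot> (g \<boxtimes> \<iota> V) = ev C V' \<cdot> (\<iota> (dual C V') \<boxtimes> f)"
  shows "dual_arr C f = g"
  using mate_eqI[OF _ _ g eq] HomE[OF f] by (simp add: dual_arr_def dual_Obj)

lemma dual_arr_Idn: "V \<in> Obj C \<Longrightarrow> dual_arr C (\<iota> V) = \<iota> (dual C V)"
  by (rule dual_arr_eqI) (simp_all add: Idn_Hom dual_Obj)

lemma dual_arr_cmp:
  assumes f: "f \<in> Hom C U V" and g: "g \<in> Hom C V X"
  shows "dual_arr C f \<cdot> dual_arr C g = dual_arr C (g \<cdot> f)"
proof (rule dual_arr_eqI[symmetric])
  note f' = dual_arr[OF f] and g' = dual_arr[OF g]
  note S = mon_simps dual_Obj ev_arr HomE[OF f] HomE[OF g] f'(1-3) g'(1-3)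
  show "g \<cdot> f \<in> Hom C U X" "dual_arr C f \<cdot> dual_arr C g \<in> Hom C (dual C X) (dual C U)"
    by (simp_all add: Hom_def S)
  have "ev C U \<cdot> ((dual_arr C f \<cdot> dual_arr C g) \<boxtimes> \<iota> U)
      = (ev C U \<cdot> (dual_arr C f \<boxtimes> \<iota> U)) \<cdot> (dual_arr C g \<boxtimes> \<iota> U)"
    by (simp add: S tens_cmp_Idn[symmetric] cmp_assoc_arr)
  also have "\<dots> = ev C V \<cdot> ((\<iota> (dual C V) \<boxtimes> f) \<cdot> (dual_arr C g \<boxtimes> \<iota> U))"
    unfolding f'(4) by (simp add: S cmp_assoc_arr)
  also have "(\<iota> (dual C V) \<boxtimes> f) \<cdot> (dual_arr C g \<boxtimes> \<iota> U) = (dual_arr C g \<boxtimes> \<iota> V) \<cdot> (\<iota> (dual C X) \<boxtimes> f)"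
    by (simp add: S tens_cmp_arr)
  also have "ev C V \<cdot> \<dots> = (ev C V \<cdot> (dual_arr C g \<boxtimes> \<iota> V)) \<cdot> (\<iota> (dual C X) \<boxtimes> f)"
    by (simp add: S cmp_assoc_arr)
  also have "\<dots> = ev C X \<cdot> (\<iota> (dual C X) \<boxtimes> (g \<cdot> f))"
    unfolding g'(4) by (simp add: S tens_cmp_Idn[symmetric] cmp_assoc_arr)
  finally show "ev C U \<cdot> ((dual_arr C f \<cdot> dual_arr C g) \<boxtimes> \<iota> U)
      = ev C X \<cdot> (\<iota> (dual C X) \<boxtimes> (g \<cdot> f))" .
qed

lemma ev_tilde_arr:
  assumes "V \<in> Obj C" "X \<in> Obj C"
  shows "ev_tilde C V X \<in> Hom C ((dual C X \<otimes> dual C V) \<otimes> (V \<otimes> X)) \<I>"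
  using assms by (simp add: ev_tilde_def Hom_def rigid_simps)

lemma zeta:
  assumes "V \<in> Obj C" "X \<in> Obj C"
  shows "zeta C V X \<in> Hom C (dual C X \<otimes> dual C V) (dual C (V \<otimes> X))"
    "ev C (V \<otimes> X) \<cdot> (zeta C V X \<boxtimes> \<iota> (V \<otimes> X)) = ev_tilde C V X"
  using mate[OF _ _ ev_tilde_arr[OF assms]] assms
  by (simp_all add: zeta_def tens_Obj dual_Obj)

definition letters :: "('o \<times> bool) set" where
  "letters = Obj C \<times> UNIV"

definition letter :: "'o \<times> bool \<Rightarrow> 'o" where
  "letter l = (if snd l then fst l else dual C (fst l))"

end

sublocale rigid_category \<subseteq> word_strictification C letters letter
  by unfold_locales (auto simp: letters_def letter_def dual_Obj)

context rigid_category
begin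

text \<open>
  The auxiliary dual of a word, a single letter whatever the length of the word.
\<close>
definition star :: "('o \<times> bool) list \<Rightarrow> ('o \<times> bool) list" where
  "star u = [(word_obj u, False)]"

text \<open>
  No associator enters here, because the product of \<open>star u @ u\<close> is \<open>dual C (word_obj u) \<otimes> word_obj u\<close>
  by definition.
\<close>
definition star_ev :: "('o \<times> bool) list \<Rightarrow> ('o \<times> bool) list \<times> 'a \<times> ('o \<times> bool) list" where
  "star_ev u = (star u @ u, ev C (word_obj u), [])"

abbreviation M where "M \<equiv> word_cat ()"

lemma star_lists: "u \<in> lists letters \<Longrightarrow> star u \<in> lists letters"
  by (simp add: star_def letters_def word_obj_Obj)

lemma letter_star: "letter (word_obj u, False) = dual C (word_obj u)"
  by (simp add: letter_def)

lemma word_obj_star: "u \<in> lists letters \<Longrightarrow> word_obj (star u) = dual C (word_obj u)"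
  by (simp add: star_def letter_def mon_simps dual_Obj word_obj_Obj)

lemma word_obj_star_append: "u \<in> lists letters \<Longrightarrow> word_obj (star u @ v) = dual C (word_obj u) \<otimes> word_obj v"
  by (simp add: star_def letter_def)

lemma word_obj_letter: "l \<in> letters \<Longrightarrow> word_obj [l] = letter l"
  by (simp add: mon_simps lobj_Obj)

lemma \<mu>_star: "u \<in> lists letters \<Longrightarrow> v \<in> lists letters \<Longrightarrow> \<mu> (star u) v = \<iota> (dual C (word_obj u) \<otimes> word_obj v)"
  using \<mu>_single[of "(word_obj u, False)" v] by (simp add: star_def letters_def word_obj_Obj letter_def)

lemma \<nu>_star: "u \<in> lists letters \<Longrightarrow> v \<in> lists letters \<Longrightarrow> \<nu> (star u) v = \<iota> (dual C (word_obj u) \<otimes> word_obj v)"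
  using \<nu>_single[of "(word_obj u, False)" v] by (simp add: star_def letters_def word_obj_Obj letter_def)

lemma \<nu>_star_append:
  "\<nu> (star u @ v) w = inv_arr C (\<Phi> (dual C (word_obj u)) (word_obj v) (word_obj w))
      \<cdot> (\<iota> (dual C (word_obj u)) \<boxtimes> \<nu> v w)"
  by (simp add: star_def letter_def)

text \<open>
  The universal property of \<open>star u\<close> is that of the dual of \<open>word_obj u\<close> in \<open>C\<close>, up to re-bracketing the
  source of the pairing. For a single letter even the zigzag equations are those of \<open>C\<close>.
\<close>
lemma dual_pairings_M: "dual_pairings M star star_ev {[l] |l. l \<in> letters}"
proof -
  interpret M: strict_monoidal_category M by (rule strict_monoidal_word_cat)
  note S = word_simps dual_Obj ev_arr star_lists word_obj_star word_obj_star_append \<mu>_star \<nu>_star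
  show ?thesis
  proof
    fix u assume u: "u \<in> Obj M"
    then show "star u \<in> Obj M" by (simp add: star_lists)
    show "star_ev u \<in> Hom M (star u \<otimes>\<^bsub>M\<^esub> u) \<I>\<^bsub>M\<^esub>"
      using u by (simp add: star_ev_def word_cat_Hom star_lists word_obj_star_append ev_Hom word_obj_Obj)
  next
    fix u v p assume u: "u \<in> Obj M" and v: "v \<in> Obj M" and p: "p \<in> Hom M (v \<otimes>\<^bsub>M\<^esub> u) \<I>\<^bsub>M\<^esub>"
    then have uv: "u \<in> lists letters" "v \<in> lists letters" by simp_all
    from p obtain p0 where p0: "p = (v @ u, p0, [])" "p0 \<in> Hom C (word_obj (v @ u)) \<I>"
      by (auto simp: word_cat_Hom)
    note S = S uv HomD[OF p0(2)]
    have eq: "star_ev u \<cdot>\<^bsub>M\<^esub> ((v, t, star u) \<boxtimes>\<^bsub>M\<^esub> \<iota>\<^bsub>M\<^esub> u) = p \<longleftrightarrow>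
        ev C (word_obj u) \<cdot> (t \<boxtimes> \<iota> (word_obj u)) = p0 \<cdot> \<mu> v u" if
            "t \<in> Hom C (word_obj v) (dual C (word_obj u))" for t
    proof -
      note S = S HomD[OF that]
      have 1: "star_ev u \<cdot>\<^bsub>M\<^esub> ((v, t, star u) \<boxtimes>\<^bsub>M\<^esub> \<iota>\<^bsub>M\<^esub> u) = p \<longleftrightarrow>
          (ev C (word_obj u) \<cdot> (t \<boxtimes> \<iota> (word_obj u))) \<cdot> \<nu> v u = p0"
        by (simp add: star_ev_def p0(1) S cmp_assoc_arr)
      have "q \<cdot> \<nu> v u = p0 \<longleftrightarrow> q = p0 \<cdot> \<mu> v u" if "q \<in> Hom C (word_obj v \<otimes> word_obj u) \<I>" for q
      proof -
        note S = S HomD[OF that]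
        have "(q \<cdot> \<nu> v u) \<cdot> \<mu> v u = q" "(p0 \<cdot> \<mu> v u) \<cdot> \<nu> v u = p0"
          by (simp_all add: S cmp_assoc_arr \<mu>_\<nu> \<nu>_\<mu>)
        then show ?thesis by metis
      qed
      then show ?thesis unfolding 1 by (simp add: Hom_def S)
    qed
    have "\<exists>!t. t \<in> Hom C (word_obj v) (dual C (word_obj u)) \<and> ev C (word_obj u)
        \<cdot> (t \<boxtimes> \<iota> (word_obj u)) = p0 \<cdot> \<mu> v u"
      by (rule ex1_mate) (simp_all add: Hom_def S)
    then obtain t where t: "t \<in> Hom C (word_obj v) (dual C (word_obj u))" "ev C (word_obj u)
        \<cdot> (t \<boxtimes> \<iota> (word_obj u)) = p0 \<cdot> \<mu> v u"
      and uniq: "\<And>s. s \<in> Hom C (word_obj v) (dual C (word_obj u)) \<Longrightarrow> ev C (word_obj u)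
          \<cdot> (s \<boxtimes> \<iota> (word_obj u)) = p0 \<cdot> \<mu> v u \<Longrightarrow> s = t"
      by blast
    show "\<exists>!t. t \<in> Hom M v (star u) \<and> star_ev u \<cdot>\<^bsub>M\<^esub> (t \<boxtimes>\<^bsub>M\<^esub> \<iota>\<^bsub>M\<^esub> u) = p"
    proof (rule ex1I)
      show "(v, t, star u) \<in> Hom M v (star u) \<and> star_ev u \<cdot>\<^bsub>M\<^esub> ((v, t, star u) \<boxtimes>\<^bsub>M\<^esub> \<iota>\<^bsub>M\<^esub> u) = p"
        using t eq[OF t(1)] uv by (simp add: word_cat_Hom star_lists word_obj_star del: word_cat_sel)
      fix s assume s: "s \<in> Hom M v (star u) \<and> star_ev u \<cdot>\<^bsub>M\<^esub> (s \<boxtimes>\<^bsub>M\<^esub> \<iota>\<^bsub>M\<^esub> u) = p"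
      then obtain s0 where s0: "s = (v, s0, star u)" "s0 \<in> Hom C (word_obj v) (dual C (word_obj u))"
        using uv by (auto simp: word_cat_Hom word_obj_star)
      then show "s = (v, t, star u)"
        using uniq[OF s0(2)] eq[OF s0(2)] s by (simp del: word_cat_sel)
    qed
  next
    fix x assume "x \<in> {[l] |l. l \<in> letters}"
    then obtain l where x: "x = [l]" and l: "l \<in> letters" by blast
    then show "x \<in> Obj M" by simp
    let ?V = "letter l" let ?V' = "dual C ?V"
    have V: "?V \<in> Obj C" using l by (rule lobj_Obj)
    have s: "star [l] = [(?V, False)]" using V by (simp add: star_def mon_simps)
    have l': "(?V, False) \<in> letters" using V by (simp add: letters_def)
    let ?c = "([], db C ?V, [l] @ star [l])"
    have "letter (?V, False) = ?V'" by (simp add: letter_def)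
    note S = word_simps dual_Obj ev_arr db_arr V l l' \<mu>_\<nu> this triangle inv_arr_Idn
    have "exact_pairing M (star [l]) [l] (star_ev [l]) ?c"
      unfolding exact_pairing_def
      using zigzag[OF V] zigzag_dual[OF V]
      by (simp add: word_cat_Hom word_cat_Arr star_ev_def s S Hom_def cmp_assoc_arr)
    then show "\<exists>c. exact_pairing M (star x) x (star_ev x) c"
      unfolding x by blast
  qed
qed

interpretation M: dual_pairings M star star_ev "{[l] |l. l \<in> letters}"
  by (rule dual_pairings_M)

lemma star_arr_M:
  assumes f: "f \<in> Hom C (word_obj u) (word_obj w)" and u: "u \<in> lists letters" and w: "w \<in> lists letters"
  shows "M.star_arr (u, f, w) = (star w, dual_arr C f, star u)"
proof -
  note f' = dual_arr[OF f]
  note S = word_simps dual_Obj ev_arr star_lists word_obj_star word_obj_star_append \<mu>_star \<nu>_star u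
      w HomD[OF f] f'(1-3)
  have "M.transpose (star w) u (star_ev w \<cdot>\<^bsub>M\<^esub> (\<iota>\<^bsub>M\<^esub> (star w) \<boxtimes>\<^bsub>M\<^esub> (u, f, w)))
      = (star w, dual_arr C f, star u)"
    by (rule M.transpose_eqI) (simp_all add: word_cat_Hom Hom_def[of C] star_ev_def S f'(4))
  then show ?thesis by (simp add: M.star_arr_def)
qed

text \<open>
  Both arrows solve the same transposition problem. The associators in the definition of
  \<open>ev_tilde\<close> are those hidden in the tensor product of words.
\<close>
lemma star_tens_M:
  assumes l: "l \<in> letters" and v: "v \<in> lists letters"
  shows "M.star_tens [l] v = (star v @ star [l], zeta C (letter l) (word_obj v), star (l # v))"
proof -
  let ?V = "letter l" and ?V' = "dual C (letter l)" and ?W = "word_obj v" and ?W' = "dual C (word_obj v)"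
  have V: "?V \<in> Obj C" using l by (rule lobj_Obj)
  have W: "?W \<in> Obj C" using v by (rule word_obj_Obj)
  have lV: "\<And>w. \<nu> (star v @ star [l]) w = inv_arr C (\<Phi> ?W' ?V' (word_obj w)) \<cdot> (\<iota> ?W' \<boxtimes> \<nu> (star [l]) w)"
    using l by (simp add: \<nu>_star_append word_obj_star word_obj_letter del: word_obj.simps \<nu>.simps)
  note S = word_simps dual_Obj ev_arr star_lists word_obj_star word_obj_star_append \<mu>_star \<nu>_star l v V W
    HomD[OF zeta(1)[OF V W]]
  have "(\<nu> (star [l] @ [l]) v) = inv_arr C (\<Phi> ?V' ?V ?W)"
    using l V W v by (simp add: \<nu>_star_append \<nu>_single word_obj_letter mon_simps dual_Obj
        del: word_obj.simps \<nu>.simps)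
  note S = S this lV
  have "ev C (?V \<otimes> ?W) \<cdot> ((zeta C ?V ?W \<boxtimes> \<iota> (?V \<otimes> ?W)) \<cdot> inv_arr C (\<Phi> ?W' ?V' (?V \<otimes> ?W)))
      = (ev C (?V \<otimes> ?W) \<cdot> (zeta C ?V ?W \<boxtimes> \<iota> (?V \<otimes> ?W))) \<cdot> inv_arr C (\<Phi> ?W' ?V' (?V \<otimes> ?W))"
    by (simp add: S cmp_assoc_arr)
  also have "\<dots> = ev C ?W \<cdot> (\<iota> ?W' \<boxtimes> (ev C ?V \<boxtimes> \<iota> ?W)) \<cdot> (\<iota> ?W' \<boxtimes> inv_arr C (\<Phi> ?V' ?V ?W)) \<cdot>
      (\<Phi> ?W' ?V' (?V \<otimes> ?W) \<cdot> inv_arr C (\<Phi> ?W' ?V' (?V \<otimes> ?W)))"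
    unfolding zeta(2)[OF V W] ev_tilde_def by (simp add: S cmp_assoc_arr)
  also have "\<dots> = ev C ?W \<cdot> (\<iota> ?W' \<boxtimes> ((ev C ?V \<boxtimes> \<iota> ?W) \<cdot> inv_arr C (\<Phi> ?V' ?V ?W)))"
    by (simp add: S inv_assoc_arr tens_cmp_Idn)
  finally have eq: "ev C (?V \<otimes> ?W) \<cdot> ((zeta C ?V ?W \<boxtimes> \<iota> (?V \<otimes> ?W)) \<cdot> inv_arr C (\<Phi> ?W' ?V' (?V \<otimes> ?W)))
      = ev C ?W \<cdot> (\<iota> ?W' \<boxtimes> ((ev C ?V \<boxtimes> \<iota> ?W) \<cdot> inv_arr C (\<Phi> ?V' ?V ?W)))" .
  have "M.transpose (star v \<otimes>\<^bsub>M\<^esub> star [l]) ([l] \<otimes>\<^bsub>M\<^esub> v) (M.tens_pairing [l] v)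
      = (star v @ star [l], zeta C ?V ?W, star (l # v))"
  proof (rule M.transpose_eqI)
    show "star_ev ([l] \<otimes>\<^bsub>M\<^esub> v) \<cdot>\<^bsub>M\<^esub> ((star v @ star [l], zeta C ?V ?W, star (l # v)) \<boxtimes>\<^bsub>M\<^esub> \<iota>\<^bsub>M\<^esub> ([l] \<otimes>\<^bsub>M\<^esub> v))
        = M.tens_pairing [l] v"
      unfolding M.tens_pairing_def star_ev_def
      using \<mu>_star[of "l # v" "l # v"] l v eq by (simp add: S)
  qed (use l v in \<open>simp_all add: word_cat_Hom Hom_def[of C] star_ev_def S\<close>)
  then show ?thesis by (simp add: M.star_tens_def)
qed

text \<open>
  Invertibility of \<open>zeta\<close> is read off from the category of words, where its proof involves no associators.
\<close>
lemma zeta_iso: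
  assumes V: "V \<in> Obj C" and X: "X \<in> Obj C"
  shows "is_iso C (zeta C V X)"
proof -
  let ?l = "(V, True)" and ?v = "[(X, True)]"
  have l: "?l \<in> letters" "?v \<in> lists letters" "letter ?l = V" "word_obj ?v = X"
    using V X by (simp_all add: letters_def letter_def mon_simps)
  have D: "word_obj (star ?v @ star [?l]) = dual C X \<otimes> dual C V" "word_obj (star (?l # ?v))
      = dual C (V \<otimes> X)"
    using V X l by (simp_all add: star_def letter_def mon_simps dual_Obj)
  have "[?l] \<in> {[l] |l. l \<in> letters}" "?v \<in> Obj M"
    using l by auto
  from M.star_tens_inverse[OF this] obtain z where
      "z \<in> Hom M (star ([?l] \<otimes>\<^bsub>M\<^esub> ?v)) (star ?v \<otimes>\<^bsub>M\<^esub> star [?l])"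
      and z: "M.star_tens [?l] ?v \<cdot>\<^bsub>M\<^esub> z = \<iota>\<^bsub>M\<^esub> (star ([?l] \<otimes>\<^bsub>M\<^esub> ?v))"
        "z \<cdot>\<^bsub>M\<^esub> M.star_tens [?l] ?v = \<iota>\<^bsub>M\<^esub> (star ?v \<otimes>\<^bsub>M\<^esub> star [?l])"
    by blast
  then obtain z0 where z0: "z = (star (?l # ?v), z0, star ?v @ star [?l])"
      "z0 \<in> Hom C (dual C (V \<otimes> X)) (dual C X \<otimes> dual C V)"
    by (auto simp: word_cat_Hom D)
  have "inverse_arrs C (zeta C V X) z0"
    using z z0 HomD[OF zeta(1)[OF V X]] D
    unfolding star_tens_M[OF l(1,2)] by (simp add: inverse_arrs_def l del: word_obj.simps)
  then show ?thesis unfolding is_iso_def by blast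
qed

end

section \<open>Rotation in a pivotal category\<close>

context pivotal_category
begin

lemma piv_Hom: "V \<in> Obj C \<Longrightarrow> piv C V \<in> Hom C V (dual C (dual C V))"
  and piv_iso: "V \<in> Obj C \<Longrightarrow> is_iso C (piv C V)"
  using piv by (auto simp: monoidal_natural_iso_def natural_iso_def id_mon_fun_def double_dual_def)

lemma piv_natural: "f \<in> Hom C V X \<Longrightarrow> piv C X \<cdot> f = dual_arr C (dual_arr C f) \<cdot> piv C V"
  using piv by (auto simp: monoidal_natural_iso_def natural_iso_def id_mon_fun_def double_dual_def Hom_def)

lemma piv_unit: "piv C \<I> = \<iota> \<I>"
  using piv by (auto simp: monoidal_natural_iso_def)

text \<open>
  Compatibility of the pivotal structure with tensor products, with the inverse of \<open>zeta\<close> moved to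
  the other side.
\<close>
lemma piv_tens:
  assumes V: "V \<in> Obj C" and X: "X \<in> Obj C"
  shows "dual_arr C (zeta C V X) \<cdot> piv C (V \<otimes> X) = zeta C (dual C X) (dual C V) \<cdot> (piv C V \<boxtimes> piv C X)"
proof -
  note z = inv_arr[OF zeta_iso[OF V X]] and zH = zeta(1)[OF V X]
  note zD = HomD[OF zH]
  have z'H: "inv_arr C (zeta C V X) \<in> Hom C (dual C (V \<otimes> X)) (dual C X \<otimes> dual C V)"
    using z zD by (simp add: Hom_def)
  note S = mon_simps dual_Obj V X zD z(1-4) HomD[OF piv_Hom] HomD[OF zeta(1)] dual_arr(1-3)[OF zH]
      dual_arr(1-3)[OF z'H]
  have "piv C (V \<otimes> X) \<cdot> \<iota> (V \<otimes> X)
      = (dual_arr C (inv_arr C (zeta C V X)) \<cdot> zeta C (dual C X) (dual C V)) \<cdot> (piv C V \<boxtimes> piv C X)"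
    using piv V X by (auto simp: monoidal_natural_iso_def id_mon_fun_def double_dual_def)
  then have "dual_arr C (zeta C V X) \<cdot> piv C (V \<otimes> X)
      = (dual_arr C (zeta C V X) \<cdot> dual_arr C (inv_arr C (zeta C V X)))
          \<cdot> zeta C (dual C X) (dual C V) \<cdot> (piv C V \<boxtimes> piv C X)"
    by (simp add: S cmp_assoc_arr)
  then show ?thesis
    unfolding dual_arr_cmp[OF zH z'H] by (simp add: z(5) S dual_arr_Idn)
qed

definition star_piv :: "('o \<times> bool) list \<Rightarrow> ('o \<times> bool) list \<times> 'a \<times> ('o \<times> bool) list" where
  "star_piv u = (u, piv C (word_obj u), star (star u))"

text \<open>
  Each condition is the corresponding property of \<open>piv\<close>, as \<open>star_arr\<close> and \<open>star_tens\<close> have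
  \<open>dual_arr\<close> and \<open>zeta\<close> underlying them.
\<close>
lemma pivotal_pairings_M: "pivotal_pairings M star star_ev {[l] |l. l \<in> letters} star_piv"
proof -
  interpret M: dual_pairings M star star_ev "{[l] |l. l \<in> letters}"
    by (rule dual_pairings_M)
  note S = word_simps dual_Obj star_lists word_obj_star HomD[OF piv_Hom]
  show ?thesis
  proof
    show "star_piv u \<in> Hom M u (star (star u))" if "u \<in> Obj M" for u
      using that by (simp add: star_piv_def word_cat_Hom S Hom_def[of C])
    show "star_piv w \<cdot>\<^bsub>M\<^esub> f = M.star_arr (M.star_arr f) \<cdot>\<^bsub>M\<^esub> star_piv u" if f: "f \<in> Hom M u w" for f u w
    proof -
      from f obtain f0 where f0: "f = (u, f0, w)" "f0 \<in> Hom C (word_obj u) (word_obj w)"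
        and uw: "u \<in> lists letters" "w \<in> lists letters" by (auto simp: word_cat_Hom)
      have "dual_arr C f0 \<in> Hom C (word_obj (star w)) (word_obj (star u))"
        using dual_arr[OF f0(2)] uw by (simp add: Hom_def word_obj_star)
      then show ?thesis
        using uw piv_natural[OF f0(2)]
        by (simp add: f0(1) star_piv_def star_arr_M[OF f0(2)] star_arr_M star_lists)
    qed
    show "star_ev (star \<I>\<^bsub>M\<^esub>) \<cdot>\<^bsub>M\<^esub> (star_piv \<I>\<^bsub>M\<^esub> \<boxtimes>\<^bsub>M\<^esub> M.transpose \<I>\<^bsub>M\<^esub> \<I>\<^bsub>M\<^esub> (\<iota>\<^bsub>M\<^esub> \<I>\<^bsub>M\<^esub>)) = \<iota>\<^bsub>M\<^esub> \<I>\<^bsub>M\<^esub>"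
    proof -
      have s: "star [] = [(\<I>, False)]" "star [(\<I>, False)] = [(\<I>, False)]" "letter (\<I>, False) = \<I>"
        by (simp_all add: star_def letter_def dual_unit mon_simps)
      have l: "(\<I>, False) \<in> letters" by (simp add: letters_def unit_Obj)
      note S = mon_simps s l ev_unit triangle dual_unit piv_unit
      have "M.transpose [] [] ([], \<iota> \<I>, []) = ([], \<iota> \<I>, [(\<I>, False)])"
        by (rule M.transpose_eqI) (simp_all add: word_cat_Hom Hom_def[of C] star_ev_def S)
      then show ?thesis
        by (simp add: star_ev_def star_piv_def S)
    qed
    show "M.star_arr (M.star_tens l v) \<cdot>\<^bsub>M\<^esub> star_piv (l \<otimes>\<^bsub>M\<^esub> v)
        = M.star_tens (star v) (star l) \<cdot>\<^bsub>M\<^esub> (star_piv l \<boxtimes>\<^bsub>M\<^esub> star_piv v)"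
      if "l \<in> {[l] |l. l \<in> letters}" "v \<in> Obj M" for l v
    proof -
      from that obtain k where l: "l = [k]" and k: "k \<in> letters" and v: "v \<in> lists letters" by auto
      have V: "letter k \<in> Obj C" using k by (rule lobj_Obj)
      have X: "word_obj v \<in> Obj C" using v by (rule word_obj_Obj)
      have Ek: "word_obj [k] = letter k" using V by (simp add: mon_simps)
      have kl: "[k] \<in> lists letters" using k by simp
      have lets: "(word_obj v, False) \<in> letters" using X by (simp add: letters_def)
      have "zeta C (letter k) (word_obj v) \<in> Hom C (word_obj (star v @ star [k])) (word_obj (star (k # v)))"
        using zeta(1)[OF V X] v k kl by (simp add: word_obj_star word_obj_star_append Ek
            del: word_obj.simps(2)) simp
      note 1 = star_arr_M[OF this]
      have "M.star_tens (star v) (star [k]) = (star (star [k]) @ star (star v), zeta C (dual C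
          (word_obj v)) (dual C (letter k)), star (star v @ star [k]))"
        using star_tens_M[OF lets, of "star [k]"] kl
        by (simp add: star_def[of v] star_lists word_obj_star Ek letter_star del: word_obj.simps)
      moreover have "\<mu> (star (star [k])) (star (star v))
          = \<iota> (dual C (dual C (letter k)) \<otimes> dual C (dual C (word_obj v)))"
        using kl v by (simp add: \<mu>_star star_lists word_obj_star Ek del: word_obj.simps)
      moreover have "\<nu> [k] v = \<iota> (letter k \<otimes> word_obj v)"
        using k v by (rule \<nu>_single)
      ultimately show ?thesis
        using piv_tens[OF V X] V X kl v k lets
        by (simp add: l star_tens_M 1 star_lists star_piv_def Ek word_obj.simps(2)[of k v]
            mon_simps HomD[OF piv_Hom] dual_Obj del: word_obj.simps \<mu>.simps \<nu>.simps)
    qed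
  qed
qed

end


section \<open>Strict duals of words\<close>

fun opposite :: "'o \<times> bool \<Rightarrow> 'o \<times> bool" where
  "opposite (V, b) = (V, \<not> b)"

lemma opposite_opposite [simp]: "opposite (opposite l) = l"
  by (cases l) simp

definition word_dual :: "('o \<times> bool) list \<Rightarrow> ('o \<times> bool) list" where
  "word_dual u = rev (map opposite u)"

lemma word_dual_simps [simp]:
  "word_dual [] = []"
  "word_dual (l # u) = word_dual u @ [opposite l]"
  "word_dual (u @ v) = word_dual v @ word_dual u"
  "word_dual (word_dual u) = u"
  by (simp_all add: word_dual_def rev_map comp_def)

context pivotal_category
begin

interpretation M: pivotal_pairings M star star_ev "{[l] |l. l \<in> letters}" star_piv
  by (rule pivotal_pairings_M)

lemma opposite_letters [simp]: "opposite l \<in> letters \<longleftrightarrow> l \<in> letters"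
  by (cases l) (auto simp: letters_def)

lemma word_dual_lists [simp]: "u \<in> lists letters \<Longrightarrow> word_dual u \<in> lists letters"
  by (induction u) simp_all

text \<open>
  The evaluation of a negative letter is the rotation of that of the positive letter, which is what
  double duals of arrows being identities demands. \<open>letter_ev_negative\<close> computes it.
\<close>
definition letter_ev :: "'o \<times> bool \<Rightarrow> ('o \<times> bool) list \<times> 'a \<times> ('o \<times> bool) list" where
  "letter_ev l =
    (let p = ([(fst l, False), (fst l, True)], ev C (fst l), [])
     in if snd l then p else M.rot [(fst l, False)] [(fst l, True)] p)"

lemma letter_ev_Hom:
  assumes "l \<in> letters"
  shows "letter_ev l \<in> Hom M ([opposite l] \<otimes>\<^bsub>M\<^esub> [l]) \<I>\<^bsub>M\<^esub>"
proof -
  obtain V b where l: "l = (V, b)" by (cases l)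
  have V: "V \<in> Obj C" "(V, True) \<in> letters" "(V, False) \<in> letters"
    using assms by (auto simp: letters_def l)
  have p: "([(V, False), (V, True)], ev C V, []) \<in> Hom M ([(V, False)] \<otimes>\<^bsub>M\<^esub> [(V, True)]) \<I>\<^bsub>M\<^esub>"
    using V ev_Hom[OF V(1)] by (simp add: word_cat_Hom letter_def mon_simps)
  then show ?thesis
    using M.rot_arr[OF _ _ p] V by (cases b) (auto simp: l letter_ev_def Hom_def[of M])
qed

text \<open>
  For a negative letter this is the fact that rotating twice is the identity. In terms of the pivotal
  structure it says that the dual of \<open>piv C V\<close> is inverse to \<open>piv C (dual C V)\<close>.
\<close>
lemma rot_letter_ev:
  assumes "l \<in> letters"
  shows "M.rot [opposite l] [l] (letter_ev l) = letter_ev (opposite l)"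
proof -
  obtain V b where l: "l = (V, b)" by (cases l)
  have V: "V \<in> Obj C" "(V, True) \<in> letters" "(V, False) \<in> letters"
    using assms by (auto simp: letters_def l)
  show ?thesis
  proof (cases b)
    case True
    then show ?thesis by (simp add: l letter_ev_def Let_def)
  next
    case False
    have "letter_ev (V, True) \<in> Hom M ([(V, False)] \<otimes>\<^bsub>M\<^esub> [(V, True)]) \<I>\<^bsub>M\<^esub>"
      using letter_ev_Hom[OF V(2)] by simp
    moreover have "[(V, False)] \<in> {[l] |l. l \<in> letters}" "[(V, True)] \<in> Obj M"
      using V by auto
    ultimately show ?thesis using M.rot_rot[of "[(V, False)]" "[(V, True)]" "letter_ev (V, True)"] False
      by (simp add: l letter_ev_def Let_def)
  qed
qed

lemma letter_ev_negative:
  assumes V: "V \<in> Obj C"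
  shows "letter_ev (V, False) = ([(V, True), (V, False)], ev C (dual C V) \<cdot> (piv C V \<boxtimes> \<iota> (dual C V)), [])"
    and "letter_ev (V, False) = star_ev [(V, False)] \<cdot>\<^bsub>M\<^esub> (star_piv [(V, True)] \<boxtimes>\<^bsub>M\<^esub> \<iota>\<^bsub>M\<^esub> [(V, False)])"
proof -
  have L: "(V, True) \<in> letters" "(V, False) \<in> letters" "(dual C V, False) \<in> letters"
    "letter (V, True) = V" "letter (V, False) = dual C V" "letter (dual C V, False) = dual C (dual C V)"
    using V by (auto simp: letters_def dual_Obj letter_def)
  have s: "star [(V, True)] = [(V, False)]" "star [(V, False)] = [(dual C V, False)]"
    using V L by (simp_all add: star_def mon_simps dual_Obj)
  note S = mon_simps V L s dual_Obj ev_arr triangle HomD[OF piv_Hom] star_ev_def star_piv_def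
    word_obj.simps \<mu>_single \<nu>_single
  have t: "M.transpose [(V, False)] [(V, True)] ([(V, False), (V, True)], ev C V, [])
      = ([(V, False)], \<iota> (dual C V), [(V, False)])"
    by (rule M.transpose_eqI) (simp_all add: word_cat_Hom Hom_def[of C] S del: \<mu>.simps \<nu>.simps)
  show 1: "letter_ev (V, False) = ([(V, True), (V, False)], ev C (dual C V) \<cdot> (piv C V \<boxtimes> \<iota> (dual C V)), [])"
    by (simp add: letter_ev_def M.rot_def t S del: \<mu>.simps(2) \<nu>.simps(2))
  show "letter_ev (V, False) = star_ev [(V, False)] \<cdot>\<^bsub>M\<^esub> (star_piv [(V, True)] \<boxtimes>\<^bsub>M\<^esub> \<iota>\<^bsub>M\<^esub> [(V, False)])"
    unfolding 1 by (simp add: S del: \<mu>.simps(2) \<nu>.simps(2))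
qed

text \<open>
  The evaluation of a positive letter is that of \<open>C\<close>; that of a negative letter differs from the
  evaluation of the auxiliary dual by the pivotal isomorphism.
\<close>
lemma letter_ev_exact:
  assumes "l \<in> letters"
  shows "\<exists>c. exact_pairing M [opposite l] [l] (letter_ev l) c"
proof -
  obtain V b where l: "l = (V, b)" by (cases l)
  have V: "V \<in> Obj C" and L: "(V, True) \<in> letters" "(V, False) \<in> letters"
      "(dual C V, False) \<in> letters"
    using assms by (auto simp: letters_def l dual_Obj)
  have EV: "word_obj [(V, True)] = V" "word_obj [(V, False)] = dual C V"
      "word_obj [(dual C V, False)] = dual C (dual C V)"
    using V by (simp_all add: letter_def mon_simps dual_Obj)
  have s: "star [(V, True)] = [(V, False)]" "star [(V, False)] = [(dual C V, False)]"
    by (simp_all only: star_def EV)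
  show ?thesis
  proof (cases b)
    case True
    have "star_ev [(V, True)] = letter_ev (V, True)"
      by (simp add: star_ev_def letter_ev_def s EV del: word_obj.simps)
    then show ?thesis
      using M.L_exact[of "[(V, True)]"] L by (auto simp: l True s)
  next
    case False
    then have b: "b = False" by simp
    obtain c where c: "exact_pairing M [(dual C V, False)] [(V, False)] (star_ev [(V, False)]) c"
      using M.L_exact[of "[(V, False)]"] L by (auto simp: s)
    note i = inv_arr[OF piv_iso[OF V]]
    have "exact_pairing M [(V, True)] [(V, False)]
        (star_ev [(V, False)] \<cdot>\<^bsub>M\<^esub> (star_piv [(V, True)] \<boxtimes>\<^bsub>M\<^esub> \<iota>\<^bsub>M\<^esub> [(V, False)]))
        ((\<iota>\<^bsub>M\<^esub> [(V, False)] \<boxtimes>\<^bsub>M\<^esub> ([(dual C V, False)], inv_arr C (piv C V), [(V, True)])) \<cdot>\<^bsub>M\<^esub> c)"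
      by (rule M.exact_pairing_twist[OF c])
        (use L i HomD[OF piv_Hom[OF V]] in \<open>simp_all add: word_cat_Hom Hom_def[of C] star_piv_def EV
            s del: word_obj.simps\<close>)
    then show ?thesis
      unfolding l b opposite.simps not_False_eq_True letter_ev_negative(2)[OF V] by blast
  qed
qed

text \<open>
  A choice in name only, since an exact pairing determines its copairing.
\<close>
definition letter_db :: "'o \<times> bool \<Rightarrow> ('o \<times> bool) list \<times> 'a \<times> ('o \<times> bool) list" where
  "letter_db l = (SOME c. exact_pairing M [opposite l] [l] (letter_ev l) c)"

primrec word_ev :: "('o \<times> bool) list \<Rightarrow> ('o \<times> bool) list \<times> 'a \<times> ('o \<times> bool) list" where
  "word_ev [] = \<iota>\<^bsub>M\<^esub> \<I>\<^bsub>M\<^esub>"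
| "word_ev (l # u) = word_ev u \<cdot>\<^bsub>M\<^esub> (\<iota>\<^bsub>M\<^esub> (word_dual u) \<boxtimes>\<^bsub>M\<^esub> (letter_ev l \<boxtimes>\<^bsub>M\<^esub> \<iota>\<^bsub>M\<^esub> u))"

primrec word_db :: "('o \<times> bool) list \<Rightarrow> ('o \<times> bool) list \<times> 'a \<times> ('o \<times> bool) list" where
  "word_db [] = \<iota>\<^bsub>M\<^esub> \<I>\<^bsub>M\<^esub>"
| "word_db (l # u) = (\<iota>\<^bsub>M\<^esub> [l] \<boxtimes>\<^bsub>M\<^esub> (word_db u \<boxtimes>\<^bsub>M\<^esub> \<iota>\<^bsub>M\<^esub> [opposite l])) \<cdot>\<^bsub>M\<^esub> letter_db l"

lemma word_exact:
  assumes "u \<in> lists letters"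
  shows "exact_pairing M (word_dual u) u (word_ev u) (word_db u)"
  using assms
proof (induction u rule: list.induct)
  case Nil
  show ?case by (simp add: exact_pairing_def word_cat_Hom Idn_Hom mon_simps)
next
  case (Cons l u)
  then have "exact_pairing M [opposite l] [l] (letter_ev l) (letter_db l)"
    unfolding letter_db_def by (intro someI_ex[OF letter_ev_exact]) simp
  from M.exact_pairing_tensor[OF this Cons.IH] Cons.prems show ?case
    by (simp del: word_cat_sel(1-6,8-))
qed

lemma word_ev_Hom: "u \<in> lists letters \<Longrightarrow> word_ev u \<in> Hom M (word_dual u \<otimes>\<^bsub>M\<^esub> u) \<I>\<^bsub>M\<^esub>"
  and word_db_Hom: "u \<in> lists letters \<Longrightarrow> word_db u \<in> Hom M \<I>\<^bsub>M\<^esub> (u \<otimes>\<^bsub>M\<^esub> word_dual u)"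
  using word_exact by (auto simp: exact_pairing_def)

lemma word_ev_append:
  assumes u: "u \<in> lists letters" and v: "v \<in> lists letters"
  shows "word_ev (u @ v) = word_ev v \<cdot>\<^bsub>M\<^esub> (\<iota>\<^bsub>M\<^esub> (word_dual v) \<boxtimes>\<^bsub>M\<^esub> (word_ev u \<boxtimes>\<^bsub>M\<^esub> \<iota>\<^bsub>M\<^esub> v))"
  using u
proof (induction u rule: list.induct)
  case Nil
  note S = M.strict_simps M.HomD[OF word_ev_Hom]
  have "\<iota>\<^bsub>M\<^esub> (word_dual v) \<boxtimes>\<^bsub>M\<^esub> (\<iota>\<^bsub>M\<^esub> \<I>\<^bsub>M\<^esub> \<boxtimes>\<^bsub>M\<^esub> \<iota>\<^bsub>M\<^esub> v) = \<iota>\<^bsub>M\<^esub> (word_dual v \<otimes>\<^bsub>M\<^esub> v)"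
    using v by (simp add: S del: word_cat_sel(2-))
  then show ?case
    using M.cmp_Idn_right[OF word_ev_Hom[OF v]] by simp
next
  case (Cons l u)
  then have l: "l \<in> letters" and u: "u \<in> lists letters" by auto
  have O: "[l] \<in> Obj M" "[opposite l] \<in> Obj M" "u \<in> Obj M" "v \<in> Obj M" "word_dual u \<in> Obj M"
      "word_dual v \<in> Obj M"
    using l u v by simp_all
  note S = M.strict_simps M.HomD[OF word_ev_Hom[OF u]] M.HomD[OF word_ev_Hom[OF v]] M.HomD[OF
      letter_ev_Hom[OF l]] O
  have "word_ev ((l # u) @ v) = word_ev (u @ v) \<cdot>\<^bsub>M\<^esub> (\<iota>\<^bsub>M\<^esub> (word_dual v \<otimes>\<^bsub>M\<^esub> word_dual u) \<boxtimes>\<^bsub>M\<^esub>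
      (letter_ev l \<boxtimes>\<^bsub>M\<^esub> \<iota>\<^bsub>M\<^esub> (u \<otimes>\<^bsub>M\<^esub> v)))"
    by simp
  also have "word_ev (u @ v) = word_ev v \<cdot>\<^bsub>M\<^esub> (\<iota>\<^bsub>M\<^esub> (word_dual v) \<boxtimes>\<^bsub>M\<^esub> (word_ev u \<boxtimes>\<^bsub>M\<^esub> \<iota>\<^bsub>M\<^esub> v))"
    using Cons.IH u by simp
  also have "\<dots> \<cdot>\<^bsub>M\<^esub> (\<iota>\<^bsub>M\<^esub> (word_dual v \<otimes>\<^bsub>M\<^esub> word_dual u) \<boxtimes>\<^bsub>M\<^esub>
      (letter_ev l \<boxtimes>\<^bsub>M\<^esub> \<iota>\<^bsub>M\<^esub> (u \<otimes>\<^bsub>M\<^esub> v)))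
    = word_ev v \<cdot>\<^bsub>M\<^esub> (\<iota>\<^bsub>M\<^esub> (word_dual v) \<boxtimes>\<^bsub>M\<^esub> (word_ev (l # u) \<boxtimes>\<^bsub>M\<^esub> \<iota>\<^bsub>M\<^esub> v))"
    unfolding word_ev.simps
    by (simp add: S M.tens_Idn_split M.tens_cmp_Idn[symmetric] M.cmp_assoc_arr del: word_cat_sel M.tens_Idn)
  finally show ?case .
qed

text \<open>
  Rotation reverses nesting and turns the evaluation of each letter into that of its opposite. This is
  exactly how the evaluation of the dual word is built.
\<close>
lemma rot_word_ev:
  assumes "u \<in> lists letters"
  shows "M.rot (word_dual u) u (word_ev u) = word_ev (word_dual u)"
  using assms
proof (induction u rule: list.induct)
  case Nil
  show ?case
    using M.rot_unit[of "[]" "\<iota>\<^bsub>M\<^esub> []"] by (simp add: word_cat_Hom Idn_Hom unit_Obj)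
next
  case (Cons l u)
  then have l: "l \<in> letters" and u: "u \<in> lists letters" by auto
  have l': "[l] \<in> {[l] |l. l \<in> letters}" using l by blast
  have "M.rot (word_dual u \<otimes>\<^bsub>M\<^esub> [opposite l]) ([l] \<otimes>\<^bsub>M\<^esub> u) (word_ev (l # u))
      = letter_ev (opposite l) \<cdot>\<^bsub>M\<^esub> (\<iota>\<^bsub>M\<^esub> [l] \<boxtimes>\<^bsub>M\<^esub> (word_ev (word_dual u) \<boxtimes>\<^bsub>M\<^esub> \<iota>\<^bsub>M\<^esub> [opposite l]))"
    unfolding word_ev.simps rot_letter_ev[OF l, symmetric] Cons.IH[OF u, symmetric]
    by (rule M.rot_tensor) (use l' l u letter_ev_Hom[OF l] word_ev_Hom[OF u] in simp_all)
  also have "letter_ev (opposite l) = word_ev [opposite l]"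
  proof -
    have "\<iota>\<^bsub>M\<^esub> \<I>\<^bsub>M\<^esub> \<cdot>\<^bsub>M\<^esub> (\<iota>\<^bsub>M\<^esub> \<I>\<^bsub>M\<^esub> \<boxtimes>\<^bsub>M\<^esub> (letter_ev (opposite l) \<boxtimes>\<^bsub>M\<^esub> \<iota>\<^bsub>M\<^esub> \<I>\<^bsub>M\<^esub>)) = letter_ev (opposite l)"
      using letter_ev_Hom[of "opposite l"] l
      by (simp add: M.strict_simps Hom_def[of M] del: word_cat_sel)
    then show ?thesis by (simp del: word_cat_sel(2-5,7-))
  qed
  finally show ?case
    using word_ev_append[of "word_dual u" "[opposite l]"] l u by (simp
        del: word_cat_sel(1-6,8-) word_ev.simps)
qed

section \<open>The strict pivotal category of words\<close>

definition strict_words :: "(('o \<times> bool) list, ('o \<times> bool) list \<times> 'a \<times> ('o \<times> bool) list) pivotal_data" where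
  "strict_words = \<lparr>Obj = Obj M, Arr = Arr M, Dom = Dom M, Cod = Cod M, Idn = Idn M, cmp = cmp M,
    unit_obj = [], tens_obj = (@), tens_arr = tens_arr M, assoc = assoc M,
    dual = word_dual, ev = word_ev, db = word_db, piv = Idn M\<rparr>"

abbreviation D where "D \<equiv> strict_words"

lemma strict_words_sel [simp]:
  "Obj D = lists letters" "Arr D = Arr M" "Dom D = Dom M" "Cod D = Cod M" "Idn D = Idn M"
  "cmp D = cmp M" "unit_obj D = []" "tens_obj D = (@)" "tens_arr D = tens_arr M" "assoc D = assoc M"
  "Hom D = Hom M" "dual D = word_dual" "ev D = word_ev" "db D = word_db" "piv D = Idn M"
  by (simp_all add: strict_words_def Hom_def fun_eq_iff)

lemma strict_monoidal_strict_words: "strict_monoidal_category D"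
proof -
  have "D = word_cat (mon_data.more D)"
    by (simp add: strict_words_def word_cat_def)
  then show ?thesis
    using strict_monoidal_word_cat by metis
qed

lemma rigid_strict_words: "rigid_category D"
proof -
  interpret D: strict_monoidal_category D by (rule strict_monoidal_strict_words)
  show ?thesis
  proof
    show "dual D \<I>\<^bsub>D\<^esub> = \<I>\<^bsub>D\<^esub>" "ev D \<I>\<^bsub>D\<^esub> = \<iota>\<^bsub>D\<^esub> \<I>\<^bsub>D\<^esub>" "db D \<I>\<^bsub>D\<^esub> = \<iota>\<^bsub>D\<^esub> \<I>\<^bsub>D\<^esub>"
      by simp_all
  next
    fix u assume "u \<in> Obj D"
    then have u: "u \<in> lists letters" by simp
    note e = M.exact_pairingD[OF word_exact[OF u]]
    show "dual D u \<in> Obj D" using u by simp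
    show "ev D u \<in> Hom D (dual D u \<otimes>\<^bsub>D\<^esub> u) \<I>\<^bsub>D\<^esub>"
      using word_ev_Hom[OF u] by simp
    show "db D u \<in> Hom D \<I>\<^bsub>D\<^esub> (u \<otimes>\<^bsub>D\<^esub> dual D u)"
      using word_db_Hom[OF u] by simp
    have "\<Phi>\<^bsub>D\<^esub> u (word_dual u) u = \<iota>\<^bsub>M\<^esub> (u @ word_dual u @ u)" by simp
    moreover have "\<iota>\<^bsub>M\<^esub> (u @ word_dual u @ u) \<cdot>\<^bsub>M\<^esub> (word_db u \<boxtimes>\<^bsub>M\<^esub> \<iota>\<^bsub>M\<^esub> u) = word_db u \<boxtimes>\<^bsub>M\<^esub> \<iota>\<^bsub>M\<^esub> u"
      by (rule M.cmp_Idn_arr'(2)) (use e(1-8) in \<open>simp_all add: M.tens_arr M.Idn_arr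
          del: word_cat_sel(2-6,8-)\<close>)
    ultimately show "(\<iota>\<^bsub>D\<^esub> u \<boxtimes>\<^bsub>D\<^esub> ev D u) \<cdot>\<^bsub>D\<^esub> \<Phi>\<^bsub>D\<^esub> u (dual D u) u \<cdot>\<^bsub>D\<^esub> (db D u \<boxtimes>\<^bsub>D\<^esub> \<iota>\<^bsub>D\<^esub> u) = \<iota>\<^bsub>D\<^esub> u"
      using e(9) by (simp del: word_cat_sel)
    have "inv_arr D (\<Phi>\<^bsub>D\<^esub> (word_dual u) u (word_dual u)) = \<iota>\<^bsub>D\<^esub> (word_dual u @ u @ word_dual u)"
      using D.inv_arr_Idn[of "word_dual u @ u @ word_dual u"] u by simp
    moreover have "\<iota>\<^bsub>M\<^esub> (word_dual u @ u @ word_dual u) \<cdot>\<^bsub>M\<^esub> (\<iota>\<^bsub>M\<^esub> (word_dual u) \<boxtimes>\<^bsub>M\<^esub> word_db u)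
        = \<iota>\<^bsub>M\<^esub> (word_dual u) \<boxtimes>\<^bsub>M\<^esub> word_db u"
      by (rule M.cmp_Idn_arr'(2)) (use e(1-8) in \<open>simp_all add: M.tens_arr M.Idn_arr
          del: word_cat_sel(2-6,8-)\<close>)
    ultimately show "(ev D u \<boxtimes>\<^bsub>D\<^esub> \<iota>\<^bsub>D\<^esub> (dual D u)) \<cdot>\<^bsub>D\<^esub> inv_arr D (\<Phi>\<^bsub>D\<^esub> (dual D u) u (dual D u))
        \<cdot>\<^bsub>D\<^esub> (\<iota>\<^bsub>D\<^esub> (dual D u) \<boxtimes>\<^bsub>D\<^esub> db D u) = \<iota>\<^bsub>D\<^esub> (dual D u)"
      using e(10) by (simp del: word_cat_sel)
  qed
qed

interpretation D: rigid_category D by (rule rigid_strict_words)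
interpretation D: strict_monoidal_category D by (rule strict_monoidal_strict_words)

text \<open>
  The evaluation of a concatenation is the nested evaluation, so the identity has the property that
  determines \<open>zeta\<close>.
\<close>
lemma zeta_strict_words:
  assumes u: "u \<in> lists letters" and v: "v \<in> lists letters"
  shows "zeta D u v = \<iota>\<^bsub>D\<^esub> (word_dual v @ word_dual u)"
proof -
  have L: "word_dual u \<in> lists letters" "word_dual v \<in> lists letters" using u v by simp_all
  have uv: "u @ v \<in> lists letters" using u v by simp
  have O: "u \<in> Obj M" "v \<in> Obj M" "word_dual u \<in> Obj M" "word_dual v \<in> Obj M"
    using u v by simp_all
  note S = M.strict_simps M.HomD[OF word_ev_Hom[OF u]] M.HomD[OF word_ev_Hom[OF v]] O
  have i: "inv_arr D (\<Phi>\<^bsub>D\<^esub> (word_dual u) u v) = \<iota>\<^bsub>M\<^esub> (word_dual u \<otimes>\<^bsub>M\<^esub> u \<otimes>\<^bsub>M\<^esub> v)"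
    using D.inv_arr_Idn[of "word_dual u @ u @ v"] u v by simp
  have p: "\<Phi>\<^bsub>D\<^esub> (word_dual v) (word_dual u) (u @ v) = \<iota>\<^bsub>M\<^esub> (word_dual v \<otimes>\<^bsub>M\<^esub> word_dual u \<otimes>\<^bsub>M\<^esub> u \<otimes>\<^bsub>M\<^esub> v)"
    by simp
  have "ev_tilde D u v = word_ev v \<cdot>\<^bsub>M\<^esub> (\<iota>\<^bsub>M\<^esub> (word_dual v) \<boxtimes>\<^bsub>M\<^esub> (word_ev u \<boxtimes>\<^bsub>M\<^esub> \<iota>\<^bsub>M\<^esub> v))
      \<cdot>\<^bsub>M\<^esub> (\<iota>\<^bsub>M\<^esub> (word_dual v) \<boxtimes>\<^bsub>M\<^esub> \<iota>\<^bsub>M\<^esub> (word_dual u \<otimes>\<^bsub>M\<^esub> u \<otimes>\<^bsub>M\<^esub> v))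
      \<cdot>\<^bsub>M\<^esub> \<iota>\<^bsub>M\<^esub> (word_dual v \<otimes>\<^bsub>M\<^esub> word_dual u \<otimes>\<^bsub>M\<^esub> u \<otimes>\<^bsub>M\<^esub> v)"
    unfolding ev_tilde_def i[symmetric] p[symmetric] by (simp only: strict_words_sel)
  also have "\<dots> = word_ev (u @ v)"
    unfolding word_ev_append[OF u v] by (simp add: S del: word_cat_sel)
  finally have e: "ev_tilde D u v = word_ev (u @ v)" .
  have "word_dual (u @ v) \<in> Obj M" "u @ v \<in> Obj M" using u v by simp_all
  then have e': "word_ev (u @ v) \<cdot>\<^bsub>M\<^esub> (\<iota>\<^bsub>M\<^esub> (word_dual (u @ v)) \<boxtimes>\<^bsub>M\<^esub> \<iota>\<^bsub>M\<^esub> (u @ v)) = word_ev (u @ v)"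
    using M.HomD[OF word_ev_Hom[OF uv]] by (simp add: M.strict_simps del: word_cat_sel word_dual_simps)
  have o: "word_dual v @ word_dual u \<in> Obj D" using u v by simp
  show ?thesis
    unfolding zeta_def strict_words_sel e
    by (rule D.mate_eqI[unfolded strict_words_sel])
      (use u v e' D.Idn_Hom[OF o] in \<open>simp_all del: word_cat_sel\<close>)
qed

text \<open>
  The equation that defines the dual \<open>g\<close> of \<open>f\<close>, rotated, defines \<open>f\<close> as the dual of \<open>g\<close>.
\<close>
lemma dual_arr_dual_arr_strict_words:
  assumes f: "f \<in> Hom D u v"
  shows "dual_arr D (dual_arr D f) = f"
proof -
  note f' = D.dual_arr[OF f]
  define g where "g = dual_arr D f"
  have uv: "u \<in> lists letters" "v \<in> lists letters"
    using D.HomE(4,5)[OF f] by simp_all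
  have g: "g \<in> Hom M (word_dual v) (word_dual u)"
    using f' by (simp add: g_def Hom_def)
  have eq: "word_ev u \<cdot>\<^bsub>M\<^esub> (g \<boxtimes>\<^bsub>M\<^esub> \<iota>\<^bsub>M\<^esub> u) = word_ev v \<cdot>\<^bsub>M\<^esub> (\<iota>\<^bsub>M\<^esub> (word_dual v) \<boxtimes>\<^bsub>M\<^esub> f)"
    using f'(4) by (simp add: g_def del: word_cat_sel)
  have fM: "f \<in> Hom M u v" using f by simp
  have I: "\<iota>\<^bsub>M\<^esub> w \<in> Hom M w w" if "w \<in> lists letters" for w
    using that M.Idn_Hom[of w] by (simp del: word_cat_sel(2-))
  have "word_ev (word_dual u) \<cdot>\<^bsub>M\<^esub> (\<iota>\<^bsub>M\<^esub> u \<boxtimes>\<^bsub>M\<^esub> g) = M.rot (word_dual v) u (word_ev u \<cdot>\<^bsub>M\<^esub> (g \<boxtimes>\<^bsub>M\<^esub> \<iota>\<^bsub>M\<^esub> u))"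
    unfolding rot_word_ev[OF uv(1), symmetric]
    by (rule M.rot_natural[OF word_ev_Hom[OF uv(1)] g I[OF uv(1)], symmetric])
  also have "\<dots> = word_ev (word_dual v) \<cdot>\<^bsub>M\<^esub> (f \<boxtimes>\<^bsub>M\<^esub> \<iota>\<^bsub>M\<^esub> (word_dual v))"
    unfolding eq rot_word_ev[OF uv(2), symmetric]
    by (rule M.rot_natural[OF word_ev_Hom[OF uv(2)] I fM]) (use uv in simp)
  finally have "word_ev (word_dual v) \<cdot>\<^bsub>M\<^esub> (f \<boxtimes>\<^bsub>M\<^esub> \<iota>\<^bsub>M\<^esub> (word_dual v))
    = word_ev (word_dual u) \<cdot>\<^bsub>M\<^esub> (\<iota>\<^bsub>M\<^esub> u \<boxtimes>\<^bsub>M\<^esub> g)" ..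
  then show ?thesis
    unfolding g_def[symmetric]
    by (intro D.dual_arr_eqI[of g "word_dual v" "word_dual u"]) (use f g in \<open>simp_all del: word_cat_sel\<close>)
qed

lemma iso_Idn_between:
  assumes "u \<in> lists letters" "v \<in> lists letters" "word_obj u = word_obj v"
  shows "is_iso D (u, \<iota> (word_obj u), v)"
  unfolding is_iso_def inverse_arrs_def
  by (rule exI[of _ "(v, \<iota> (word_obj v), u)"]) (use assms in \<open>simp add: word_cat_Arr word_cat_Hom
      word_simps Idn_Hom\<close>)

lemma strict_pivotal_strict_words: "strict_pivotal_category D"
proof -
  have ds: "mon_str (double_dual D) u v = \<iota>\<^bsub>D\<^esub> (u @ v)" if "u \<in> lists letters" "v \<in> lists letters" for u v
  proof -
    have L: "word_dual v @ word_dual u \<in> Obj D" "u @ v \<in> Obj D"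
      "word_dual u \<in> lists letters" "word_dual v \<in> lists letters" using that by simp_all
    have "dual_arr D (inv_arr D (\<iota>\<^bsub>D\<^esub> (word_dual v @ word_dual u))) = \<iota>\<^bsub>D\<^esub> (u @ v)"
      unfolding D.inv_arr_Idn[OF L(1)] D.dual_arr_Idn[OF L(1)] by simp
    moreover have "\<iota>\<^bsub>D\<^esub> (u @ v) \<cdot>\<^bsub>D\<^esub> \<iota>\<^bsub>D\<^esub> (u @ v) = \<iota>\<^bsub>D\<^esub> (u @ v)"
      by (rule D.cmp_Idn_left[OF D.Idn_Hom[OF L(2)]])
    ultimately show ?thesis
      using zeta_strict_words[OF that] zeta_strict_words[OF L(4,3)] by (simp add: double_dual_def
          del: word_cat_sel)
  qed
  have piv_strict_words: "monoidal_natural_iso D D (id_mon_fun D) (double_dual D) (piv D)"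
    unfolding monoidal_natural_iso_def natural_iso_def
  proof (intro conjI ballI)
    fix u assume u: "u \<in> Obj D"
    show "piv D u \<in> Hom D (on_obj (id_mon_fun D) u) (on_obj (double_dual D) u)"
      using D.Idn_Hom[OF u] by (simp add: id_mon_fun_def double_dual_def del: word_cat_sel)
    show "is_iso D (piv D u)"
      using iso_Idn_between[of u u] u by simp
  next
    fix f assume f: "f \<in> Arr D"
    then have "f \<in> Hom D (Dom D f) (Cod D f)" by (simp add: Hom_def)
    note g = dual_arr_dual_arr_strict_words[OF this]
    show "piv D (Cod D f) \<cdot>\<^bsub>D\<^esub> on_arr (id_mon_fun D) f = on_arr (double_dual D) f \<cdot>\<^bsub>D\<^esub> piv D (Dom D f)"
      using D.cmp_Idn_arr[OF f] g by (simp add: id_mon_fun_def double_dual_def del: word_cat_sel)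
  next
    fix u v assume u: "u \<in> Obj D" and v: "v \<in> Obj D"
    have uv: "u @ v \<in> Obj D" using u v by simp
    have "\<iota>\<^bsub>D\<^esub> (u @ v) \<cdot>\<^bsub>D\<^esub> \<iota>\<^bsub>D\<^esub> (u @ v) = \<iota>\<^bsub>D\<^esub> (u @ v)"
      by (rule D.cmp_Idn_left[OF D.Idn_Hom[OF uv]])
    then show "piv D (u \<otimes>\<^bsub>D\<^esub> v) \<cdot>\<^bsub>D\<^esub> mon_str (id_mon_fun D) u v
        = mon_str (double_dual D) u v \<cdot>\<^bsub>D\<^esub> (piv D u \<boxtimes>\<^bsub>D\<^esub> piv D v)"
      using ds D.tens_Idn[OF u v] u v by (simp add: id_mon_fun_def del: word_cat_sel)
  next
    show "piv D \<I>\<^bsub>D\<^esub> = \<iota>\<^bsub>D\<^esub> \<I>\<^bsub>D\<^esub>" by simp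
  qed
  show ?thesis
  proof (intro strict_pivotal_category.intro pivotal_category.intro strict_monoidal_strict_words
      rigid_strict_words)
    show "pivotal_category_axioms D" using piv_strict_words by unfold_locales
    show "strict_pivotal_category_axioms D"
      by unfold_locales (simp_all add: zeta_strict_words)
  qed
qed


section \<open>The equivalence\<close>

text \<open>
  The unit goes to the empty word and not to a one-letter word, since a monoidal functor is required
  to preserve the unit strictly.
\<close>
definition word :: "'o \<Rightarrow> ('o \<times> bool) list" where
  "word V = (if V = \<I> then [] else [(V, True)])"

lemma word_unit [simp]: "word \<I> = []"
  by (simp add: word_def)

lemma word_lists: "V \<in> Obj C \<Longrightarrow> word V \<in> lists letters"
  by (simp add: word_def letters_def)

lemma word_obj_word: "V \<in> Obj C \<Longrightarrow> word_obj (word V) = V"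
  by (simp add: word_def letter_def mon_simps)

lemma word_obj_word_append: "V \<in> Obj C \<Longrightarrow> u \<in> lists letters \<Longrightarrow> word_obj (word V @ u) = V \<otimes> word_obj u"
  by (simp add: word_def letter_def mon_simps word_obj_Obj)

lemma \<mu>_word: "V \<in> Obj C \<Longrightarrow> u \<in> lists letters \<Longrightarrow> \<mu> (word V) u = \<iota> (V \<otimes> word_obj u)"
  by (simp add: word_def letter_def letters_def mon_simps word_obj_Obj triangle)

lemma \<nu>_word: "V \<in> Obj C \<Longrightarrow> u \<in> lists letters \<Longrightarrow> \<nu> (word V) u = \<iota> (V \<otimes> word_obj u)"
  by (simp add: word_def letter_def letters_def mon_simps word_obj_Obj triangle inv_arr_Idn)

text \<open>
  Here the associator of \<open>C\<close> reappears: it is the monoidal coherence of the functor to words. If \<open>U\<close> is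
  the unit, the word is shorter, but the associator is an identity too.
\<close>
lemma \<nu>_word_word:
  assumes "U \<in> Obj C" "V \<in> Obj C" "u \<in> lists letters"
  shows "\<nu> (word U @ word V) u = inv_arr C (\<Phi> U V (word_obj u))"
  using assms
  by (cases "U = \<I>") (simp_all add: \<nu>_word assoc_unit_left inv_arr_Idn mon_simps word_obj_Obj word_obj_word,
      simp add: word_def[of U] letter_def mon_simps word_obj_Obj word_obj_word \<nu>_word)

text \<open>
  An arrow keeps its underlying arrow of \<open>C\<close>, and the monoidal structure has identities of \<open>C\<close>
  underlying it, although its source and target words differ.
\<close>
definition word_functor :: "('o, 'a, ('o \<times> bool) list, ('o \<times> bool) list \<times> 'a \<times> ('o \<times> bool) list)
    mon_fun_data" where
  "word_functor = \<lparr>on_obj = word,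
    on_arr = (\<lambda>f. (word (Dom C f), f, word (Cod C f))),
    mon_str = (\<lambda>V X. (word V @ word X, \<iota> (V \<otimes> X), word (V \<otimes> X)))\<rparr>"

lemma word_functor_sel [simp]:
  "on_obj word_functor = word"
  "on_arr word_functor f = (word (Dom C f), f, word (Cod C f))"
  "mon_str word_functor V X = (word V @ word X, \<iota> (V \<otimes> X), word (V \<otimes> X))"
  by (simp_all add: word_functor_def)

lemmas word_functor_simps = mon_simps word_lists word_obj_word word_obj_word_append \<mu>_word \<nu>_word
    Dom_Obj Cod_Obj

lemma is_functor_word_functor: "is_functor C D word_functor"
  unfolding is_functor_def
  by (auto simp: word_cat_Hom word_functor_simps intro: HomI)

lemma monoidal_functor_word_functor: "is_monoidal_functor C D word_functor"
  unfolding is_monoidal_functor_def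
proof (intro conjI ballI is_functor_word_functor)
  show "on_obj word_functor \<I> = \<I>\<^bsub>D\<^esub>" by simp
  show "mon_str word_functor V X \<in> Hom D (on_obj word_functor V \<otimes>\<^bsub>D\<^esub> on_obj word_functor X) (on_obj
      word_functor (V \<otimes> X))"
    if "V \<in> Obj C" "X \<in> Obj C" for V X
    using that by (simp add: word_cat_Hom word_functor_simps Idn_Hom)
  show "is_iso D (mon_str word_functor V X)" if "V \<in> Obj C" "X \<in> Obj C" for V X
    using iso_Idn_between[of "word V @ word X" "word (V \<otimes> X)"] that by (simp add: word_functor_simps)
  show "mon_str word_functor (Cod C f) (Cod C g) \<cdot>\<^bsub>D\<^esub> (on_arr word_functor f \<boxtimes>\<^bsub>D\<^esub> on_arr word_functor g)
      = on_arr word_functor (f \<boxtimes> g) \<cdot>\<^bsub>D\<^esub> mon_str word_functor (Dom C f) (Dom C g)" if "f \<in> Arr C"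
          "g \<in> Arr C" for f g
    using that by (simp add: word_functor_simps)
  show "on_arr word_functor (\<Phi> U V X) \<cdot>\<^bsub>D\<^esub> mon_str word_functor (U \<otimes> V) X
      \<cdot>\<^bsub>D\<^esub> (mon_str word_functor U V \<boxtimes>\<^bsub>D\<^esub> \<iota>\<^bsub>D\<^esub> (on_obj word_functor X))
      = mon_str word_functor U (V \<otimes> X) \<cdot>\<^bsub>D\<^esub> (\<iota>\<^bsub>D\<^esub> (on_obj word_functor U) \<boxtimes>\<^bsub>D\<^esub> mon_str word_functor V X)
        \<cdot>\<^bsub>D\<^esub> \<Phi>\<^bsub>D\<^esub> (on_obj word_functor U) (on_obj word_functor V) (on_obj word_functor X)"
    if "U \<in> Obj C" "V \<in> Obj C" "X \<in> Obj C" for U V X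
    using that by (simp add: word_functor_simps \<nu>_word_word inv_assoc_arr)
  show "mon_str word_functor V \<I> = \<iota>\<^bsub>D\<^esub> (on_obj word_functor V)" "mon_str word_functor \<I> V
      = \<iota>\<^bsub>D\<^esub> (on_obj word_functor V)" if "V \<in> Obj C" for V
    using that by (simp_all add: word_functor_simps)
qed


text \<open>
  A quasi-inverse sends a word to its product and an arrow to its underlying arrow.
\<close>
lemma equivalence_word_functor: "is_equivalence C D word_functor"
proof -
  let ?G = "\<lparr>on_obj = word_obj, on_arr = (\<lambda>(u, f, v). f)\<rparr>"
  have "is_functor D C ?G"
    unfolding is_functor_def by (auto simp: word_cat_Arr word_obj_Obj)
  moreover have "natural_iso C C id_fun (comp_fun ?G word_functor) (Idn C)"
  proof -
    have "is_iso C (\<iota> V)" if "V \<in> Obj C" for V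
      unfolding is_iso_def inverse_arrs_def
      by (rule exI[of _ "\<iota> V"]) (use that in \<open>simp add: mon_simps Idn_Hom\<close>)
    then show ?thesis
      by (auto simp: natural_iso_def id_fun_def comp_fun_def word_obj_word Idn_Hom mon_simps)
  qed
  moreover have "natural_iso D D (comp_fun word_functor ?G) id_fun (\<lambda>u. (word (word_obj u), \<iota>
      (word_obj u), u))"
    unfolding natural_iso_def
  proof (intro conjI ballI)
    fix u assume "u \<in> Obj D"
    then have u: "u \<in> lists letters" by simp
    show "(word (word_obj u), \<iota> (word_obj u), u) \<in> Hom D (on_obj (comp_fun word_functor ?G) u)
        (on_obj id_fun u)"
      using u by (simp add: word_cat_Hom comp_fun_def id_fun_def word_lists word_obj_Obj
          word_obj_word Idn_Hom)
    show "is_iso D (word (word_obj u), \<iota> (word_obj u), u)"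
      using iso_Idn_between[of "word (word_obj u)" u] u by (simp add: word_lists word_obj_Obj word_obj_word)
  next
    fix f assume "f \<in> Arr D"
    then obtain u f0 v where f: "f = (u, f0, v)" "f0 \<in> Hom C (word_obj u) (word_obj v)"
      by (cases f) (auto simp: word_cat_Arr)
    show "(word (word_obj (Cod D f)), \<iota> (word_obj (Cod D f)), Cod D f)
        \<cdot>\<^bsub>D\<^esub> on_arr (comp_fun word_functor ?G) f
        = on_arr id_fun f \<cdot>\<^bsub>D\<^esub> (word (word_obj (Dom D f)), \<iota> (word_obj (Dom D f)), Dom D f)"
      using HomD[OF f(2)] by (simp add: f(1) comp_fun_def id_fun_def mon_simps)
  qed
  ultimately show ?thesis
    unfolding is_equivalence_def using is_functor_word_functor by blast
qed

text \<open>
  These hold for the empty word too, as the dual of the unit is the unit.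
\<close>
lemma word_dual_word:
  assumes "V \<in> Obj C"
  shows "word_obj (word_dual (word V)) = dual C V"
    "u \<in> lists letters \<Longrightarrow> \<mu> (word_dual (word V)) u = \<iota> (dual C V \<otimes> word_obj u)"
    "u \<in> lists letters \<Longrightarrow> \<nu> (word_dual (word V)) u = \<iota> (dual C V \<otimes> word_obj u)"
    "u \<in> lists letters \<Longrightarrow> word_obj (word_dual (word V) @ u) = dual C V \<otimes> word_obj u"
  using assms
  by (simp_all add: word_def letter_def letters_def mon_simps word_obj_Obj dual_Obj triangle
      inv_arr_Idn dual_unit)

lemma word_ev_word:
  assumes V: "V \<in> Obj C"
  shows "word_ev (word V) = (word_dual (word V) @ word V, ev C V, [])"
    "word_ev (word_dual (word V)) = (word V @ word_dual (word V), ev C (dual C V)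
        \<cdot> (piv C V \<boxtimes> \<iota> (dual C V)), [])"
proof -
  have single: "word_ev [l] = letter_ev l" if "l \<in> letters" for l
  proof -
    have "word_ev [l] = \<iota>\<^bsub>M\<^esub> \<I>\<^bsub>M\<^esub> \<cdot>\<^bsub>M\<^esub> (\<iota>\<^bsub>M\<^esub> \<I>\<^bsub>M\<^esub> \<boxtimes>\<^bsub>M\<^esub> (letter_ev l \<boxtimes>\<^bsub>M\<^esub> \<iota>\<^bsub>M\<^esub> \<I>\<^bsub>M\<^esub>))"
      by simp
    then show ?thesis
      using letter_ev_Hom[OF that] by (simp add: M.strict_simps Hom_def[of M] del: word_cat_sel)
  qed
  have L: "(V, True) \<in> letters" "(V, False) \<in> letters" using V by (simp_all add: letters_def)
  show "word_ev (word V) = (word_dual (word V) @ word V, ev C V, [])"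
  proof (cases "V = \<I>")
    case False
    then show ?thesis using single[OF L(1)] by (simp add: word_def letter_ev_def del: word_ev.simps)
  qed (simp add: ev_unit)
  show "word_ev (word_dual (word V)) = (word V @ word_dual (word V), ev C (dual C V)
      \<cdot> (piv C V \<boxtimes> \<iota> (dual C V)), [])"
  proof (cases "V = \<I>")
    case False
    then show ?thesis
      using single[OF L(2)] by (simp add: word_def letter_ev_negative(1)[OF V] del: word_ev.simps)
  qed (simp add: ev_unit dual_unit piv_unit mon_simps)
qed

text \<open>
  The canonical arrow \<open>xi_tilde\<close> has an identity of \<open>C\<close> underlying it. The claim therefore reduces to the
  formula for the evaluation of a negative letter, which contains the pivotal structure of \<open>C\<close>.
\<close>
lemma preserves_pivotal_word_functor: "preserves_pivotal C D word_functor"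
  unfolding preserves_pivotal_def
proof
  have xi: "xi_tilde C D word_functor V = (word (dual C V), \<iota> (dual C V), word_dual (word V))" if V:
      "V \<in> Obj C" for V
    unfolding xi_tilde_def
  proof (rule D.mate_eqI)
    note S = V word_functor_simps dual_Obj word_dual_word word_ev_word ev_arr
    show "on_obj word_functor (dual C V) \<in> Obj D" "on_obj word_functor V \<in> Obj D"
      "(word (dual C V), \<iota> (dual C V), word_dual (word V)) \<in> Hom D (on_obj word_functor (dual C V))
          (dual D (on_obj word_functor V))"
      using V by (simp_all add: S word_cat_Hom Idn_Hom)
    show "ev D (on_obj word_functor V) \<cdot>\<^bsub>D\<^esub> ((word (dual C V), \<iota> (dual C V), word_dual (word V))
        \<boxtimes>\<^bsub>D\<^esub> \<iota>\<^bsub>D\<^esub> (on_obj word_functor V))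
        = on_arr word_functor (ev C V) \<cdot>\<^bsub>D\<^esub> mon_str word_functor (dual C V) V"
      by (simp add: S)
  qed
  fix V assume V: "V \<in> Obj C"
  have V': "dual C V \<in> Obj C" using V by (rule dual_Obj)
  note p = HomD[OF piv_Hom[OF V]]
  note S = V V' p word_functor_simps dual_Obj word_dual_word word_ev_word ev_arr
  let ?g = "(word V, piv C V, word_dual (word (dual C V)))"
  have "dual_arr D (xi_tilde C D word_functor V) = ?g"
    unfolding xi[OF V]
  proof (rule D.dual_arr_eqI)
    show "(word (dual C V), \<iota> (dual C V), word_dual (word V)) \<in> Hom D (word (dual C V)) (word_dual
        (word V))"
      "?g \<in> Hom D (dual D (word_dual (word V))) (dual D (word (dual C V)))"
      using piv_Hom[OF V] by (simp_all add: S word_cat_Hom Idn_Hom)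
    show "ev D (word (dual C V)) \<cdot>\<^bsub>D\<^esub> (?g \<boxtimes>\<^bsub>D\<^esub> \<iota>\<^bsub>D\<^esub> (word (dual C V)))
      = ev D (word_dual (word V)) \<cdot>\<^bsub>D\<^esub>
        (\<iota>\<^bsub>D\<^esub> (dual D (word_dual (word V))) \<boxtimes>\<^bsub>D\<^esub> (word (dual C V), \<iota> (dual C V), word_dual (word V)))"
      by (simp add: S)
  qed
  then show "xi_tilde C D word_functor (dual C V) \<cdot>\<^bsub>D\<^esub> on_arr word_functor (piv C V)
      = dual_arr D (xi_tilde C D word_functor V) \<cdot>\<^bsub>D\<^esub> piv D (on_obj word_functor V)"
    by (simp add: xi[OF V'] S)
qed

end

theorem theorem2p2:
  fixes C :: "('o, 'a) pivotal_data"
  assumes "pivotal_category C"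
  shows "\<exists>(D :: ('o signed_words, ('o, 'a) word_arrows) pivotal_data)
          (F :: ('o, 'a, 'o signed_words, ('o, 'a) word_arrows) mon_fun_data).
        strict_pivotal_category D \<and>
        is_monoidal_functor C D F \<and>
        is_equivalence C D F \<and>
        preserves_pivotal C D F"
proof -
  interpret pivotal_category C by (rule assms)
  show ?thesis
    using strict_pivotal_strict_words monoidal_functor_word_functor equivalence_word_functor
        preserves_pivotal_word_functor by blast
qed

end
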